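(* Let $n \geq 3$ be an integer. Then the following hold. (1) $m^m(3,2)=1$, and $\mu_3^{m}(B) = m^m(3,2)$ for $B \in \mathcal{K}^2_o$ whenever $B$ is a parallelogram. (2) If $n \geq 4$, then $m^m(n,2) = 2$, and $\mu_n^{m}(B) = m^m(n,2)$ for $B \in \mathcal{K}^2_o$ whenever $B$ is a parallelogram. (3) $M^m(4,2) = 2$, and $\mu_4^{m}(B) = M^m(4,2)$ for every $B \in \mathcal{K}^2_o$. (4) If $n \geq 6$ is even, and $n'$ denotes the largest positive integer with $n' \leq n$ and $n' \equiv 2 \pmod 4$, then $$M^m(n,2) = \frac{n' \sin \frac{2 \pi}{n'} }{2 \sin \frac{(n'-2)\pi}{2n'}},$$ and $\mu_n^{m}(B) = M^m(n,2)$ for $B\in\mathcal{K}^2_o$ whenever $B$ is an affinely regular $n'$-gon.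
   Context: $\lambda_2$ denotes area (Lebesgue measure) in $\mathbb{R}^2$; $o$ is the origin. $\mathcal{K}^2_o$ is the family of $o$-symmetric convex bodies (compact convex sets with nonempty interior) in $\mathbb{R}^2$. A polygon is affinely regular if it is the image of a regular polygon under a nondegenerate affine transformation. For $B\in\mathcal{K}^2_o$, let $I(B)$ be a maximum area cross-polytope inscribed in $B$, i.e. a maximum area $o$-symmetric parallelogram $\operatorname{conv}\{\pm x,\pm y\}$ contained in $B$. Gromov's mass of a set $S\subset\mathbb{R}^2$ in the normed plane with unit disk $B$ is the multiple of Lebesgue measure normalized so that $I(B)$ has measure $\frac{2^2}{2!}=2$, i.e. $\operatorname{vol}^{m}_B(S)=\frac{2\lambda_2(S)}{\lambda_2(I(B))}$. For $n\ge 3$, $$\mu_n^{m}(B)=\sup\{\operatorname{vol}_B^{m}(Q): Q \text{ is a convex polygon contained in } B \text{ with at most } n \text{ vertices}\},$$ $m^{m}(n,2)=\inf\{\mu_n^{m}(B): B\in\mathcal{K}^2_o\}$ and $M^{m}(n,2)=\sup\{\mu_n^{m}(B): B\in\mathcal{K}^2_o\}$. *)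

theory Defs
  imports "HOL-Analysis.Analysis"
begin

abbreviation area :: "(real^2) set \<Rightarrow> real" where
  "area S \<equiv> measure lebesgue S"

definition symmetric_bodies :: "(real^2) set set" where
  "symmetric_bodies = {B. compact B \<and> convex B \<and> interior B \<noteq> {} \<and> uminus ` B = B}"

definition cross_polytope :: "(real^2) set \<Rightarrow> bool" where
  "cross_polytope P \<longleftrightarrow>
     (\<exists>x y. x \<noteq> y \<and> independent {x, y} \<and> P = convex hull {x, - x, y, - y})"

text \<open>For a symmetric convex body a maximum exists by compactness. A maximizer need not be
  unique, but only its area enters below, which does not depend on the choice.\<close>

definition max_cross_polytope :: "(real^2) set \<Rightarrow> (real^2) set" where
  "max_cross_polytope B = (ARG_MAX area P. cross_polytope P \<and> P \<subseteq> B)"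

definition mass :: "(real^2) set \<Rightarrow> (real^2) set \<Rightarrow> real" where
  "mass B S = 2 * area S / area (max_cross_polytope B)"

text \<open>In the plane, a convex polygon is a polytope with nonempty interior; its vertices are its
  extreme points (finitely many, so the cardinality is meaningful).\<close>

definition convex_polygon :: "(real^2) set \<Rightarrow> bool" where
  "convex_polygon Q \<longleftrightarrow> polytope Q \<and> interior Q \<noteq> {}"

definition vertices :: "(real^2) set \<Rightarrow> (real^2) set" where
  "vertices Q = {v. v extreme_point_of Q}"

text \<open>The extrema are taken in the extended reals, so that no boundedness is presupposed.\<close>

definition mu_mass :: "nat \<Rightarrow> (real^2) set \<Rightarrow> ereal" where
  "mu_mass n B =
     (SUP Q \<in> {Q. convex_polygon Q \<and> Q \<subseteq> B \<and> card (vertices Q) \<le> n}. ereal (mass B Q))"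

definition inf_mass :: "nat \<Rightarrow> ereal" where
  "inf_mass n = (INF B \<in> symmetric_bodies. mu_mass n B)"

definition sup_mass :: "nat \<Rightarrow> ereal" where
  "sup_mass n = (SUP B \<in> symmetric_bodies. mu_mass n B)"

definition parallelogram :: "(real^2) set \<Rightarrow> bool" where
  "parallelogram P \<longleftrightarrow>
     (\<exists>p u v. u \<noteq> v \<and> independent {u, v} \<and> P = convex hull {p, p + u, p + u + v, p + v})"

definition regular_polygon :: "nat \<Rightarrow> (real^2) set \<Rightarrow> bool" where
  "regular_polygon k P \<longleftrightarrow> k \<ge> 3 \<and>
     (\<exists>(c :: real^2) (r :: real) (t :: real). r > 0 \<and>
        P = convex hull ((\<lambda>j. c + r *\<^sub>R vector [cos (t + 2 * pi * real j / real k),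
                                             sin (t + 2 * pi * real j / real k)]) ` {..<k}))"

definition affinely_regular :: "nat \<Rightarrow> (real^2) set \<Rightarrow> bool" where
  "affinely_regular k P \<longleftrightarrow>
     (\<exists>(A :: real^2^2) b R. invertible A \<and> regular_polygon k R \<and> P = (\<lambda>x. A *v x + b) ` R)"

end

theory Submission
  imports Defs
begin

text \<open>Normalise a symmetric body so that \<open>x\<^sub>1 y\<^sub>2 - x\<^sub>2 y\<^sub>1\<close> has maximum 1 on it; then the mass of a polygon
  is its area. For an inscribed polygon with \<open>2m\<close> vertices around the origin, move the vertices
  radially to the boundary, merge them with their reflections in angular order, and take every
  second point: this gives two symmetric \<open>2m\<close>-gons, and the Monge property of convex position
  shows that their areas add up to at least twice the original area (Dowker). If the origin is
  not interior to the polygon, its area is at most half that of the body, hence at most 2.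

  For symmetric \<open>2m\<close>-gons with all wedges at most 1, consider one of maximal area. Deleting a vertex
  must decrease the area, so it is strictly convex, and moving a vertex shows that each vertex has
  two tight partners. This rigidity makes the polygon equal to its rotated polar (a Radon curve)
  and forces \<open>m\<close> to be odd. The polygonal Blaschke-Santalo inequality, proved by inserting points of
  a circle into the quadratic form whose null vectors are the coordinates of the polygon, bounds
  its area by \<open>2m sin (pi / 2m)\<close>, the value attained by regular polygons.\<close>

section \<open>Antiperiodic sequences in the plane\<close>

text \<open>Convexity is recovered only for a hypothetical counterexample of maximal area: by
  induction on \<open>m\<close> it beats every configuration with fewer vertices. Area is affine in
  each single vertex, so maximality alone does not forbid sliding a vertex in a direction of
  constant area; to exclude this, the sum of squared wedges is maximised among the area maximisers.
  No rigid configuration has even \<open>m\<close>, which is why the extremal value depends on n'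
  and not on n. The Blaschke-Santalo inequality bounds the product of the areas of a polygon and its
  polar; it gives a bound on a single area because a Radon polygon coincides with its rotated polar.
  Dowker's averaging is needed because an inscribed polygon need not be symmetric, whereas the
  extremal analysis relies on antipodal vertices throughout.\<close>

definition wedge :: "real^2 \<Rightarrow> real^2 \<Rightarrow> real" where
  "wedge x y = x$1 * y$2 - x$2 * y$1"

lemma wedge_add_left: "wedge (x + y) z = wedge x z + wedge y z"
  and wedge_add_right: "wedge z (x + y) = wedge z x + wedge z y"
  and wedge_diff_left: "wedge (x - y) z = wedge x z - wedge y z"
  and wedge_diff_right: "wedge z (x - y) = wedge z x - wedge z y"
  and wedge_scaleR_left [simp]: "wedge (c *\<^sub>R x) z = c * wedge x z"
  and wedge_scaleR_right [simp]: "wedge z (c *\<^sub>R x) = c * wedge z x"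
  and wedge_minus_left [simp]: "wedge (- x) z = - wedge x z"
  and wedge_minus_right [simp]: "wedge z (- x) = - wedge z x"
  and wedge_self [simp]: "wedge x x = 0"
  and wedge_zero_left [simp]: "wedge 0 x = 0"
  and wedge_zero_right [simp]: "wedge x 0 = 0"
  by (simp_all add: wedge_def algebra_simps)

lemmas wedge_linear = wedge_add_left wedge_add_right wedge_diff_left wedge_diff_right

lemma wedge_commute: "wedge x y = - wedge y x"
  by (simp add: wedge_def)

lemma vec2_eq_iff: "(x::real^2) = y \<longleftrightarrow> x$1 = y$1 \<and> x$2 = y$2"
  by (simp add: vec_eq_iff forall_2)

text \<open>Cramer's rule without division: for independent \<open>a\<close>, \<open>b\<close> it
  yields the coordinates of \<open>c\<close> as quotients of wedges.\<close>

lemma wedge_expand: "wedge a b *\<^sub>R c = wedge c b *\<^sub>R a + wedge a c *\<^sub>R b"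
  by (simp add: vec2_eq_iff wedge_def algebra_simps)

lemma wedge_eq_0_imp_scaleR:
  assumes "wedge x y = 0" "x \<noteq> 0"
  obtains c where "y = c *\<^sub>R x"
proof (cases "x$1 = 0")
  case True
  then have x2: "x$2 \<noteq> 0" using assms(2) by (auto simp: vec2_eq_iff)
  have "y = (y$2 / x$2) *\<^sub>R x"
    using assms(1) True x2 by (simp add: vec2_eq_iff wedge_def)
  then show ?thesis by (rule that)
next
  case False
  have "y = (y$1 / x$1) *\<^sub>R x"
    using assms(1) False by (simp add: vec2_eq_iff wedge_def field_simps)
  then show ?thesis by (rule that)
qed

lemma wedge_nonzero_exists: "x \<noteq> 0 \<Longrightarrow> \<exists>q. wedge q x = 1"
proof -
  assume "x \<noteq> 0"
  then have n: "x$1 * x$1 + x$2 * x$2 \<noteq> 0"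
    by (auto simp: vec2_eq_iff sum_squares_eq_zero_iff)
  have "wedge ((1 / (x$1 * x$1 + x$2 * x$2)) *\<^sub>R vector [x$2, - x$1]) x = 1"
    using n by (simp add: wedge_def divide_simps)
  then show ?thesis by blast
qed

lemma continuous_on_wedge [continuous_intros]:
  assumes "continuous_on S f" "continuous_on S g"
  shows "continuous_on S (\<lambda>x. wedge (f x) (g x))"
  unfolding wedge_def using assms by (intro continuous_intros)

lemma sum_periodic_shift:
  fixes g :: "int \<Rightarrow> 'a::ab_group_add"
  assumes m: "0 \<le> m" and per: "\<And>i. g (i + m) = g i"
  shows "sum g {a..<a + m} = sum g {0..<m}"
proof -
  have step: "sum g {a + 1..<a + 1 + m} = sum g {a..<a + m}" for a
  proof (cases "m = 0")
    case False
    have 1: "{a..<a + m + 1} = insert (a + m) {a..<a + m}" using m by auto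
    have 2: "{a..<a + m + 1} = insert a {a + 1..<a + 1 + m}" using m by auto
    have "g (a + m) + sum g {a..<a + m} = g a + sum g {a + 1..<a + 1 + m}"
      using arg_cong[OF 1, of "sum g"] unfolding 2 by simp
    then show ?thesis by (simp add: per)
  qed auto
  show ?thesis
  proof (induction a rule: int_induct[where k = 0])
    case base
    show ?case by simp
  next
    case (step1 i)
    then show ?case using step[of i] by simp
  next
    case (step2 i)
    then show ?case using step[of "i - 1"] by simp
  qed
qed

text \<open>Encodes a symmetric 2m-gon by integer indices, with antipodes \<open>m\<close> steps
  apart, so that cyclic index arithmetic needs no \<open>mod\<close>.\<close>

definition antiperiodic :: "int \<Rightarrow> (int \<Rightarrow> 'a::uminus) \<Rightarrow> bool" where
  "antiperiodic m p \<longleftrightarrow> (\<forall>i. p (i + m) = - p i)"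

lemma antiperiodicD: "antiperiodic m p \<Longrightarrow> p (i + m) = - p i"
  by (simp add: antiperiodic_def)

lemma antiperiodic_minusD: "antiperiodic m (p :: int \<Rightarrow> 'a::group_add) \<Longrightarrow> p (i - m) = - p i"
  by (metis add_diff_cancel_right' antiperiodic_def add.inverse_inverse diff_add_cancel)

definition antiperiodic_extension :: "int \<Rightarrow> (int \<Rightarrow> 'a) \<Rightarrow> int \<Rightarrow> 'a::uminus" where
  "antiperiodic_extension m f i = (if even (i div m) then f (i mod m) else - f (i mod m))"

lemma antiperiodic_extension:
  fixes f :: "int \<Rightarrow> 'a::group_add"
  shows "m > 0 \<Longrightarrow> antiperiodic m (antiperiodic_extension m f)"
  by (auto simp: antiperiodic_def antiperiodic_extension_def)

lemma antiperiodic_extension_base: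
  "0 \<le> i \<Longrightarrow> i < m \<Longrightarrow> antiperiodic_extension m f i = f i"
  by (simp add: antiperiodic_extension_def)

text \<open>Two indices less than \<open>m\<close> apart lie in the same or in adjacent blocks. In
  adjacent blocks the residues come in reversed order and one point is negated; the two sign changes
  cancel.\<close>

lemma wedge_antiperiodic_extension:
  assumes m: "m > 0" and ij: "i < j" "j < i + m"
    and P: "\<And>i j. 0 \<le> i \<Longrightarrow> i < j \<Longrightarrow> j < m \<Longrightarrow> P (wedge (f i) (f j))"
  shows "P (wedge (antiperiodic_extension m f i) (antiperiodic_extension m f j))"
proof -
  define a r b s where "a = i div m" and "r = i mod m" and "b = j div m" and "s = j mod m"
  have i: "i = a * m + r" and j: "j = b * m + s" by (simp_all add: a_def r_def b_def s_def)
  have r: "0 \<le> r" "r < m" "0 \<le> s" "s < m" using m by (auto simp: r_def s_def)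
  have "a \<le> b" unfolding a_def b_def using ij m by (simp add: zdiv_mono1)
  moreover have "b \<le> (i + m) div m" unfolding b_def using ij m by (intro zdiv_mono1) auto
  then have "b \<le> a + 1" using m by (simp add: a_def)
  ultimately consider "b = a" | "b = a + 1" by linarith
  then show ?thesis
  proof cases
    case 1
    then have "r < s" using i j ij by simp
    then have "P (wedge (f r) (f s))" using P r by blast
    then show ?thesis using 1
      by (simp add: antiperiodic_extension_def flip: a_def b_def r_def s_def)
  next
    case 2
    have "j = a * m + m + s" using j 2 by (simp add: algebra_simps)
    then have "s < r" using i ij by linarith
    then have "P (wedge (f s) (f r))" using P r by blast
    then show ?thesis using 2 wedge_commute[of "f r"]
      by (auto simp add: antiperiodic_extension_def simp flip: a_def b_def r_def s_def)
  qed
qed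

text \<open>Repeated points and zero are allowed, which gives closedness and makes it harmless to
  pad a vertex list. Pairs less than half a turn apart suffice, since antipodes are
  parallel.\<close>

definition admissible :: "int \<Rightarrow> (int \<Rightarrow> real^2) \<Rightarrow> bool" where
  "admissible m p \<longleftrightarrow> antiperiodic m p \<and>
     (\<forall>i j. i < j \<and> j < i + m \<longrightarrow> 0 \<le> wedge (p i) (p j) \<and> wedge (p i) (p j) \<le> 1)"

text \<open>The fan triangles of half a turn, each counted with twice its area; by symmetry this is
  the area of the whole 2m-gon.\<close>

definition half_area :: "int \<Rightarrow> (int \<Rightarrow> real^2) \<Rightarrow> real" where
  "half_area m p = (\<Sum>i\<in>{0..<m}. wedge (p i) (p (i + 1)))"

lemma admissible_antiperiodic: "admissible m p \<Longrightarrow> antiperiodic m p"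
  by (simp add: admissible_def)

lemma admissible_bounds:
  assumes "admissible m p" "i \<le> j" "j \<le> i + m"
  shows "0 \<le> wedge (p i) (p j)" "wedge (p i) (p j) \<le> 1"
  using assms antiperiodicD[OF admissible_antiperiodic[OF assms(1)], of i]
  by (auto simp: admissible_def le_less)

lemma admissible_extension:
  assumes "m > 0"
    and "\<And>i j. 0 \<le> i \<Longrightarrow> i < j \<Longrightarrow> j < m \<Longrightarrow> 0 \<le> wedge (f i) (f j) \<and> wedge (f i) (f j) \<le> 1"
  shows "admissible m (antiperiodic_extension m f)"
  unfolding admissible_def
  using antiperiodic_extension[OF assms(1)] assms(2)
    wedge_antiperiodic_extension[OF assms(1), where P = "\<lambda>x. 0 \<le> x \<and> x \<le> 1" and f = f]
  by blast

lemma half_area_shift: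
  assumes "0 \<le> m" "antiperiodic m p"
  shows "(\<Sum>i\<in>{a..<a + m}. wedge (p i) (p (i + 1))) = half_area m p"
  unfolding half_area_def
proof (rule sum_periodic_shift[OF assms(1)])
  fix i
  have "p (i + m + 1) = - p (i + 1)" using antiperiodicD[OF assms(2), of "i + 1"] by (simp add: ac_simps)
  then show "wedge (p (i + m)) (p (i + m + 1)) = wedge (p i) (p (i + 1))"
    using antiperiodicD[OF assms(2), of i] by simp
qed

section \<open>A polygonal Blaschke-Santalo inequality\<close>

text \<open>Summation by parts; there is no boundary term because the product of two antiperiodic
  functions is periodic.\<close>

lemma abel_antiperiodic:
  fixes f g :: "int \<Rightarrow> real"
  assumes m: "0 \<le> m" and f: "antiperiodic m f" and g: "antiperiodic m g"
  shows "(\<Sum>s\<in>{0..<m}. (f (s + 1) - f s) * g s) = (\<Sum>s\<in>{0..<m}. f s * (g (s - 1) - g s))"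
proof -
  have "(\<Sum>s\<in>{0..<m}. f (s + 1) * g s) = (\<Sum>s\<in>{1..<1 + m}. f s * g (s - 1))"
    by (rule sum.reindex_bij_witness[where j = "\<lambda>s. s + 1" and i = "\<lambda>s. s - 1"]) auto
  also have "\<dots> = (\<Sum>s\<in>{0..<m}. f s * g (s - 1))"
  proof (rule sum_periodic_shift[OF m])
    fix i
    have "g (i + m - 1) = - g (i - 1)"
      using antiperiodicD[OF g, of "i - 1"] by (simp add: algebra_simps)
    then show "f (i + m) * g (i + m - 1) = f i * g (i - 1)"
      using antiperiodicD[OF f, of i] by simp
  qed
  finally show ?thesis by (simp add: left_diff_distrib right_diff_distrib sum_subtractf)
qed

text \<open>The components of \<^term>\<open>p\<close> are null vectors of the quadratic form. Subtracting one of them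
  makes \<^term>\<open>u\<close> vanish at \<^term>\<open>0::int\<close>, and then completing squares relative to the null
  vector \<open>wedge (p 0) (p s)\<close>, which is positive for \<open>0 < s < m\<close>, shows that the form is
  nonnegative.\<close>

lemma antiperiodic_ground_state:
  fixes p :: "int \<Rightarrow> real^2" and a c u :: "int \<Rightarrow> real"
  assumes m: "m \<ge> 2" and p: "antiperiodic m p"
    and pos: "\<And>i j. i < j \<Longrightarrow> j < i + m \<Longrightarrow> 0 < wedge (p i) (p j)"
    and a: "\<And>s. a s > 0" and aper: "\<And>s. a (s + m) = a s"
    and w: "\<And>s. p (s + 1) - p s = a s *\<^sub>R w s"
    and c: "\<And>s. w (s - 1) - w s = c s *\<^sub>R p s"
    and u: "antiperiodic m u"
  shows "(\<Sum>s\<in>{0..<m}. c s * (u s)\<^sup>2) \<le> (\<Sum>s\<in>{0..<m}. (u (s + 1) - u s)\<^sup>2 / a s)"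
proof -
  have m0: "0 \<le> m" using m by simp
  have wper: "antiperiodic m w"
    unfolding antiperiodic_def
  proof
    fix s
    have "a (s + m) *\<^sub>R w (s + m) = - (a s *\<^sub>R w s)"
      using antiperiodicD[OF p, of s] antiperiodicD[OF p, of "s + 1"]
      by (simp add: ac_simps flip: w)
    then have "a s *\<^sub>R w (s + m) = a s *\<^sub>R (- w s)" by (simp add: aper)
    then show "w (s + m) = - w s" using a[of s] by (metis order_less_irrefl real_vector.scale_left_imp_eq)
  qed
  have "p 0 \<noteq> 0" using pos[of 0 1] m by auto
  then obtain q where q: "wedge q (p 0) = 1" using wedge_nonzero_exists by blast
  define h where "h s = u 0 * wedge q (p s)" for s
  define \<eta> where "\<eta> s = u 0 * wedge q (w s)" for s
  define g where "g s = u s - h s" for s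
  define v where "v s = wedge (p 0) (p s)" for s
  define \<omega> where "\<omega> s = wedge (p 0) (w s)" for s
  define r where "r s = g s / v s" for s
  define \<phi> where "\<phi> s = (r s)\<^sup>2 * v s" for s
  have hper: "antiperiodic m h" and eper: "antiperiodic m \<eta>" and vper: "antiperiodic m v" and oper: "antiperiodic m \<omega>"
    using antiperiodicD[OF p] antiperiodicD[OF wper]
    by (simp_all add: antiperiodic_def h_def \<eta>_def v_def \<omega>_def)
  have gper: "antiperiodic m g"
    using antiperiodicD[OF hper] antiperiodicD[OF u] by (simp add: antiperiodic_def g_def)
  have rper: "r (s + m) = r s" for s
    using antiperiodicD[OF gper, of s] antiperiodicD[OF vper, of s] by (simp add: r_def)
  have phper: "antiperiodic m \<phi>"
    using rper antiperiodicD[OF vper] by (simp add: antiperiodic_def \<phi>_def)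
  have dh: "h (s + 1) - h s = a s * \<eta> s" and dv: "v (s + 1) - v s = a s * \<omega> s" for s
    using arg_cong[OF w[of s], of "wedge q"] arg_cong[OF w[of s], of "wedge (p 0)"]
    by (auto simp: h_def \<eta>_def v_def \<omega>_def wedge_linear simp flip: right_diff_distrib)
  have deta: "\<eta> (s - 1) - \<eta> s = c s * h s" and dom: "\<omega> (s - 1) - \<omega> s = c s * v s" for s
    using arg_cong[OF c[of s], of "wedge q"] arg_cong[OF c[of s], of "wedge (p 0)"]
    by (auto simp: h_def \<eta>_def v_def \<omega>_def wedge_linear simp flip: right_diff_distrib)
  have g0: "g 0 = 0" by (simp add: g_def h_def q)
  have gm: "g m = 0" using antiperiodicD[OF gper, of 0] g0 by simp
  have vpos: "0 < v s" if "0 < s" "s < m" for s using pos[of 0 s] that by (simp add: v_def)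
  have v0: "v 0 = 0" by (simp add: v_def)
  have vm: "v m = 0" using antiperiodicD[OF vper, of 0] v0 by simp
  \<comment> \<open>At \<open>s = 0\<close> and \<open>s = m\<close> the quotient \<open>r s\<close>
    is 0 by the convention for division by zero, and \<open>g s\<close> vanishes there too.\<close>
  have grv: "g s = r s * v s" if "0 \<le> s" "s \<le> m" for s
    using that vpos[of s] g0 gm by (cases "s = 0 \<or> s = m") (auto simp: r_def)
  have vnn: "0 \<le> v s" if "0 \<le> s" "s \<le> m" for s
    using that vpos[of s] v0 vm by (cases "s = 0 \<or> s = m") auto
  have "(\<Sum>s\<in>{0..<m}. c s * (g s)\<^sup>2) = (\<Sum>s\<in>{0..<m}. \<phi> s * (\<omega> (s - 1) - \<omega> s))"
    by (intro sum.cong refl) (auto simp: dom \<phi>_def grv power2_eq_square)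
  also have "\<dots> = (\<Sum>s\<in>{0..<m}. (\<phi> (s + 1) - \<phi> s) * \<omega> s)"
    using abel_antiperiodic[OF m0 phper oper] by simp
  also have "\<dots> \<le> (\<Sum>s\<in>{0..<m}. (g (s + 1) - g s)\<^sup>2 / a s)"
  proof (intro sum_mono)
    fix s assume s: "s \<in> {0..<m}"
    \<comment> \<open>A discrete Picone identity for \<open>g = r * v\<close>; the square that it
      splits off is the only loss in the estimate.\<close>
    have "(g (s + 1) - g s)\<^sup>2
        = v s * v (s + 1) * (r (s + 1) - r s)\<^sup>2 + (\<phi> (s + 1) - \<phi> s) * (v (s + 1) - v s)"
      using s grv[of s] grv[of "s + 1"] by (simp add: \<phi>_def power2_eq_square algebra_simps)
    moreover have "0 \<le> v s * v (s + 1) * (r (s + 1) - r s)\<^sup>2" using s vnn by simp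
    ultimately have "(\<phi> (s + 1) - \<phi> s) * (a s * \<omega> s) \<le> (g (s + 1) - g s)\<^sup>2" unfolding dv by linarith
    then show "(\<phi> (s + 1) - \<phi> s) * \<omega> s \<le> (g (s + 1) - g s)\<^sup>2 / a s"
      using a[of s] by (simp add: pos_le_divide_eq mult.assoc mult.commute[of "\<omega> s"])
  qed
  finally have G: "(\<Sum>s\<in>{0..<m}. c s * (g s)\<^sup>2) \<le> (\<Sum>s\<in>{0..<m}. (g (s + 1) - g s)\<^sup>2 / a s)" .
  \<comment> \<open>From \<open>u = g + h\<close> the square of \<open>u\<close> is that of
    \<open>g\<close> plus \<open>(2 * g + h) * h\<close>. The second term is summed by parts, and
    the same identity for differences reassembles \<open>u\<close> at the end.\<close>
  define f where "f s = 2 * g s + h s" for s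
  have fper: "antiperiodic m f"
    using antiperiodicD[OF hper] antiperiodicD[OF gper] by (simp add: antiperiodic_def f_def)
  have ugh: "u s = g s + h s" for s by (simp add: g_def)
  have "(\<Sum>s\<in>{0..<m}. c s * (u s)\<^sup>2) = (\<Sum>s\<in>{0..<m}. c s * (g s)\<^sup>2 + f s * (\<eta> (s - 1) - \<eta> s))"
    by (intro sum.cong refl) (simp add: deta f_def ugh power2_eq_square algebra_simps)
  also have "\<dots> = (\<Sum>s\<in>{0..<m}. c s * (g s)\<^sup>2) + (\<Sum>s\<in>{0..<m}. (f (s + 1) - f s) * \<eta> s)"
    by (simp add: sum.distrib abel_antiperiodic[OF m0 fper eper])
  also have "\<dots> \<le> (\<Sum>s\<in>{0..<m}. (g (s + 1) - g s)\<^sup>2 / a s + (f (s + 1) - f s) * \<eta> s)"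
    using G by (simp add: sum.distrib)
  also have "\<dots> = (\<Sum>s\<in>{0..<m}. (u (s + 1) - u s)\<^sup>2 / a s)"
  proof (intro sum.cong refl)
    fix s
    have \<eta>: "\<eta> s = (h (s + 1) - h s) / a s" using dh[of s] a[of s] by (simp add: field_simps)
    show "(g (s + 1) - g s)\<^sup>2 / a s + (f (s + 1) - f s) * \<eta> s = (u (s + 1) - u s)\<^sup>2 / a s"
      unfolding f_def ugh \<eta> times_divide_eq_right add_divide_distrib[symmetric]
      by (intro arg_cong[where f = "\<lambda>x. x / a s"]) (simp add: power2_eq_square algebra_simps)
  qed
  finally show ?thesis .
qed

lemma concave_on_sin: "concave_on {0..pi} sin"
  by (rule f''_le0_imp_concave[where f' = cos and f'' = "\<lambda>x. - sin x"])
     (auto intro!: derivative_eq_intros sin_ge_zero)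

text \<open>Jensen's inequality: a chain of chords along a half circle is longest when the arcs are
  equal.\<close>

lemma sum_two_sin_half_le:
  assumes "finite S" "S \<noteq> {}" and \<Delta>: "\<And>s. s \<in> S \<Longrightarrow> 0 \<le> \<Delta> s \<and> \<Delta> s \<le> pi" and sum: "sum \<Delta> S = pi"
  shows "(\<Sum>s\<in>S. 2 * sin (\<Delta> s / 2)) \<le> 2 * real (card S) * sin (pi / (2 * real (card S)))"
proof -
  have c: "real (card S) > 0" using assms(1,2) by (simp add: card_gt_0_iff)
  have "(\<Sum>s\<in>S. (1 / real (card S)) * sin (\<Delta> s / 2)) \<le> sin (\<Sum>s\<in>S. (1 / real (card S)) *\<^sub>R (\<Delta> s / 2))"
    using c \<Delta> pi_ge_zero
    by (intro concave_on_sum[OF assms(1,2) concave_on_sin]) (auto simp del: pi_ge_zero, fastforce)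
  also have "(\<Sum>s\<in>S. (1 / real (card S)) *\<^sub>R (\<Delta> s / 2)) = pi / (2 * real (card S))"
    by (simp add: sum flip: sum_distrib_left sum_divide_distrib)
  finally have "(\<Sum>s\<in>S. sin (\<Delta> s / 2)) \<le> real (card S) * sin (pi / (2 * real (card S)))"
    using c by (simp add: field_simps flip: sum_distrib_left sum_divide_distrib)
  then show ?thesis by (simp flip: sum_distrib_left)
qed

text \<open>A chord of length \<open>t * a s\<close> of the unit circle subtends the angle
  \<open>2 * arcsin (t * a s / 2)\<close>. The sum of these angles is continuous and 0 at
  \<open>t = 0\<close>; at \<open>t = 2 / A\<close> the longest chord is a diameter, whose angle
  alone is \<open>pi\<close>. The intermediate value theorem applies.\<close>

lemma exists_chord_scaling:
  fixes a :: "'i \<Rightarrow> real"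
  assumes S: "finite S" "S \<noteq> {}" and a: "\<And>s. s \<in> S \<Longrightarrow> a s > 0"
  obtains t \<Delta> where "t > 0" "\<And>s. s \<in> S \<Longrightarrow> 0 \<le> \<Delta> s \<and> \<Delta> s \<le> pi"
    "\<And>s. s \<in> S \<Longrightarrow> 2 * sin (\<Delta> s / 2) = t * a s" "sum \<Delta> S = pi"
proof -
  define A where "A = Max (a ` S)"
  have A: "A \<in> a ` S" "\<And>s. s \<in> S \<Longrightarrow> a s \<le> A" using S by (auto simp: A_def)
  then have Ap: "A > 0" using a by auto
  define \<psi> where "\<psi> t = (\<Sum>s\<in>S. 2 * arcsin (t * a s / 2))" for t
  have bd: "0 \<le> t * a s / 2 \<and> t * a s / 2 \<le> 1" if "s \<in> S" "0 \<le> t" "t \<le> 2 / A" for s t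
  proof -
    have "t * a s \<le> 2 / A * A" using that A(2)[of s] a[of s] Ap by (intro mult_mono) auto
    then show ?thesis using that a[of s] Ap by simp
  qed
  have bd1: "-1 \<le> t * a s / 2 \<and> t * a s / 2 \<le> 1" if "s \<in> S" "t \<in> {0..2 / A}" for s t
    using bd[of s t] that by auto
  have cont: "continuous_on {0..2 / A} \<psi>"
    unfolding \<psi>_def using bd1 by (intro continuous_intros) auto
  have nn: "0 \<le> 2 * arcsin (t * a s / 2)" "2 * arcsin (t * a s / 2) \<le> pi" if "s \<in> S" "0 \<le> t" "t \<le> 2 / A" for s t
    using bd[OF that] arcsin_le_arcsin[of 0 "t * a s / 2"] arcsin_ubound[of "t * a s / 2"] by auto
  obtain s0 where s0: "s0 \<in> S" "A = a s0" using A(1) by auto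
  have "pi = (\<Sum>s\<in>{s0}. 2 * arcsin (2 / A * a s / 2))" using Ap s0 by simp
  also have "\<dots> \<le> \<psi> (2 / A)" unfolding \<psi>_def using S(1) s0 nn[of _ "2 / A"] Ap by (intro sum_mono2) auto
  finally have "pi \<le> \<psi> (2 / A)" .
  moreover have "\<psi> 0 \<le> pi" by (simp add: \<psi>_def)
  ultimately obtain t where t: "0 \<le> t" "t \<le> 2 / A" "\<psi> t = pi"
    using IVT'[OF _ _ _ cont, of pi] Ap by auto
  have "t \<noteq> 0" using t(3) by (auto simp: \<psi>_def)
  show ?thesis
  proof (rule that[of t "\<lambda>s. 2 * arcsin (t * a s / 2)"])
    show "t > 0" using t(1) \<open>t \<noteq> 0\<close> by simp
    show "0 \<le> 2 * arcsin (t * a s / 2) \<and> 2 * arcsin (t * a s / 2) \<le> pi" if "s \<in> S" for s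
      using nn[OF that t(1,2)] by auto
    show "2 * sin (2 * arcsin (t * a s / 2) / 2) = t * a s" if "s \<in> S" for s
      using bd[OF that t(1,2)] by (simp add: sin_arcsin)
    show "(\<Sum>s\<in>S. 2 * arcsin (t * a s / 2)) = pi" using t(3) by (simp add: \<psi>_def)
  qed
qed

lemma chord_square: "(cos (x + y) - cos x)\<^sup>2 + (sin (x + y) - sin x)\<^sup>2 = (2 * sin (y / 2 :: real))\<^sup>2"
proof -
  have "(cos (x + y) - cos x)\<^sup>2 + (sin (x + y) - sin x)\<^sup>2
      = ((cos (x + y))\<^sup>2 + (sin (x + y))\<^sup>2) + ((cos x)\<^sup>2 + (sin x)\<^sup>2)
        - 2 * (cos (x + y) * cos x + sin (x + y) * sin x)"
    by (simp add: power2_eq_square algebra_simps)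
  also have "cos (x + y) * cos x + sin (x + y) * sin x = cos y"
    using cos_diff[of "x + y" x] by simp
  also have "cos y = 1 - 2 * (sin (y / 2))\<^sup>2" using cos_double_sin[of "y / 2"] by simp
  finally show ?thesis by (simp add: power2_eq_square)
qed

text \<open>The test functions are the coordinates of points on the unit circle whose consecutive
  distances are proportional to \<^term>\<open>a\<close>. For a symmetric polygon the two factors are its area
  and the area of its polar.\<close>

theorem polygonal_blaschke_santalo:
  fixes p :: "int \<Rightarrow> real^2" and a c :: "int \<Rightarrow> real"
  assumes m: "m \<ge> 2" and p: "antiperiodic m p"
    and pos: "\<And>i j. i < j \<Longrightarrow> j < i + m \<Longrightarrow> 0 < wedge (p i) (p j)"
    and a: "\<And>s. a s > 0" and aper: "\<And>s. a (s + m) = a s"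
    and w: "\<And>s. p (s + 1) - p s = a s *\<^sub>R w s"
    and c: "\<And>s. w (s - 1) - w s = c s *\<^sub>R p s"
  shows "(\<Sum>s\<in>{0..<m}. a s) * (\<Sum>s\<in>{0..<m}. c s) \<le> (2 * real_of_int m * sin (pi / (2 * real_of_int m)))\<^sup>2"
proof -
  have S: "finite {0..<m}" "{0..<m} \<noteq> {}" using m by auto
  have cardS: "real (card {0..<m}) = real_of_int m" using m by simp
  obtain t \<Delta> where t: "t > 0" and \<Delta>: "\<And>s. s \<in> {0..<m} \<Longrightarrow> 0 \<le> \<Delta> s \<and> \<Delta> s \<le> pi"
    and chord: "\<And>s. s \<in> {0..<m} \<Longrightarrow> 2 * sin (\<Delta> s / 2) = t * a s" and sumD: "sum \<Delta> {0..<m} = pi"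
    using exists_chord_scaling[OF S, of a] a by auto
  define \<theta> where "\<theta> s = sum \<Delta> {0..<s}" for s :: int
  have \<theta>step: "\<theta> (s + 1) = \<theta> s + \<Delta> s" if "0 \<le> s" for s
  proof -
    have "{0..<s + 1} = insert s {0..<s}" using that by auto
    then show ?thesis by (simp add: \<theta>_def)
  qed
  \<comment> \<open>The arcs sum to \<open>pi\<close>, so the chain runs from (1, 0) to its antipode
    and extends antiperiodically; hence \<open>base\<close> also holds at
    \<open>s = m\<close>.\<close>
  define C where "C = antiperiodic_extension m (\<lambda>s. cos (\<theta> s))"
  define D where "D = antiperiodic_extension m (\<lambda>s. sin (\<theta> s))"
  have CD: "antiperiodic m C" "antiperiodic m D"
    using m by (auto simp: C_def D_def intro: antiperiodic_extension)
  have base: "C s = cos (\<theta> s)" "D s = sin (\<theta> s)" if "0 \<le> s" "s \<le> m" for s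
  proof -
    have th: "\<theta> 0 = 0" "\<theta> m = pi" using sumD by (auto simp: \<theta>_def)
    have "C 0 = 1" "D 0 = 0" using m th by (auto simp: C_def D_def antiperiodic_extension_base)
    then have "C m = cos (\<theta> m)" "D m = sin (\<theta> m)"
      using antiperiodicD[OF CD(1), of 0] antiperiodicD[OF CD(2), of 0] th by auto
    then show "C s = cos (\<theta> s)" "D s = sin (\<theta> s)"
      using that by (cases "s = m"; simp add: C_def D_def antiperiodic_extension_base)+
  qed
  have "(\<Sum>s\<in>{0..<m}. c s) = (\<Sum>s\<in>{0..<m}. c s * (C s)\<^sup>2) + (\<Sum>s\<in>{0..<m}. c s * (D s)\<^sup>2)"
    unfolding sum.distrib[symmetric]
    by (intro sum.cong refl) (simp add: base flip: distrib_left)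
  also have "\<dots> \<le> (\<Sum>s\<in>{0..<m}. (C (s + 1) - C s)\<^sup>2 / a s) + (\<Sum>s\<in>{0..<m}. (D (s + 1) - D s)\<^sup>2 / a s)"
    by (intro add_mono antiperiodic_ground_state[OF m p pos a aper w c] CD) auto
  also have "\<dots> = (\<Sum>s\<in>{0..<m}. t\<^sup>2 * a s)"
    unfolding sum.distrib[symmetric]
  proof (intro sum.cong refl)
    fix s assume s: "s \<in> {0..<m}"
    have "(C (s + 1) - C s)\<^sup>2 + (D (s + 1) - D s)\<^sup>2 = (t * a s)\<^sup>2"
      using s base[of s] base[of "s + 1"] chord_square[of "\<theta> s" "\<Delta> s"] chord[OF s]
      by (simp add: \<theta>step)
    then show "(C (s + 1) - C s)\<^sup>2 / a s + (D (s + 1) - D s)\<^sup>2 / a s = t\<^sup>2 * a s"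
      using a[of s] by (simp add: power2_eq_square flip: add_divide_distrib)
  qed
  finally have c_le: "(\<Sum>s\<in>{0..<m}. c s) \<le> t\<^sup>2 * (\<Sum>s\<in>{0..<m}. a s)"
    by (simp add: sum_distrib_left)
  have apos: "0 \<le> (\<Sum>s\<in>{0..<m}. a s)" using a by (intro sum_nonneg) (simp add: less_imp_le)
  \<comment> \<open>The factor \<open>t\<^sup>2\<close> in \<open>c_le\<close> is absorbed here:
    \<open>t\<close> times the sum of \<open>a\<close> is the length of the chain of chords, for
    which equal arcs are best.\<close>
  have "t * (\<Sum>s\<in>{0..<m}. a s) = (\<Sum>s\<in>{0..<m}. 2 * sin (\<Delta> s / 2))"
    by (simp add: sum_distrib_left chord del: mult_minus_left)
  also have "\<dots> \<le> 2 * real_of_int m * sin (pi / (2 * real_of_int m))"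
    using sum_two_sin_half_le[OF S \<Delta> sumD] cardS by simp
  finally have "(t * (\<Sum>s\<in>{0..<m}. a s))\<^sup>2 \<le> (2 * real_of_int m * sin (pi / (2 * real_of_int m)))\<^sup>2"
    using t apos by (intro power_mono) auto
  moreover have "(\<Sum>s\<in>{0..<m}. a s) * (\<Sum>s\<in>{0..<m}. c s) \<le> (t * (\<Sum>s\<in>{0..<m}. a s))\<^sup>2"
    using mult_left_mono[OF c_le apos] by (simp add: power2_eq_square algebra_simps)
  ultimately show ?thesis by linarith
qed

section \<open>Rigidity of maximal configurations\<close>

text \<open>Hypothesis \<open>D\<close> is a strict left turn at every vertex. If
  \<open>p (i + 1)\<close> were a multiple of \<open>p i\<close>, the turn at \<open>i\<close> would
  force the factor below 1 and the turn at \<open>i + 1\<close> would force it above 1.\<close>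

lemma strictly_convex_adjacent_pos:
  assumes m: "m \<ge> 2" and adm: "admissible m p"
    and D: "\<And>i. wedge (p (i - 1)) (p (i + 1)) < wedge (p (i - 1)) (p i) + wedge (p i) (p (i + 1))"
  shows "0 < wedge (p i) (p (i + 1))"
proof (rule ccontr)
  assume "\<not> ?thesis"
  then have z: "wedge (p i) (p (i + 1)) = 0"
    using admissible_bounds(1)[OF adm, of i "i + 1"] m by auto
  have D1: "wedge (p (i - 1)) (p (i + 1)) < wedge (p (i - 1)) (p i)" using D[of i] z by simp
  have D2: "wedge (p i) (p (i + 2)) < wedge (p (i + 1)) (p (i + 2))"
    using D[of "i + 1"] z by (simp add: add.assoc)
  have x: "0 \<le> wedge (p (i - 1)) (p i)" and y: "0 \<le> wedge (p i) (p (i + 2))"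
    using admissible_bounds(1)[OF adm] m by auto
  show False
  proof (cases "p i = 0")
    case True
    then show ?thesis using D1 admissible_bounds(1)[OF adm, of "i - 1" "i + 1"] m by simp
  next
    case False
    then obtain \<kappa> where l: "p (i + 1) = \<kappa> *\<^sub>R p i" using wedge_eq_0_imp_scaleR[OF z] by blast
    have "0 < (1 - \<kappa>) * wedge (p (i - 1)) (p i)" using D1 l by (simp add: algebra_simps)
    then have "\<kappa> < 1" using x by (simp add: zero_less_mult_iff)
    have "0 < (\<kappa> - 1) * wedge (p i) (p (i + 2))" using D2 l by (simp add: algebra_simps)
    then have "\<kappa> > 1" using y by (simp add: zero_less_mult_iff)
    with \<open>\<kappa> < 1\<close> show ?thesis by simp
  qed
qed

text \<open>If \<open>p j\<close> were a multiple of \<open>p i\<close>, the positive wedges of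
  \<open>p j\<close> with its two neighbours would require opposite signs of the factor.\<close>

lemma strictly_convex_pos:
  assumes m: "m \<ge> 2" and adm: "admissible m p"
    and D: "\<And>i. wedge (p (i - 1)) (p (i + 1)) < wedge (p (i - 1)) (p i) + wedge (p i) (p (i + 1))"
    and ij: "i < j" "j < i + m"
  shows "0 < wedge (p i) (p j)"
proof (rule ccontr)
  assume "\<not> ?thesis"
  then have z: "wedge (p i) (p j) = 0"
    using admissible_bounds(1)[OF adm, of i j] ij by auto
  note adj = strictly_convex_adjacent_pos[OF m adm D]
  have "p i \<noteq> 0" using adj[of i] by auto
  then obtain \<kappa> where l: "p j = \<kappa> *\<^sub>R p i" using wedge_eq_0_imp_scaleR[OF z] by blast
  have "0 < \<kappa> * wedge (p i) (p (j + 1))" using adj[of j] l by simp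
  moreover have "0 \<le> wedge (p i) (p (j + 1))" using admissible_bounds(1)[OF adm] ij by simp
  ultimately have "0 < \<kappa>" by (simp add: zero_less_mult_iff)
  moreover have "0 < - (\<kappa> * wedge (p i) (p (j - 1)))"
    using adj[of "j - 1"] l wedge_commute[of "p (j - 1)" "p i"] by simp
  moreover have "0 \<le> wedge (p i) (p (j - 1))" using admissible_bounds(1)[OF adm] ij by simp
  ultimately show False by (simp add: mult_less_0_iff)
qed

text \<open>The wedges with \<open>p i\<close> measure heights above the line through
  \<open>p i\<close>. By the three-term relation for \<open>p (l - 1)\<close>, \<open>p l\<close>,
  \<open>p (l + 1)\<close>, a weighted sum of the neighbouring heights is a multiple of the middle
  one; by \<open>D\<close> the weights add up to more than that multiple, so a positive height
  exceeds at least one neighbour.\<close>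

lemma strictly_convex_no_local_min:
  assumes m: "m \<ge> 2" and adm: "admissible m p"
    and D: "\<And>i. wedge (p (i - 1)) (p (i + 1)) < wedge (p (i - 1)) (p i) + wedge (p i) (p (i + 1))"
    and il: "i < l" "l < i + m"
    and le: "wedge (p i) (p l) \<le> wedge (p i) (p (l - 1))" "wedge (p i) (p l) \<le> wedge (p i) (p (l + 1))"
  shows False
proof -
  let ?a = "wedge (p l) (p (l + 1))" and ?b = "wedge (p (l - 1)) (p l)"
  have a: "0 < ?a" and b: "0 < ?b"
    using strictly_convex_adjacent_pos[OF m adm D, of l] strictly_convex_adjacent_pos[OF m adm D, of "l - 1"]
    by auto
  have v: "0 < wedge (p i) (p l)" using strictly_convex_pos[OF m adm D il] .
  have "(?b + ?a) * wedge (p i) (p l) \<le> ?a * wedge (p i) (p (l - 1)) + ?b * wedge (p i) (p (l + 1))"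
    using mult_left_mono[OF le(1), of ?a] mult_left_mono[OF le(2), of ?b] a b
    unfolding distrib_right by linarith
  also have "\<dots> = wedge (p (l - 1)) (p (l + 1)) * wedge (p i) (p l)"
    by (simp add: wedge_def algebra_simps)
  also have "\<dots> < (?b + ?a) * wedge (p i) (p l)"
    using D[of l] v by (intro mult_strict_right_mono) auto
  finally show False by simp
qed

text \<open>The value 1 at \<open>j\<close> and \<open>k\<close> is the upper bound, so the least
  height strictly between them would be a local minimum.\<close>

lemma tight_partners_adjacent:
  assumes m: "m \<ge> 2" and adm: "admissible m p"
    and D: "\<And>i. wedge (p (i - 1)) (p (i + 1)) < wedge (p (i - 1)) (p i) + wedge (p i) (p (i + 1))"
    and jk: "i < j" "j < k" "k < i + m"
    and tight: "wedge (p i) (p j) = 1" "wedge (p i) (p k) = 1"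
  shows "k = j + 1"
proof (rule ccontr)
  assume "k \<noteq> j + 1"
  then have "{j + 1..k - 1} \<noteq> {}" using jk by auto
  then obtain l where l: "l \<in> {j + 1..k - 1}"
    and min: "\<And>t. t \<in> {j + 1..k - 1} \<Longrightarrow> wedge (p i) (p l) \<le> wedge (p i) (p t)"
    using ex_is_arg_min_if_finite[of "{j + 1..k - 1}" "\<lambda>l. wedge (p i) (p l)"]
    by (auto simp: is_arg_min_linorder)
  have le1: "wedge (p i) (p l) \<le> 1" using admissible_bounds(2)[OF adm] l jk by auto
  have "wedge (p i) (p l) \<le> wedge (p i) (p t)" if "t \<in> {j..k}" for t
    using min[of t] le1 tight that by (cases "t = j \<or> t = k") auto
  then show False
    using strictly_convex_no_local_min[OF m adm D, of i l] l jk by auto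
qed

text \<open>In the geometric picture \<^term>\<open>\<sigma> i\<close> is the edge parallel to \<^term>\<open>p i\<close>; the polygon is a Radon
  curve, and since passing twice to the parallel edge is almost half a turn, \<^term>\<open>m\<close> is odd.\<close>

lemma rigid_configuration:
  assumes m: "m \<ge> 3" and adm: "admissible m p"
    and D: "\<And>i. wedge (p (i - 1)) (p (i + 1)) < wedge (p (i - 1)) (p i) + wedge (p i) (p (i + 1))"
    and tight: "\<And>i j. \<exists>l. i < l \<and> l < i + m \<and> l \<noteq> j \<and> wedge (p i) (p l) = 1"
  obtains k where "m = 2 * k + 1" "\<And>s. p (s + 1) - p s = wedge (p s) (p (s + 1)) *\<^sub>R p (s + k + 1)"
proof -
  have m2: "m \<ge> 2" using m by simp
  note adj = strictly_convex_adjacent_pos[OF m2 adm D]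
  note apm = antiperiodicD[OF admissible_antiperiodic[OF adm]]
  have "\<exists>s. i < s \<and> s + 1 < i + m \<and> wedge (p i) (p s) = 1 \<and> wedge (p i) (p (s + 1)) = 1" for i
  proof -
    obtain l where l: "i < l" "l < i + m" "wedge (p i) (p l) = 1" using tight by blast
    obtain l' where l': "i < l'" "l' < i + m" "l' \<noteq> l" "wedge (p i) (p l') = 1" using tight by blast
    show ?thesis
    proof (cases "l < l'")
      case True
      then have "l' = l + 1" using tight_partners_adjacent[OF m2 adm D] l l' by blast
      then show ?thesis using l l' by blast
    next
      case False
      then have "l = l' + 1" using tight_partners_adjacent[OF m2 adm D, of i l' l] l l' by auto
      then show ?thesis using l l' by blast
    qed
  qed
  then obtain \<sigma> where \<sigma>: "\<And>i. i < \<sigma> i" "\<And>i. \<sigma> i + 1 < i + m"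
    "\<And>i. wedge (p i) (p (\<sigma> i)) = 1" "\<And>i. wedge (p i) (p (\<sigma> i + 1)) = 1" by metis
  have uniq: "l = \<sigma> i \<or> l = \<sigma> i + 1" if l: "i < l" "l < i + m" "wedge (p i) (p l) = 1" for i l
  proof (rule ccontr)
    assume "\<not> ?thesis"
    then consider "l < \<sigma> i" | "\<sigma> i + 1 < l" by linarith
    then show False
    proof cases
      case 1
      then have "\<sigma> i + 1 = l + 1" using tight_partners_adjacent[OF m2 adm D, of i l "\<sigma> i + 1"] l \<sigma> by auto
      then show False using 1 by simp
    next
      case 2
      have "l = \<sigma> i + 1" using tight_partners_adjacent[OF m2 adm D, of i "\<sigma> i" l] l 2 \<sigma> by auto
      then show False using 2 by simp
    qed
  qed
  have edge: "p (\<sigma> i + 1) - p (\<sigma> i) = - (wedge (p (\<sigma> i)) (p (\<sigma> i + 1)) *\<^sub>R p i)" for i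
  proof -
    have "wedge (p i) (p (\<sigma> i + 1) - p (\<sigma> i)) = 0" using \<sigma> by (simp add: wedge_linear)
    moreover have "p i \<noteq> 0" using adj[of i] by auto
    ultimately obtain \<kappa> where l: "p (\<sigma> i + 1) - p (\<sigma> i) = \<kappa> *\<^sub>R p i"
      using wedge_eq_0_imp_scaleR by blast
    have "wedge (p (\<sigma> i)) (p (\<sigma> i + 1)) = wedge (p (\<sigma> i)) (p (\<sigma> i + 1) - p (\<sigma> i))"
      by (simp add: wedge_linear)
    also have "\<dots> = - \<kappa>"
      unfolding l using \<sigma>(3)[of i] wedge_commute[of "p (\<sigma> i)" "p i"] by simp
    finally show ?thesis using l by simp
  qed
  \<comment> \<open>Tightness is symmetric up to the antipode, so \<open>i + m\<close> is a tight
    partner of both \<open>\<sigma> i\<close> and \<open>\<sigma> i + 1\<close>. Of the four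
    resulting positions, two make \<open>\<sigma>\<close> agree on these indices, and a third
    reverses two consecutive edges and produces a right turn.\<close>
  have \<sigma>\<sigma>: "\<sigma> (\<sigma> i) = i + m - 1 \<and> \<sigma> (\<sigma> i + 1) = i + m" for i
  proof -
    let ?s = "\<sigma> i"
    have 1: "i + m = \<sigma> ?s \<or> i + m = \<sigma> ?s + 1"
      using uniq[of ?s "i + m"] \<sigma>[of i] apm[of i] wedge_commute[of "p ?s" "p i"] by auto
    have 2: "i + m = \<sigma> (?s + 1) \<or> i + m = \<sigma> (?s + 1) + 1"
      using uniq[of "?s + 1" "i + m"] \<sigma>[of i] apm[of i] wedge_commute[of "p (?s + 1)" "p i"] by auto
    have ne: "\<sigma> ?s \<noteq> \<sigma> (?s + 1)"
    proof
      assume eq: "\<sigma> ?s = \<sigma> (?s + 1)"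
      have "p ?s = p (?s + 1)"
        using edge[of ?s] edge[of "?s + 1"] adj[of "\<sigma> ?s"] eq by auto
      then show False using adj[of ?s] by simp
    qed
    have "\<not> (\<sigma> ?s = i + m \<and> \<sigma> (?s + 1) = i + m - 1)"
    proof
      assume eq: "\<sigma> ?s = i + m \<and> \<sigma> (?s + 1) = i + m - 1"
      define t where "t = i + m"
      have e1: "p (t + 1) - p t = - (wedge (p t) (p (t + 1)) *\<^sub>R p ?s)"
        using edge[of ?s] eq by (simp add: t_def)
      have e2: "p t - p (t - 1) = - (wedge (p (t - 1)) (p t) *\<^sub>R p (?s + 1))"
        using edge[of "?s + 1"] eq by (simp add: t_def)
      have "wedge (p t - p (t - 1)) (p (t + 1) - p t)
          = - (wedge (p (t - 1)) (p t) * (wedge (p t) (p (t + 1)) * wedge (p ?s) (p (?s + 1))))"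
        unfolding e1 e2 using wedge_commute[of "p (?s + 1)" "p ?s"] by simp
      also have "\<dots> < 0" using adj[of t] adj[of "t - 1"] adj[of ?s] by simp
      finally show False using D[of t] by (simp add: wedge_linear)
    qed
    then show ?thesis using 1 2 ne by linarith
  qed
  \<comment> \<open>By \<open>\<sigma>\<sigma>\<close>, applying \<open>\<sigma>\<close> twice is a
    shift by \<open>m - 1\<close>, hence injective, while \<open>\<sigma> (i + 1)\<close> and
    \<open>\<sigma> i + 1\<close> have the same image \<open>i + m\<close>.\<close>
  have \<sigma>step: "\<sigma> (i + 1) = \<sigma> i + 1" for i
  proof -
    have "\<sigma> (\<sigma> (i + 1)) = \<sigma> (\<sigma> i + 1)" using \<sigma>\<sigma>[of i] \<sigma>\<sigma>[of "i + 1"] by simp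
    then have "\<sigma> (\<sigma> (\<sigma> (i + 1))) = \<sigma> (\<sigma> (\<sigma> i + 1))" by simp
    then show ?thesis using \<sigma>\<sigma>[of "\<sigma> i + 1"] \<sigma>\<sigma>[of "\<sigma> (i + 1)"] by linarith
  qed
  define k where "k = \<sigma> 0"
  have \<sigma>k: "\<sigma> i = i + k" for i
  proof (induction i rule: int_induct[where k = 0])
    case base
    show ?case by (simp add: k_def)
  next
    case (step1 i)
    then show ?case using \<sigma>step[of i] by simp
  next
    case (step2 i)
    then show ?case using \<sigma>step[of "i - 1"] by simp
  qed
  have mk: "m = 2 * k + 1" using \<sigma>\<sigma>[of 0] by (simp add: \<sigma>k)
  show ?thesis
  proof (rule that[OF mk])
    fix s
    have "p (s + 1) - p s = wedge (p s) (p (s + 1)) *\<^sub>R (- p (s - k))"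
      using edge[of "s - k"] by (simp add: \<sigma>k)
    also have "- p (s - k) = p (s + k + 1)"
      using apm[of "s - k"] by (simp add: mk algebra_simps)
    finally show "p (s + 1) - p s = wedge (p s) (p (s + 1)) *\<^sub>R p (s + k + 1)" .
  qed
qed

text \<open>The Radon relation makes the edge directions \<open>w\<close> vertices of the same
  polygon, and the coefficients \<open>c\<close> a shift of \<open>a\<close>. Both factors of the
  Blaschke-Santalo product are then the area, so a square is bounded.\<close>

lemma radon_half_area_le:
  assumes m: "m \<ge> 2" and p: "antiperiodic m p"
    and pos: "\<And>i j. i < j \<Longrightarrow> j < i + m \<Longrightarrow> 0 < wedge (p i) (p j)"
    and mk: "m = 2 * k + 1"
    and radon: "\<And>s. p (s + 1) - p s = wedge (p s) (p (s + 1)) *\<^sub>R p (s + k + 1)"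
  shows "half_area m p \<le> 2 * real_of_int m * sin (pi / (2 * real_of_int m))"
proof -
  define a where "a s = wedge (p s) (p (s + 1))" for s
  have apos: "0 < a s" for s using pos[of s "s + 1"] m by (simp add: a_def)
  have aper: "a (s + m) = a s" for s
    using antiperiodicD[OF p, of s] antiperiodicD[OF p, of "s + 1"] by (simp add: a_def ac_simps)
  have c: "p (s - 1 + k + 1) - p (s + k + 1) = a (s + k) *\<^sub>R p s" for s
  proof -
    have e: "s - 1 + k + 1 = s + k" "s + k + k + 1 = s + m" by (simp_all add: mk)
    have "p (s + k + 1) - p (s + k) = - (a (s + k) *\<^sub>R p s)"
      using radon[of "s + k"] antiperiodicD[OF p, of s] unfolding e a_def by simp
    then have "p (s + k) - p (s + k + 1) = a (s + k) *\<^sub>R p s"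
      by (metis add.inverse_inverse minus_diff_eq)
    then show ?thesis unfolding e .
  qed
  have "(\<Sum>s\<in>{0..<m}. a (s + k)) = (\<Sum>s\<in>{k..<k + m}. a s)"
    by (rule sum.reindex_bij_witness[where j = "\<lambda>s. s + k" and i = "\<lambda>s. s - k"]) auto
  also have "\<dots> = (\<Sum>s\<in>{0..<m}. a s)" using sum_periodic_shift[of m a] aper m by simp
  finally have ac: "(\<Sum>s\<in>{0..<m}. a (s + k)) = (\<Sum>s\<in>{0..<m}. a s)" .
  have F: "half_area m p = (\<Sum>s\<in>{0..<m}. a s)" by (simp add: half_area_def a_def)
  have le: "(half_area m p)\<^sup>2 \<le> (2 * real_of_int m * sin (pi / (2 * real_of_int m)))\<^sup>2"
    using polygonal_blaschke_santalo[where w = "\<lambda>s. p (s + k + 1)", OF m p pos apos aper radon[folded a_def] c]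
    unfolding ac F power2_eq_square[of "sum a _"] .
  have "pi / (2 * real_of_int m) \<le> pi / 1" using m by (intro divide_left_mono) auto
  then have "0 \<le> sin (pi / (2 * real_of_int m))" using m by (intro sin_ge_zero) auto
  then have "0 \<le> 2 * real_of_int m * sin (pi / (2 * real_of_int m))" using m by simp
  with le show ?thesis by (rule power2_le_imp_le)
qed

section \<open>Existence of an extremal configuration\<close>

lemma antiperiodic_cases:
  fixes p :: "int \<Rightarrow> 'a::group_add"
  assumes m: "m > 0" and p: "antiperiodic m p"
  obtains r where "0 \<le> r" "r < m" "p i = p r \<or> p i = - p r"
proof -
  have "\<exists>r. 0 \<le> r \<and> r < m \<and> (p (r' + n * m) = p r \<or> p (r' + n * m) = - p r)" if "0 \<le> r'" "r' < m" for n r'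
  proof (induction n rule: int_induct[where k = 0])
    case base
    then show ?case using that by auto
  next
    case (step1 n)
    then show ?case using antiperiodicD[OF p, of "r' + n * m"] by (auto simp: algebra_simps)
  next
    case (step2 n)
    then show ?case using antiperiodic_minusD[OF p, of "r' + n * m"] by (auto simp: algebra_simps)
  qed
  from this[of "i mod m" "i div m"] that show ?thesis using m by (auto simp: mult.commute)
qed

lemma half_area_antiperiodic:
  assumes m: "m \<ge> 1" and q: "antiperiodic m q"
  shows "half_area m q = (\<Sum>j\<in>{0..<m - 1}. wedge (q j) (q (j + 1))) + wedge (q 0) (q (m - 1))"
proof -
  have "{0..<m} = insert (m - 1) {0..<m - 1}" using m by auto
  moreover have "q m = - q 0" using antiperiodicD[OF q, of 0] by simp
  ultimately show ?thesis
    unfolding half_area_def using wedge_commute[of "q (m - 1)" "q 0"] by simp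
qed

text \<open>The tie-breaker among area maximisers. Being built from wedges, it is invariant under
  linear maps of determinant 1, as area and admissibility are.\<close>

definition spread :: "int \<Rightarrow> (int \<Rightarrow> real^2) \<Rightarrow> real" where
  "spread m p = (\<Sum>i\<in>{0..<m}. \<Sum>j\<in>{0..<m}. (wedge (p i) (p j))\<^sup>2)"

lemma spread_shift:
  assumes m: "0 \<le> m" and p: "antiperiodic m p"
  shows "spread m (\<lambda>i. p (c + i)) = spread m p"
proof -
  have shift: "(\<Sum>j\<in>{0..<m}. g (c + j)) = sum g {0..<m}" if "\<And>j. g (j + m) = g j" for g :: "int \<Rightarrow> real"
  proof -
    have "(\<Sum>j\<in>{0..<m}. g (c + j)) = sum g {c..<c + m}"
      by (rule sum.reindex_bij_witness[where j = "\<lambda>s. c + s" and i = "\<lambda>s. s - c"]) auto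
    then show ?thesis using sum_periodic_shift[OF m, of g] that by simp
  qed
  have "(\<Sum>j\<in>{0..<m}. (wedge (p i) (p (c + j)))\<^sup>2) = (\<Sum>j\<in>{0..<m}. (wedge (p i) (p j))\<^sup>2)" for i
    by (rule shift) (simp add: antiperiodicD[OF p])
  then have "spread m (\<lambda>i. p (c + i)) = (\<Sum>i\<in>{0..<m}. \<Sum>j\<in>{0..<m}. (wedge (p (c + i)) (p j))\<^sup>2)"
    by (simp add: spread_def)
  also have "\<dots> = spread m p"
    unfolding spread_def by (rule shift) (simp add: antiperiodicD[OF p])
  finally show ?thesis .
qed

text \<open>Invariance under area-preserving linear maps makes the admissible configurations
  unbounded. Coordinates relative to a pair with the largest wedge \<open>M\<close> put every point
  into the square, and they divide all wedges by \<open>M\<close>, which is at most 1, so neither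
  functional decreases.\<close>

lemma normalize_admissible:
  assumes m: "m \<ge> 1" and adm: "admissible m p" and F: "0 < half_area m p"
  obtains q where "admissible m q" "\<And>i. q i \<in> cbox (-1) 1"
    "half_area m p \<le> half_area m q" "spread m p \<le> spread m q"
proof -
  note ap = admissible_antiperiodic[OF adm]
  define W where "W = (\<lambda>(i, j). wedge (p i) (p j)) ` ({0..<m} \<times> {0..<m})"
  define M where "M = Max W"
  have W: "finite W" "W \<noteq> {}" using m by (auto simp: W_def)
  have le0: "wedge (p i) (p j) \<le> M" if "0 \<le> i" "i < m" "0 \<le> j" "j < m" for i j
    unfolding M_def using that W by (intro Max_ge) (auto simp: W_def)
  have absle: "\<bar>wedge (p i) (p j)\<bar> \<le> M" for i j
  proof -
    obtain r where r: "0 \<le> r" "r < m" "p i = p r \<or> p i = - p r"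
      using antiperiodic_cases[OF _ ap, of i] m by auto
    obtain s where s: "0 \<le> s" "s < m" "p j = p s \<or> p j = - p s"
      using antiperiodic_cases[OF _ ap, of j] m by auto
    have "\<bar>wedge (p i) (p j)\<bar> = \<bar>wedge (p r) (p s)\<bar>" using r s by auto
    then show ?thesis using le0[of r s] le0[of s r] r s wedge_commute[of "p r" "p s"] by (auto simp: abs_if)
  qed
  have "M \<in> W" unfolding M_def using W by simp
  then obtain a b where ab: "0 \<le> a" "a < m" "0 \<le> b" "b < m" "M = wedge (p a) (p b)"
    by (auto simp: W_def)
  have Mpos: "0 < M"
  proof (rule ccontr)
    assume "\<not> 0 < M"
    then have "wedge (p i) (p (i + 1)) \<le> 0" for i using absle[of i "i + 1"] by linarith
    then have "half_area m p \<le> 0" unfolding half_area_def by (intro sum_nonpos) auto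
    then show False using F by simp
  qed
  have M1: "M \<le> 1"
  proof (cases "a < b")
    case True
    then show ?thesis using admissible_bounds(2)[OF adm, of a b] ab by simp
  next
    case False
    then show ?thesis
      using admissible_bounds(1)[OF adm, of b a] ab wedge_commute[of "p a" "p b"] by simp
  qed
  define q :: "int \<Rightarrow> real^2" where "q i = vector [wedge (p i) (p b) / M, wedge (p a) (p i) / M]" for i
  have wq: "wedge (q i) (q j) = wedge (p i) (p j) / M" for i j
  proof -
    have "wedge (q i) (q j)
        = (wedge (p i) (p b) * wedge (p a) (p j) - wedge (p a) (p i) * wedge (p j) (p b)) / (M * M)"
      unfolding q_def wedge_def[of "vector xs" "vector ys" for xs ys] by (simp add: diff_divide_distrib)
    also have "wedge (p i) (p b) * wedge (p a) (p j) - wedge (p a) (p i) * wedge (p j) (p b)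
        = M * wedge (p i) (p j)"
      unfolding ab(5) by (simp add: wedge_def algebra_simps)
    finally show ?thesis using Mpos by simp
  qed
  have grow: "x \<le> x / M" if "0 \<le> x" for x using Mpos mult_right_mono[OF M1 that] by (simp add: field_simps)
  show ?thesis
  proof (rule that)
    show "admissible m q"
      unfolding admissible_def
    proof (intro conjI allI impI)
      show "antiperiodic m q"
        by (simp add: antiperiodic_def q_def antiperiodicD[OF ap]) (simp add: vec2_eq_iff)
      fix i j assume ij: "i < j \<and> j < i + m"
      show "0 \<le> wedge (q i) (q j)" using admissible_bounds(1)[OF adm, of i j] ij Mpos by (simp add: wq)
      show "wedge (q i) (q j) \<le> 1" using absle[of i j] Mpos by (simp add: wq field_simps)
    qed
    show "q i \<in> cbox (-1) 1" for i
      using absle[of i b] absle[of a i] Mpos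
      by (simp add: mem_box_cart forall_2 q_def field_simps abs_le_iff)
    show "half_area m p \<le> half_area m q"
      unfolding half_area_def wq using admissible_bounds(1)[OF adm] m by (intro sum_mono grow) auto
    show "spread m p \<le> spread m q"
      unfolding spread_def wq power_divide
    proof (intro sum_mono)
      fix i j
      have "(wedge (p i) (p j))\<^sup>2 \<le> (wedge (p i) (p j))\<^sup>2 / M" by (rule grow) simp
      also have "\<dots> \<le> (wedge (p i) (p j))\<^sup>2 / M / M" by (rule grow) (use Mpos in simp)
      finally show "(wedge (p i) (p j))\<^sup>2 \<le> (wedge (p i) (p j))\<^sup>2 / M\<^sup>2" by (simp add: power2_eq_square)
    qed
  qed
qed

text \<open>Tychonoff's theorem for the cube of all integer sequences; each constraint involves
  finitely many coordinates and is therefore closed.\<close>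

lemma compact_bounded_admissible:
  "compact {q. admissible m q \<and> (\<forall>i. q i \<in> cbox (-1) 1)}"
proof -
  have "compactin (product_topology (\<lambda>i::int. euclidean) UNIV) (PiE UNIV (\<lambda>i. cbox (-1) (1::real^2)))"
    unfolding compactin_PiE by simp
  then have "compact (PiE UNIV (\<lambda>i::int. cbox (-1) (1::real^2)))"
    by (simp add: euclidean_product_topology)
  moreover have "{q. admissible m q} = (\<Inter>i. {q. q (i + m) = - q i}) \<inter>
      (\<Inter>(i, j)\<in>{(i, j). i < j \<and> j < i + m}. {q. 0 \<le> wedge (q i) (q j)} \<inter> {q. wedge (q i) (q j) \<le> 1})"
    by (auto simp: admissible_def antiperiodic_def)
  moreover have "closed \<dots>"
    by (intro closed_Int closed_INT ballI) (auto intro!: closed_Int closed_Collect_eq closed_Collect_le continuous_intros)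
  ultimately have "compact (PiE UNIV (\<lambda>i::int. cbox (-1) (1::real^2)) \<inter> {q. admissible m q})"
    by (simp add: compact_Int_closed)
  moreover have "PiE UNIV (\<lambda>i::int. cbox (-1) (1::real^2)) \<inter> {q. admissible m q}
      = {q. admissible m q \<and> (\<forall>i. q i \<in> cbox (-1) 1)}"
    by (auto simp: PiE_UNIV_domain)
  ultimately show ?thesis by simp
qed

text \<open>Maximising area and then spread over the compact normalised set suffices, since
  normalisation lowers neither. Configurations without positive area cannot be normalised, but they
  cannot compete with \<open>p0\<close>.\<close>

lemma lexicographic_maximizer:
  assumes m: "m \<ge> 1" and p0: "admissible m p0" "0 < half_area m p0"
  obtains p where "admissible m p" "\<And>q. admissible m q \<Longrightarrow> half_area m q \<le> half_area m p"
    "\<And>q. admissible m q \<Longrightarrow> half_area m q = half_area m p \<Longrightarrow> spread m q \<le> spread m p"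
proof -
  define K where "K = {q. admissible m q \<and> (\<forall>i. q i \<in> cbox (-1) 1)}"
  have K: "compact K" unfolding K_def by (rule compact_bounded_admissible)
  have contF: "continuous_on S (half_area m)" for S
    unfolding half_area_def by (intro continuous_intros continuous_on_product_coordinates[THEN continuous_on_subset]) auto
  have contS: "continuous_on S (spread m)" for S
    unfolding spread_def by (intro continuous_intros continuous_on_product_coordinates[THEN continuous_on_subset]) auto
  have norm: "\<exists>q'\<in>K. half_area m q \<le> half_area m q' \<and> spread m q \<le> spread m q'"
    if "admissible m q" "0 < half_area m q" for q
    by (rule normalize_admissible[OF m that]) (auto simp: K_def)
  have "K \<noteq> {}" using norm[OF p0] by auto
  then obtain p1 where p1: "p1 \<in> K" "\<And>q. q \<in> K \<Longrightarrow> half_area m q \<le> half_area m p1"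
    using continuous_attains_sup[OF K _ contF] by blast
  have p1pos: "0 < half_area m p1" using norm[OF p0] p1(2) p0(2) by force
  define K' where "K' = K \<inter> {q. half_area m q = half_area m p1}"
  have "compact K'"
    unfolding K'_def by (intro compact_Int_closed[OF K] closed_Collect_eq contF continuous_on_const)
  moreover have "K' \<noteq> {}" using p1 by (auto simp: K'_def)
  ultimately have "\<exists>p\<in>K'. \<forall>q\<in>K'. spread m q \<le> spread m p"
    by (rule continuous_attains_sup[OF _ _ contS])
  then obtain p where p: "p \<in> K'" "\<And>q. q \<in> K' \<Longrightarrow> spread m q \<le> spread m p" by blast
  have max: "half_area m q \<le> half_area m p" if "admissible m q" for q
  proof (cases "0 < half_area m q")
    case True
    then show ?thesis using norm[OF that] p1(2) p(1) by (force simp: K'_def)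
  next
    case False
    then show ?thesis using p1pos p(1) by (simp add: K'_def)
  qed
  show ?thesis
  proof (rule that)
    show "admissible m p" using p(1) by (simp add: K'_def K_def)
    show "half_area m q \<le> half_area m p" if "admissible m q" for q using max[OF that] .
    show "spread m q \<le> spread m p" if q: "admissible m q" "half_area m q = half_area m p" for q
    proof -
      have "0 < half_area m q" using q(2) p1pos p(1) by (simp add: K'_def)
      then obtain q' where q': "q' \<in> K" "half_area m q \<le> half_area m q'" "spread m q \<le> spread m q'"
        using norm[OF q(1)] by blast
      then have "q' \<in> K'" using p1(2)[of q'] q(2) p(1) by (force simp: K'_def)
      then show ?thesis using p(2)[of q'] q'(3) by simp
    qed
  qed
qed

section \<open>Variations of an extremal configuration\<close>

text \<open>Dropping \<open>p i\<close> and its antipode removes two congruent triangles; the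
  bracket is twice the signed area of one of them.\<close>

lemma delete_vertex:
  assumes m: "m \<ge> 2" and adm: "admissible m p"
  obtains q where "admissible (m - 1) q"
    "half_area (m - 1) q = half_area m p
       - (wedge (p (i - 1)) (p i) + wedge (p i) (p (i + 1)) - wedge (p (i - 1)) (p (i + 1)))"
proof -
  note ap = admissible_antiperiodic[OF adm]
  \<comment> \<open>Starting the block at \<open>p (i + 1)\<close> makes the antipode of
    \<open>p i\<close> its last point, so shortening the block by one removes exactly this
    pair.\<close>
  define f where "f j = p (i + 1 + j)" for j
  define q where "q = antiperiodic_extension (m - 1) f"
  have base: "q j = f j" if "0 \<le> j" "j < m - 1" for j
    using that by (simp add: q_def antiperiodic_extension_base)
  have admq: "admissible (m - 1) q"
    unfolding q_def using m admissible_bounds[OF adm] by (intro admissible_extension) (auto simp: f_def)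
  have pm: "p (i + m - 1) = - p (i - 1)" and pm': "p (i + m) = - p i"
    using antiperiodicD[OF ap, of "i - 1"] antiperiodicD[OF ap, of i] by (simp_all add: algebra_simps)
  have "half_area (m - 1) q = (\<Sum>j\<in>{0..<m - 2}. wedge (q j) (q (j + 1))) + wedge (q 0) (q (m - 2))"
    using half_area_antiperiodic[OF _ admissible_antiperiodic[OF admq]] m by (simp add: algebra_simps)
  also have "\<dots> = (\<Sum>j\<in>{0..<m - 2}. wedge (f j) (f (j + 1))) + wedge (f 0) (f (m - 2))"
    using m by (simp add: base)
  also have "wedge (f 0) (f (m - 2)) = wedge (p (i - 1)) (p (i + 1))"
    using pm wedge_commute[of "p (i - 1)" "p (i + 1)"] by (simp add: f_def algebra_simps)
  also have "(\<Sum>j\<in>{0..<m - 2}. wedge (f j) (f (j + 1))) = (\<Sum>s\<in>{i + 1..<i + m - 1}. wedge (p s) (p (s + 1)))"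
    by (rule sum.reindex_bij_witness[where j = "\<lambda>s. i + 1 + s" and i = "\<lambda>s. s - (i + 1)"])
       (auto simp: f_def algebra_simps)
  finally have 1: "half_area (m - 1) q
      = (\<Sum>s\<in>{i + 1..<i + m - 1}. wedge (p s) (p (s + 1))) + wedge (p (i - 1)) (p (i + 1))" .
  have "{i..<i + m} = insert i (insert (i + m - 1) {i + 1..<i + m - 1})" using m by auto
  then have "half_area m p = wedge (p i) (p (i + 1)) + (wedge (p (i + m - 1)) (p (i + m))
      + (\<Sum>s\<in>{i + 1..<i + m - 1}. wedge (p s) (p (s + 1))))"
    using half_area_shift[OF _ ap, of i] m by (simp add: algebra_simps)
  then have "half_area (m - 1) q = half_area m p
       - (wedge (p (i - 1)) (p i) + wedge (p i) (p (i + 1)) - wedge (p (i - 1)) (p (i + 1)))"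
    using 1 by (simp add: pm pm')
  then show ?thesis using that admq by blast
qed

text \<open>If \<^term>\<open>p i\<close> has no tight partner besides possibly \<^term>\<open>p j\<close>, it can be moved in both directions
  along \<^term>\<open>p j\<close>. The area is affine and the spread strictly convex along this segment.\<close>

lemma two_tight_partners:
  assumes m: "m \<ge> 3" and adm: "admissible m p"
    and pos: "\<And>i j. i < j \<Longrightarrow> j < i + m \<Longrightarrow> 0 < wedge (p i) (p j)"
    and max: "\<And>q. admissible m q \<Longrightarrow> half_area m q \<le> half_area m p"
    and smax: "\<And>q. admissible m q \<Longrightarrow> half_area m q = half_area m p \<Longrightarrow> spread m q \<le> spread m p"
  shows "\<exists>l. i < l \<and> l < i + m \<and> l \<noteq> j \<and> wedge (p i) (p l) = 1"
proof -
  note ap = admissible_antiperiodic[OF adm]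
  have main: "\<exists>l. i < l \<and> l < i + m \<and> l \<noteq> j \<and> wedge (p i) (p l) = 1" if j: "i < j" "j < i + m" for j
  proof (rule ccontr)
    assume no: "\<not> ?thesis"
    define v where "v l = wedge (p i) (p l)" for l
    define E where "E = (\<lambda>l. min (v l) (1 - v l)) ` ({i + 1..<i + m} - {j})"
    have v01: "0 < v l \<and> v l < 1" if "i < l" "l < i + m" "l \<noteq> j" for l
      using pos[of i l] admissible_bounds(2)[OF adm, of i l] no that by (force simp: v_def)
    define \<epsilon> where "\<epsilon> = Min (insert 1 E)"
    have fE: "finite (insert 1 E)" by (simp add: E_def)
    have "\<forall>x\<in>insert 1 E. 0 < x" using v01 by (auto simp: E_def)
    then have \<epsilon>: "0 < \<epsilon>" unfolding \<epsilon>_def using fE by (subst Min_gr_iff) auto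
    have \<epsilon>le: "\<epsilon> \<le> v l \<and> \<epsilon> \<le> 1 - v l" if "i < l" "l < i + m" "l \<noteq> j" for l
    proof -
      have "min (v l) (1 - v l) \<in> insert 1 E" using that by (auto simp: E_def)
      then have "\<epsilon> \<le> min (v l) (1 - v l)" unfolding \<epsilon>_def using fE by (rule Min_le[rotated])
      then show ?thesis by simp
    qed
    \<comment> \<open>Moving along \<open>p j\<close> leaves the wedge with \<open>p j\<close>
      unchanged, so the one constraint that may be tight is preserved for both signs of
      \<open>t\<close>.\<close>
    define f where "f t s = (if s = 0 then p i + t *\<^sub>R p j else p (i + s))" for t :: real and s :: int
    define q where "q t = antiperiodic_extension m (f t)" for t
    have base: "q t s = f t s" if "0 \<le> s" "s < m" for t s
      using that by (simp add: q_def antiperiodic_extension_base)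
    have absw: "\<bar>wedge (p j) (p l)\<bar> \<le> 1" if "i < l" "l < i + m" for l
    proof (cases "j \<le> l")
      case True
      then show ?thesis using admissible_bounds[OF adm, of j l] that j by auto
    next
      case False
      then show ?thesis
        using admissible_bounds[OF adm, of l j] that j wedge_commute[of "p j" "p l"] by auto
    qed
    have admq: "admissible m (q t)" if t: "\<bar>t\<bar> \<le> \<epsilon>" for t
      unfolding q_def
    proof (rule admissible_extension)
      fix s r :: int assume sr: "0 \<le> s" "s < r" "r < m"
      show "0 \<le> wedge (f t s) (f t r) \<and> wedge (f t s) (f t r) \<le> 1"
      proof (cases "s = 0")
        case True
        have w: "wedge (f t s) (f t r) = v (i + r) + t * wedge (p j) (p (i + r))"
          using True sr by (simp add: f_def v_def wedge_linear)
        show ?thesis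
        proof (cases "i + r = j")
          case True
          then show ?thesis unfolding w using admissible_bounds[OF adm, of i j] j by (simp add: v_def)
        next
          case False
          have "\<bar>t * wedge (p j) (p (i + r))\<bar> \<le> \<epsilon> * 1"
            unfolding abs_mult using t absw[of "i + r"] sr by (intro mult_mono) auto
          then show ?thesis unfolding w using \<epsilon>le[of "i + r"] sr False by auto
        qed
      next
        case False
        then show ?thesis using admissible_bounds[OF adm, of "i + s" "i + r"] sr by (simp add: f_def)
      qed
    qed (use m in simp)
    define p' where "p' s = p (i + s)" for s
    have ap': "antiperiodic m p'" using antiperiodicD[OF ap] by (simp add: antiperiodic_def p'_def add.assoc[symmetric])
    have hp': "half_area m p' = half_area m p"
    proof -
      have "half_area m p' = (\<Sum>s\<in>{i..<i + m}. wedge (p s) (p (s + 1)))"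
        unfolding half_area_def
        by (rule sum.reindex_bij_witness[where j = "\<lambda>s. i + s" and i = "\<lambda>s. s - i"])
           (auto simp: p'_def algebra_simps)
      then show ?thesis using half_area_shift[OF _ ap] m by simp
    qed
    have sp': "spread m p' = spread m p" using spread_shift[OF _ ap, of i] m by (simp add: p'_def[abs_def])
    have aq: "antiperiodic m (q t)" for t
      unfolding q_def using m by (intro antiperiodic_extension) simp
    \<comment> \<open>The derivative of the wedges in \<open>t\<close>; they are affine because the
      moving point has wedge 0 with itself.\<close>
    define \<beta> where "\<beta> s r = (if s = 0 then wedge (p j) (p' r) else 0) + (if r = 0 then wedge (p' s) (p j) else 0)" for s r
    have wq: "wedge (q t s) (q t r) = wedge (p' s) (p' r) + t * \<beta> s r"
      if "0 \<le> s" "s < m" "0 \<le> r" "r < m" for s r t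
      using that wedge_commute[of "p j" "p i"]
      by (auto simp: base f_def p'_def \<beta>_def wedge_linear algebra_simps)
    have "half_area m (q \<epsilon>) + half_area m (q (- \<epsilon>)) = 2 * half_area m p'"
      using m unfolding half_area_antiperiodic[OF _ aq] half_area_antiperiodic[OF _ ap']
      by (simp add: half_area_antiperiodic[OF _ aq] half_area_antiperiodic[OF _ ap'] wq
            sum.distrib sum_subtractf)
    then have eq: "half_area m (q \<epsilon>) = half_area m p" "half_area m (q (- \<epsilon>)) = half_area m p"
      using max[OF admq, of \<epsilon>] max[OF admq, of "- \<epsilon>"] \<epsilon> hp' by auto
    \<comment> \<open>Here \<open>m >= 3\<close> provides a third index, at which the derivative is
      nonzero; this makes the spread strictly convex.\<close>
    have "\<exists>l. i < l \<and> l < i + m \<and> l \<noteq> j"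
      using m by (cases "j = i + 1") (auto intro: exI[of _ "i + 1"] exI[of _ "i + 2"])
    then obtain l where l: "i < l" "l < i + m" "l \<noteq> j" by blast
    have "wedge (p j) (p l) \<noteq> 0"
      using pos[of j l] pos[of l j] l j wedge_commute[of "p j" "p l"] by (cases "j < l") auto
    then have \<beta>l: "\<beta> 0 (l - i) \<noteq> 0" using l by (simp add: \<beta>_def p'_def)
    have sqs: "(wedge (q \<epsilon> s) (q \<epsilon> r))\<^sup>2 + (wedge (q (- \<epsilon>) s) (q (- \<epsilon>) r))\<^sup>2
        = 2 * (wedge (p' s) (p' r))\<^sup>2 + 2 * \<epsilon>\<^sup>2 * (\<beta> s r)\<^sup>2"
      if "0 \<le> s" "s < m" "0 \<le> r" "r < m" for s r
      using that by (simp add: wq power2_eq_square algebra_simps)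
    have "spread m (q \<epsilon>) + spread m (q (- \<epsilon>))
        = (\<Sum>s\<in>{0..<m}. \<Sum>r\<in>{0..<m}. 2 * (wedge (p' s) (p' r))\<^sup>2 + 2 * \<epsilon>\<^sup>2 * (\<beta> s r)\<^sup>2)"
      unfolding spread_def sum.distrib[symmetric] by (intro sum.cong refl) (simp add: sqs)
    also have "\<dots> = 2 * spread m p' + 2 * \<epsilon>\<^sup>2 * (\<Sum>s\<in>{0..<m}. \<Sum>r\<in>{0..<m}. (\<beta> s r)\<^sup>2)"
      by (simp add: spread_def sum.distrib sum_distrib_left)
    also have "\<dots> > 2 * spread m p'"
    proof -
      have row: "0 < (\<Sum>r\<in>{0..<m}. (\<beta> 0 r)\<^sup>2)"
        using \<beta>l l by (intro sum_pos2[where i = "l - i"]) auto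
      have "0 < (\<Sum>s\<in>{0..<m}. \<Sum>r\<in>{0..<m}. (\<beta> s r)\<^sup>2)"
        by (rule sum_pos2[where i = 0 and f = "\<lambda>s. \<Sum>r\<in>{0..<m}. (\<beta> s r)\<^sup>2"])
           (use m row in \<open>simp_all add: sum_nonneg\<close>)
      then show ?thesis using \<epsilon> by simp
    qed
    finally have "2 * spread m p < spread m (q \<epsilon>) + spread m (q (- \<epsilon>))" using sp' by simp
    then show False
      using smax[OF admq eq(1)] smax[OF admq eq(2)] \<epsilon> by auto
  qed
  show ?thesis
  proof (cases "i < j \<and> j < i + m")
    case True
    then show ?thesis using main by blast
  next
    case False
    then show ?thesis using main[of "i + 1"] m by auto
  qed
qed

section \<open>The area bound for admissible configurations\<close>

text \<open>A regular 2\<mu>-gon of circumradius 1 with \<mu> odd has area \<mu> sin (pi / \<mu>)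
  and largest wedge cos (pi / (2 \<mu>)); the quotient is 2 \<mu> sin (pi / (2 \<mu>)). An even
  \<open>m\<close> inherits the value of \<open>m - 1\<close>.\<close>

definition odd_gon_bound :: "int \<Rightarrow> real" where
  "odd_gon_bound m = (let \<mu> = real_of_int (if odd m then m else m - 1) in 2 * \<mu> * sin (pi / (2 * \<mu>)))"

lemma sin_mult_ge:
  assumes "0 \<le> c" "c \<le> 1" "0 \<le> x" "x \<le> pi"
  shows "c * sin x \<le> sin (c * x)"
proof -
  have "0 \<in> {0..pi}" "x \<in> {0..pi}" using assms by auto
  from concave_onD[OF concave_on_sin assms(1,2) this] show ?thesis by (simp del: sin_zero) simp
qed

text \<open>With x = pi / (2 \<mu>) the expression is pi times sin x / x, which decreases in
  x.\<close>

lemma gon_bound_mono: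
  assumes "1 \<le> \<mu>" "\<mu> \<le> \<nu>"
  shows "2 * \<mu> * sin (pi / (2 * \<mu>)) \<le> 2 * \<nu> * sin (pi / (2 * \<nu>))"
proof -
  have "(\<mu> / \<nu>) * sin (pi / (2 * \<mu>)) \<le> sin ((\<mu> / \<nu>) * (pi / (2 * \<mu>)))"
    using assms by (intro sin_mult_ge) (auto simp: field_simps)
  then show ?thesis using assms by (simp add: field_simps)
qed

lemma odd_gon_bound_mono:
  assumes "m \<ge> 2"
  shows "odd_gon_bound (m - 1) \<le> odd_gon_bound m"
  unfolding odd_gon_bound_def Let_def
proof (rule gon_bound_mono)
  have "1 \<le> (if odd (m - 1) then m - 1 else m - 1 - 1)"
    "(if odd (m - 1) then m - 1 else m - 1 - 1) \<le> (if odd m then m else m - 1)"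
    using assms by presburger+
  then show "1 \<le> real_of_int (if odd (m - 1) then m - 1 else m - 1 - 1)"
    "real_of_int (if odd (m - 1) then m - 1 else m - 1 - 1) \<le> real_of_int (if odd m then m else m - 1)"
    by linarith+
qed

lemma odd_gon_bound_ge_2:
  assumes "m \<ge> 1"
  shows "2 \<le> odd_gon_bound m"
proof -
  have "1 \<le> (if odd m then m else m - 1)" using assms by presburger
  then have "1 \<le> real_of_int (if odd m then m else m - 1)" by linarith
  from gon_bound_mono[OF order_refl this] show ?thesis by (simp add: odd_gon_bound_def Let_def)
qed

text \<open>A maximiser above the bound for \<open>m\<close> is also above the bound for
  \<open>m - 1\<close>, so by induction deleting any vertex strictly lowers its area. This is the
  strict convexity that rigidity needs; rigidity then makes \<open>m\<close> odd, and the Radon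
  estimate contradicts the assumption. For \<open>m = 2\<close> a single wedge decides.\<close>

theorem half_area_le:
  assumes "m \<ge> 1" "admissible m p"
  shows "half_area m p \<le> odd_gon_bound m"
  using assms
proof (induction m arbitrary: p rule: int_ge_induct)
  case base
  have "half_area 1 p = 0"
    using half_area_antiperiodic[OF _ admissible_antiperiodic[OF base]] by simp
  then show ?case using odd_gon_bound_ge_2[of 1] by simp
next
  case (step n)
  define m where "m = n + 1"
  have IH: "half_area (m - 1) q \<le> odd_gon_bound (m - 1)" if "admissible (m - 1) q" for q
    using step.IH that by (simp add: m_def)
  have "half_area m p0 \<le> odd_gon_bound m" if p0: "admissible m p0" for p0
  proof (cases "m = 2")
    case True
    have "{0..<1::int} = {0}" by auto
    then have "half_area m p0 = 2 * wedge (p0 0) (p0 1)"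
      using half_area_antiperiodic[OF _ admissible_antiperiodic[OF p0]] True by simp
    then show ?thesis
      using admissible_bounds(2)[OF p0, of 0 1] odd_gon_bound_ge_2[of m] True by simp
  next
    case False
    then have m: "m \<ge> 3" using step.hyps by (simp add: m_def)
    show ?thesis
    proof (rule ccontr)
      assume gt: "\<not> ?thesis"
      then have "0 < half_area m p0" using odd_gon_bound_ge_2[of m] m by simp
      moreover have "m \<ge> 1" using m by simp
      ultimately obtain p where adm: "admissible m p"
        and max: "\<And>q. admissible m q \<Longrightarrow> half_area m q \<le> half_area m p"
        and smax: "\<And>q. admissible m q \<Longrightarrow> half_area m q = half_area m p \<Longrightarrow> spread m q \<le> spread m p"
        using lexicographic_maximizer[OF _ p0] by metis
      have big: "odd_gon_bound m < half_area m p" using gt max[OF p0] by simp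
      have m2: "m \<ge> 2" using m by simp
      have D: "wedge (p (i - 1)) (p (i + 1)) < wedge (p (i - 1)) (p i) + wedge (p i) (p (i + 1))" for i
      proof -
        obtain q where q: "admissible (m - 1) q" "half_area (m - 1) q = half_area m p
           - (wedge (p (i - 1)) (p i) + wedge (p i) (p (i + 1)) - wedge (p (i - 1)) (p (i + 1)))"
          by (rule delete_vertex[OF m2 adm])
        then show ?thesis using IH[OF q(1)] odd_gon_bound_mono[of m] m big by simp
      qed
      note pos = strictly_convex_pos[OF m2 adm D]
      obtain k where k: "m = 2 * k + 1"
        "\<And>s. p (s + 1) - p s = wedge (p s) (p (s + 1)) *\<^sub>R p (s + k + 1)"
        using rigid_configuration[OF m adm D two_tight_partners[OF m adm pos max smax]] by blast
      have "half_area m p \<le> odd_gon_bound m"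
        using radon_half_area_le[OF m2 admissible_antiperiodic[OF adm] pos k]
        by (simp add: odd_gon_bound_def k(1))
      then show False using big by simp
    qed
  qed
  then show ?case using step.prems by (simp add: m_def)
qed

section \<open>Areas and symmetric bodies\<close>

definition span_map :: "real^2 \<Rightarrow> real^2 \<Rightarrow> real^2 \<Rightarrow> real^2" where
  "span_map x y v = v$1 *\<^sub>R x + v$2 *\<^sub>R y"

lemma linear_span_map: "linear (span_map x y)"
  by (rule linearI) (simp_all add: span_map_def algebra_simps)

lemma det_span_map: "det (matrix (span_map x y)) = wedge x y"
  by (simp add: det_2 matrix_def span_map_def wedge_def axis_def)

lemma area_span_map:
  "S \<in> lmeasurable \<Longrightarrow> area (span_map x y ` S) = \<bar>wedge x y\<bar> * area S"
  by (simp add: measure_linear_image[OF linear_span_map] det_span_map)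

lemma area_square: "area (cbox (-1) 1) = 4"
proof -
  have "area (cbox (-1) (1::real^2)) = measure lborel (cbox (-1) (1::real^2))"
    by (simp add: measure_completion)
  also have "\<dots> = (\<Prod>i\<in>UNIV. (1::real^2)$i - (-1::real^2)$i)"
    by (subst content_cbox_cart) (auto simp: interval_ne_empty_cart)
  also have "\<dots> = 4" by (simp add: UNIV_2)
  finally show ?thesis .
qed

lemma area_span_map_square: "area (span_map x y ` cbox (-1) 1) = 4 * \<bar>wedge x y\<bar>"
  by (simp add: area_span_map area_square)

lemma area_triangle: "area (convex hull {a, b, c}) = \<bar>wedge (b - a) (c - a)\<bar> / 2"
proof -
  have "convex hull {a, b, c} \<in> sets borel"
    by (intro borel_compact finite_imp_compact_convex_hull) simp
  then have "area (convex hull {a, b, c}) = measure lborel (convex hull {a, b, c})"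
    by (simp add: measure_completion)
  then show ?thesis by (simp add: content_triangle wedge_def abs_minus_commute mult.commute)
qed

text \<open>The generators are the sum and difference of the two columns, so the four vertices are
  the images of the corners of the square.\<close>

lemma cross_polytope_eq_span_map:
  "convex hull {x, - x, y, - y} = span_map ((1/2) *\<^sub>R (x + y)) ((1/2) *\<^sub>R (x - y)) ` cbox (-1) 1"
    (is "?C = ?L ` _")
proof
  have L: "?L v = ((v$1 + v$2) / 2) *\<^sub>R x + ((v$1 - v$2) / 2) *\<^sub>R y" for v
    by (simp add: span_map_def vec2_eq_iff field_simps)
  have corner: "?L (vector [a, b]) \<in> ?L ` cbox (-1) 1" if "\<bar>a\<bar> = 1" "\<bar>b\<bar> = 1" for a b
    using that by (intro imageI) (auto simp: mem_box_cart forall_2)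
  have "{x, - x, y, - y} \<subseteq> ?L ` cbox (-1) 1"
    using corner[of 1 1] corner[of "-1" "-1"] corner[of 1 "-1"] corner[of "-1" 1] by (simp add: L)
  then show "?C \<subseteq> ?L ` cbox (-1) 1"
    by (intro hull_minimal convex_linear_image linear_span_map convex_box)
  show "?L ` cbox (-1) 1 \<subseteq> ?C"
  proof
    fix z assume "z \<in> ?L ` cbox (-1) 1"
    then obtain v where v: "v \<in> cbox (-1) 1" "z = ?L v" by blast
    define a b where "a = (1 + v$1) / 2" and "b = (1 + v$2) / 2"
    have ab: "0 \<le> a" "a \<le> 1" "0 \<le> b" "b \<le> 1" using v(1) by (auto simp: a_def b_def mem_box_cart forall_2)
    have C: "x \<in> ?C" "- x \<in> ?C" "y \<in> ?C" "- y \<in> ?C" by (simp_all add: hull_inc)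
    have edges: "b *\<^sub>R x + (1 - b) *\<^sub>R y \<in> ?C" "b *\<^sub>R (- y) + (1 - b) *\<^sub>R (- x) \<in> ?C"
      by (rule convexD[OF convex_convex_hull]; use ab C in simp)+
    have "a *\<^sub>R (b *\<^sub>R x + (1 - b) *\<^sub>R y) + (1 - a) *\<^sub>R (b *\<^sub>R (- y) + (1 - b) *\<^sub>R (- x)) \<in> ?C"
      by (rule convexD[OF convex_convex_hull edges]) (use ab in simp_all)
    also have "a *\<^sub>R (b *\<^sub>R x + (1 - b) *\<^sub>R y) + (1 - a) *\<^sub>R (b *\<^sub>R (- y) + (1 - b) *\<^sub>R (- x)) = z"
      unfolding v(2) L by (simp add: vec2_eq_iff a_def b_def field_simps)
    finally show "z \<in> ?C" .
  qed
qed

lemma area_cross_polytope: "area (convex hull {x, - x, y, - y}) = 2 * \<bar>wedge x y\<bar>"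
proof -
  have "wedge ((1/2) *\<^sub>R (x + y)) ((1/2) *\<^sub>R (x - y)) = - wedge x y / 2"
    by (simp add: wedge_def field_simps)
  then show ?thesis unfolding cross_polytope_eq_span_map area_span_map_square by simp
qed

lemma independent_iff_wedge:
  "x \<noteq> y \<and> independent {x, y} \<longleftrightarrow> wedge x y \<noteq> 0"
proof
  assume A: "x \<noteq> y \<and> independent {x, y}"
  show "wedge x y \<noteq> 0"
  proof
    assume w: "wedge x y = 0"
    have "x \<noteq> 0" using A dependent_zero[of "{x, y}"] by auto
    then obtain c where "y = c *\<^sub>R x" using wedge_eq_0_imp_scaleR[OF w] by blast
    then have "y \<in> span {x}" by (simp add: span_base span_mul)
    then show False using A by (auto simp: insert_commute[of x y] independent_insert split: if_splits)
  qed
next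
  assume w: "wedge x y \<noteq> 0"
  then have "x \<noteq> y" "y \<noteq> 0" by auto
  moreover have "x \<notin> span {y}" using w by (auto simp: span_singleton)
  ultimately show "x \<noteq> y \<and> independent {x, y}" by (simp add: independent_insert)
qed

lemma symmetric_bodiesD:
  assumes "B \<in> symmetric_bodies"
  shows "compact B" "convex B" "interior B \<noteq> {}" "x \<in> B \<Longrightarrow> - x \<in> B"
  using assms by (auto simp: symmetric_bodies_def)

lemma symmetric_body_contains_ball:
  assumes B: "B \<in> symmetric_bodies"
  obtains e where "0 < e" "ball 0 e \<subseteq> B"
proof -
  obtain c where "c \<in> interior B" using symmetric_bodiesD(3)[OF B] by blast
  then obtain e where e: "0 < e" "ball c e \<subseteq> B" using mem_interior by blast
  have "ball 0 (e / 2) \<subseteq> B"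
  proof
    fix w :: "real^2" assume "w \<in> ball 0 (e / 2)"
    then have "c + 2 *\<^sub>R w \<in> B" using e by (intro subsetD[OF e(2)]) (simp add: dist_norm)
    moreover have "- c \<in> B" using symmetric_bodiesD(4)[OF B] e by (meson centre_in_ball subsetD)
    ultimately have "(1/2) *\<^sub>R (c + 2 *\<^sub>R w) + (1/2) *\<^sub>R (- c) \<in> B"
      by (intro convexD[OF symmetric_bodiesD(2)[OF B]]) auto
    then show "w \<in> B" by (simp add: vec2_eq_iff algebra_simps)
  qed
  then show ?thesis using that[of "e / 2"] e by simp
qed

lemma max_wedge_exists:
  assumes B: "B \<in> symmetric_bodies"
  obtains x y where "x \<in> B" "y \<in> B" "0 < wedge x y"
    "\<And>u v. u \<in> B \<Longrightarrow> v \<in> B \<Longrightarrow> \<bar>wedge u v\<bar> \<le> wedge x y"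
    "area (max_cross_polytope B) = 2 * wedge x y"
proof -
  note sym = symmetric_bodiesD[OF B]
  obtain e where e: "0 < e" "ball 0 e \<subseteq> B" by (rule symmetric_body_contains_ball[OF B])
  define d1 d2 :: "real^2" where "d1 = vector [e/2, 0]" and "d2 = vector [0, e/2]"
  have d: "d1 \<in> B" "d2 \<in> B"
    using e by (auto intro!: subsetD[OF e(2)] simp: d1_def d2_def norm_vec_def L2_set_def sum_2 dist_norm)
  have wd: "0 < wedge d1 d2" using e by (simp add: wedge_def d1_def d2_def)
  have "continuous_on (B \<times> B) (\<lambda>z. wedge (fst z) (snd z))" by (intro continuous_intros)
  then have "\<exists>z\<in>B \<times> B. \<forall>w\<in>B \<times> B. wedge (fst w) (snd w) \<le> wedge (fst z) (snd z)"
    using sym(1) d by (intro continuous_attains_sup compact_Times) auto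
  then obtain x y where xy: "x \<in> B" "y \<in> B" and max: "\<And>u v. u \<in> B \<Longrightarrow> v \<in> B \<Longrightarrow> wedge u v \<le> wedge x y"
    by force
  have pos: "0 < wedge x y" using max[OF d] wd by simp
  have absmax: "\<bar>wedge u v\<bar> \<le> wedge x y" if "u \<in> B" "v \<in> B" for u v
    using max[OF that] max[OF that(2,1)] wedge_commute[of u v] by simp
  define P where "P = (\<lambda>P. cross_polytope P \<and> P \<subseteq> B)"
  have le: "area Q \<le> 2 * wedge x y" if Q: "P Q" for Q
  proof -
    obtain u v where uv: "Q = convex hull {u, - u, v, - v}" using Q by (auto simp: P_def cross_polytope_def)
    then have "u \<in> B" "v \<in> B" using Q by (auto simp: P_def intro: hull_inc)
    then show ?thesis unfolding uv area_cross_polytope using absmax by simp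
  qed
  define Z where "Z = convex hull {x, - x, y, - y}"
  have Z: "P Z" "area Z = 2 * wedge x y"
  proof -
    show "P Z" unfolding P_def Z_def cross_polytope_def
    proof
      show "\<exists>u v. u \<noteq> v \<and> independent {u, v} \<and> convex hull {x, - x, y, - y} = convex hull {u, - u, v, - v}"
        using independent_iff_wedge[of x y] pos by (intro exI[of _ x] exI[of _ y]) auto
      show "convex hull {x, - x, y, - y} \<subseteq> B" using xy sym by (intro hull_minimal) auto
    qed
    show "area Z = 2 * wedge x y" using pos by (simp add: Z_def area_cross_polytope)
  qed
  \<comment> \<open>The choice operator may return another maximiser than \<open>Z\<close>; only the
    common area is transferred.\<close>
  have "is_arg_max area P (arg_max area P)"
    unfolding arg_max_def by (rule someI[of _ Z]) (use Z le in \<open>force simp: is_arg_max_linorder\<close>)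
  then have "area (arg_max area P) = 2 * wedge x y"
    using Z le[of "arg_max area P"] by (force simp: is_arg_max_linorder)
  then have "area (max_cross_polytope B) = 2 * wedge x y"
    by (simp add: max_cross_polytope_def P_def)
  with that[OF xy pos absmax] show ?thesis by blast
qed

text \<open>By Cramer's rule the coordinates of a point of \<open>B\<close> in the basis
  \<open>x\<close>, \<open>y\<close> are quotients of wedges, bounded by 1 by maximality; so
  \<open>B\<close> lies in a parallelogram of area \<open>4 * wedge x y\<close>.\<close>

lemma area_body_le:
  assumes xy: "0 < wedge x y" and x: "x \<in> B" and y: "y \<in> B" and B: "compact B"
    and max: "\<And>u v. u \<in> B \<Longrightarrow> v \<in> B \<Longrightarrow> \<bar>wedge u v\<bar> \<le> wedge x y"
  shows "area B \<le> 4 * wedge x y"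
proof -
  have "B \<subseteq> span_map x y ` cbox (-1) 1"
  proof
    fix v assume v: "v \<in> B"
    have "v = span_map x y (vector [wedge v y / wedge x y, wedge x v / wedge x y])"
    proof -
      have "v = (1 / wedge x y) *\<^sub>R (wedge x y *\<^sub>R v)" using xy by simp
      also have "\<dots> = (1 / wedge x y) *\<^sub>R (wedge v y *\<^sub>R x + wedge x v *\<^sub>R y)"
        unfolding wedge_expand[of x y v] ..
      finally show ?thesis by (simp add: span_map_def scaleR_add_right)
    qed
    moreover have "vector [wedge v y / wedge x y, wedge x v / wedge x y] \<in> cbox (-1) (1::real^2)"
      using max[OF v y] max[OF x v] xy by (simp add: mem_box_cart forall_2 abs_le_iff field_simps)
    ultimately show "v \<in> span_map x y ` cbox (-1) 1" by blast
  qed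
  then have "area B \<le> area (span_map x y ` cbox (-1) 1)"
    using B by (intro measure_mono_fmeasurable measurable_linear_image linear_span_map)
      (auto simp: lmeasurable_compact fmeasurableD)
  then show ?thesis using xy by (simp add: area_span_map_square)
qed

text \<open>\<open>Q\<close> and its reflection have disjoint interiors: a common interior point and
  its negative would both be interior to \<open>Q\<close>, and so would their midpoint, the
  origin.\<close>

lemma area_le_half_body:
  assumes B: "B \<in> symmetric_bodies" and Q: "convex Q" "compact Q" "Q \<subseteq> B" and o: "0 \<notin> interior Q"
  shows "2 * area Q \<le> area B"
proof -
  have Q': "convex (uminus ` Q)" "compact (uminus ` Q)"
    using Q(1,2) by (auto intro: convex_negations compact_negations)
  have area': "area (uminus ` Q) = area Q"
  proof -
    have "uminus = span_map (vector [-1, 0]) (vector [0, -1])"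
      by (auto simp: span_map_def vec2_eq_iff)
    then show ?thesis
      using area_span_map[of Q "vector [-1, 0]" "vector [0, -1]"] lmeasurable_compact[OF Q(2)]
      by (simp add: wedge_def)
  qed
  have "interior (Q \<inter> uminus ` Q) = {}"
  proof (rule ccontr)
    assume "interior (Q \<inter> uminus ` Q) \<noteq> {}"
    then obtain c where c: "c \<in> interior Q" "c \<in> interior (uminus ` Q)" by auto
    have "interior (uminus ` Q) = uminus ` interior Q" by (rule interior_negations)
    then have "- c \<in> interior Q" using c(2) by auto
    then have "(1/2) *\<^sub>R c + (1/2) *\<^sub>R (- c) \<in> interior Q"
      using c(1) by (intro convexD[OF convex_interior[OF Q(1)]]) auto
    then show False using o by simp
  qed
  then have "negligible (Q \<inter> uminus ` Q)"
    using negligible_convex_interior[of "Q \<inter> uminus ` Q"] Q(1) Q'(1) by (simp add: convex_Int)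
  then have "area (Q \<union> uminus ` Q) = area Q + area (uminus ` Q)"
    using Q(2) Q'(2) by (simp add: measure_Un3 lmeasurable_compact negligible_imp_measure0)
  moreover have "area (Q \<union> uminus ` Q) \<le> area B"
    using Q Q'(2) symmetric_bodiesD[OF B]
    by (intro measure_mono_fmeasurable) (auto simp: lmeasurable_compact fmeasurableD compact_Un)
  ultimately show ?thesis using area' by simp
qed

section \<open>Symmetrization of inscribed polygons\<close>

text \<open>For a convex body with the origin in its interior these are the boundary points; the
  radial form is the one that moving vertices outward produces.\<close>

definition outer_point :: "(real^2) set \<Rightarrow> real^2 \<Rightarrow> bool" where
  "outer_point B q \<longleftrightarrow> q \<in> B \<and> (\<forall>c>1. c *\<^sub>R q \<notin> B)"

lemma outer_point_nonzero: "outer_point B q \<Longrightarrow> q \<noteq> 0"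
  unfolding outer_point_def by (metis lt_ex gt_ex scaleR_zero_right)

lemma outer_point_combination:
  assumes B: "convex B" and q: "outer_point B q" and ab: "a \<in> B" "b \<in> B" "0 \<le> \<alpha>" "0 \<le> \<beta>"
    and eq: "q = \<alpha> *\<^sub>R a + \<beta> *\<^sub>R b"
  shows "1 \<le> \<alpha> + \<beta>"
proof (rule ccontr)
  assume less: "\<not> 1 \<le> \<alpha> + \<beta>"
  have "\<alpha> + \<beta> \<noteq> 0"
  proof
    assume "\<alpha> + \<beta> = 0"
    then have "\<alpha> = 0" "\<beta> = 0" using ab by auto
    then show False using eq outer_point_nonzero[OF q] by simp
  qed
  then have s: "0 < \<alpha> + \<beta>" using ab by simp
  have "(\<alpha> / (\<alpha> + \<beta>)) *\<^sub>R a + (\<beta> / (\<alpha> + \<beta>)) *\<^sub>R b \<in> B"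
    using ab s by (intro convexD[OF B]) (auto simp flip: add_divide_distrib)
  also have "(\<alpha> / (\<alpha> + \<beta>)) *\<^sub>R a + (\<beta> / (\<alpha> + \<beta>)) *\<^sub>R b = (1 / (\<alpha> + \<beta>)) *\<^sub>R q"
    unfolding eq by (simp add: scaleR_add_right)
  finally show False using q s less by (auto simp: outer_point_def)
qed

text \<open>Cramer's rule writes \<open>y\<close> as a nonnegative combination of \<open>x\<close>
  and \<open>w\<close>. A coefficient sum below 1 would allow \<open>y\<close> to be scaled up
  inside \<open>B\<close>.\<close>

lemma outer_point_triangle:
  assumes B: "convex B" and pts: "x \<in> B" "outer_point B y" "w \<in> B"
    and pos: "0 \<le> wedge x y" "0 \<le> wedge y w" "0 \<le> wedge x w"
  shows "wedge x w \<le> wedge x y + wedge y w"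
proof (cases "wedge x w = 0")
  case False
  then have D: "0 < wedge x w" using pos by simp
  have "y = (1 / wedge x w) *\<^sub>R (wedge x w *\<^sub>R y)" using D by simp
  also have "\<dots> = (wedge y w / wedge x w) *\<^sub>R x + (wedge x y / wedge x w) *\<^sub>R w"
    unfolding wedge_expand[of x w y] by (simp add: scaleR_add_right)
  finally have "1 \<le> wedge y w / wedge x w + wedge x y / wedge x w"
    using pos D by (intro outer_point_combination[OF B pts(2,1,3)]) auto
  then show ?thesis using D by (simp add: field_simps)
qed (use pos in simp)

text \<open>The directions of the two chords of the convex curve bounding \<^term>\<open>B\<close> differ by at most a
  half turn.\<close>

lemma outer_point_monge:
  assumes B: "convex B" and sym: "\<And>x. x \<in> B \<Longrightarrow> - x \<in> B"
    and out: "outer_point B a" "outer_point B s" "outer_point B t" "outer_point B u"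
    and pos: "0 \<le> wedge a s" "0 \<le> wedge a t" "0 \<le> wedge a u" "0 \<le> wedge s t" "0 \<le> wedge s u" "0 \<le> wedge t u"
  shows "0 \<le> wedge (s - a) (u - t)"
proof -
  have mem: "a \<in> B" "s \<in> B" "t \<in> B" "u \<in> B" "- a \<in> B" "- s \<in> B" "- u \<in> B"
    using out sym by (auto simp: outer_point_def)
  have outa: "outer_point B (- a)"
    using out(1) sym unfolding outer_point_def by (metis minus_minus scaleR_minus_right)
  note com = wedge_commute[of u a] wedge_commute[of s a] wedge_commute[of u s] wedge_commute[of t a]
    wedge_commute[of t s] wedge_commute[of u t]
  note tri = outer_point_triangle[OF B]
  have 1: "wedge a u \<le> wedge a s + wedge s u" using tri[of a s u] mem out pos by simp
  have 2: "wedge a u \<le> wedge a t + wedge t u" using tri[of a t u] mem out pos by simp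
  have 3: "wedge s u \<le> wedge a u + wedge a s" using tri[of "- u" a s] mem out pos com by simp
  have 4: "wedge a t \<le> wedge t u + wedge a u" using tri[of t u "- a"] mem out pos com by simp
  have 5: "wedge a s \<le> wedge s u + wedge a u" using tri[of s u "- a"] mem out pos com by simp
  have 6: "wedge t u \<le> wedge a u + wedge a t" using tri[of "- u" a t] mem out pos com by simp
  have 7: "wedge s t \<le> wedge a t + wedge a s" using tri[of t "- a" "- s"] mem outa pos com by simp
  have goal: "wedge (s - a) (u - t) = wedge s u + wedge a t - wedge s t - wedge a u"
    by (simp add: wedge_linear)
  show ?thesis
  proof (cases "wedge a u = 0")
    case True
    then show ?thesis using 3 5 7 goal by simp
  next
    case False
    then have D: "0 < wedge a u" using pos by simp
    \<comment> \<open>Inequalities 1 and 3 bound the first factor in absolute value by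
      \<open>wedge a s\<close>, 2 and 4 the second by \<open>wedge t u\<close>. The Pluecker
      relation below turns the product estimate into the claim.\<close>
    have "(wedge a u - wedge s u) * (wedge a u - wedge a t)
        \<le> \<bar>wedge a u - wedge s u\<bar> * \<bar>wedge a u - wedge a t\<bar>" by (metis abs_ge_self abs_mult)
    also have "\<dots> \<le> wedge a s * wedge t u" using 1 2 3 4 by (intro mult_mono) auto
    finally have "(wedge a u - wedge s u) * (wedge a u - wedge a t) \<le> wedge a s * wedge t u" .
    moreover have "wedge a u * wedge (s - a) (u - t)
        = wedge a s * wedge t u - (wedge a u - wedge s u) * (wedge a u - wedge a t)"
      by (simp add: wedge_def algebra_simps)
    ultimately have "0 \<le> wedge a u * wedge (s - a) (u - t)" by simp
    then show ?thesis using D by (simp add: zero_le_mult_iff)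
  qed
qed

section \<open>The merged vertex cycle and Dowker's averaging\<close>

lemma convex_wedge_le: "convex {x. wedge x a \<le> c}"
proof -
  have "{x. wedge x a \<le> c} = {x. inner (vector [a$2, - a$1]) x \<le> c}"
    by (simp add: wedge_def inner_vec_def sum_2 mult.commute)
  then show ?thesis by (simp add: convex_halfspace_le)
qed

lemma convex_hull_wedge_le:
  "S \<subseteq> {x. wedge x a \<le> c} \<Longrightarrow> convex hull S \<subseteq> {x. wedge x a \<le> c}"
  by (intro hull_minimal convex_wedge_le)

lemma periodic_multiple:
  fixes f :: "int \<Rightarrow> 'a"
  assumes "\<And>i. f (i + N) = f i"
  shows "f (i + t * N) = f i"
proof (induction t rule: int_induct[where k = 0])
  case base
  then show ?case by simp
next
  case (step1 t)
  then show ?case using assms[of "i + t * N"] by (simp add: algebra_simps)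
next
  case (step2 t)
  then show ?case using assms[of "i + (t - 1) * N"] by (simp add: algebra_simps)
qed

text \<open>The merged angular order of the vertices of a polygon (the indices satisfying \<^term>\<open>plus\<close>)
  and of their reflections in the origin.\<close>

locale merged_cycle =
  fixes n :: int and z :: "int \<Rightarrow> real^2" and plus :: "int \<Rightarrow> bool" and B Q :: "(real^2) set"
  assumes n: "0 < n" and z: "antiperiodic n z" and plus: "\<And>i. plus (i + n) \<longleftrightarrow> \<not> plus i"
    and order: "\<And>i j. i \<le> j \<Longrightarrow> j \<le> i + n \<Longrightarrow> 0 \<le> wedge (z i) (z j)"
    and outer: "\<And>i. outer_point B (z i)"
    and B: "convex B" "\<And>x. x \<in> B \<Longrightarrow> - x \<in> B"
    and Q: "compact Q" "Q \<subseteq> convex hull (z ` {i. plus i})" "0 \<in> interior Q"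
begin

lemma z_period: "z (i + 2 * n) = z i"
  using antiperiodicD[OF z, of i] antiperiodicD[OF z, of "i + n"] by (simp add: algebra_simps)

lemma plus_period: "plus (i + 2 * n) = plus i"
  using plus[of i] plus[of "i + n"] by (simp add: algebra_simps)

lemma z_multiple: "z (i + t * (2 * n)) = z i" and plus_multiple: "plus (i + t * (2 * n)) = plus i"
  by (rule periodic_multiple, rule z_period, rule periodic_multiple, rule plus_period)

lemma window:
  obtains t where "a \<le> i + t * (2 * n)" "i + t * (2 * n) < a + 2 * n"
proof (rule that)
  have "i + (- ((i - a) div (2 * n))) * (2 * n) = a + (i - a) mod (2 * n)"
    by (simp add: minus_div_mult_eq_mod[symmetric])
  then show "a \<le> i + (- ((i - a) div (2 * n))) * (2 * n)"
    "i + (- ((i - a) div (2 * n))) * (2 * n) < a + 2 * n"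
    using n by auto
qed

lemma z_nonzero: "z i \<noteq> 0"
  using outer_point_nonzero[OF outer] .

text \<open>Otherwise \<open>Q\<close> would lie in a closed half-plane with the origin on its
  boundary, although the origin is interior to \<open>Q\<close>.\<close>

lemma exists_plus_on_side:
  assumes w: "w \<noteq> 0"
  obtains i where "a \<le> i" "i < a + 2 * n" "plus i" "0 < wedge w (z i)"
proof -
  have "\<exists>i. plus i \<and> 0 < wedge w (z i)"
  proof (rule ccontr)
    assume no: "\<not> ?thesis"
    have "z ` {i. plus i} \<subseteq> {x. wedge x (- w) \<le> 0}"
    proof
      fix x assume "x \<in> z ` {i. plus i}"
      then show "x \<in> {x. wedge x (- w) \<le> 0}" using no wedge_commute[of x w] by force
    qed
    then have side: "Q \<subseteq> {x. wedge x (- w) \<le> 0}"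
      using Q(2) convex_hull_wedge_le by blast
    obtain e where e: "0 < e" "ball 0 e \<subseteq> Q" using Q(3) mem_interior by blast
    obtain q where q: "wedge q w = 1" using wedge_nonzero_exists[OF w] by blast
    define N where "N = norm q + 1"
    have N: "0 < N" unfolding N_def by (rule add_nonneg_pos) auto
    define c where "c = e / (2 * N)"
    have c: "0 < c" using e N by (simp add: c_def)
    have "norm (c *\<^sub>R (- q)) < e"
    proof -
      have "norm (c *\<^sub>R (- q)) = c * norm q" using c by simp
      also have "\<dots> \<le> c * N" using c by (simp add: N_def)
      also have "\<dots> = e / 2" using N by (simp add: c_def)
      finally show ?thesis using e by simp
    qed
    then have "c *\<^sub>R (- q) \<in> ball 0 e" by (simp only: mem_ball_0)
    then have "wedge (c *\<^sub>R (- q)) (- w) \<le> 0" using side e(2) by blast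
    then show False using q c by simp
  qed
  then obtain i where i: "plus i" "0 < wedge w (z i)" by blast
  obtain t where "a \<le> i + t * (2 * n)" "i + t * (2 * n) < a + 2 * n" by (rule window)
  then show ?thesis using that[of "i + t * (2 * n)"] i by (simp add: z_multiple plus_multiple)
qed

text \<open>The next index of an original vertex, skipping reflected ones.\<close>

definition nx :: "int \<Rightarrow> int" where
  "nx i = i + int (LEAST d. 0 < d \<and> plus (i + int d))"

lemma nx: "i < nx i" "plus (nx i)" and nx_le: "i < j \<Longrightarrow> plus j \<Longrightarrow> nx i \<le> j"
proof -
  have "\<exists>d>0. plus (i + int d)"
  proof (cases "plus i")
    case True
    then show ?thesis using n plus_period[of i] by (intro exI[of _ "nat (2 * n)"]) auto
  next
    case False
    then show ?thesis using n plus[of i] by (intro exI[of _ "nat n"]) auto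
  qed
  from LeastI_ex[OF this] show "i < nx i" "plus (nx i)" by (auto simp: nx_def)
  assume "i < j" "plus j"
  then have "(LEAST d. 0 < d \<and> plus (i + int d)) \<le> nat (j - i)" by (intro Least_le) auto
  then show "nx i \<le> j" using \<open>i < j\<close> by (simp add: nx_def)
qed

lemma nx_multiple: "nx (i + t * (2 * n)) = nx i + t * (2 * n)"
proof -
  have "plus (i + t * (2 * n) + int d) = plus (i + int d)" for d
    using plus_multiple[of "i + int d" t] by (simp add: algebra_simps)
  then show ?thesis by (simp add: nx_def)
qed

text \<open>Some original vertex lies strictly to the left of \<open>z k\<close>; the angular order
  puts its index strictly between \<open>k\<close> and \<open>k + n\<close>.\<close>

lemma nx_less: "plus k \<Longrightarrow> nx k < k + n"
proof (rule ccontr)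
  assume k: "plus k" and "\<not> nx k < k + n"
  obtain i where i: "k - n \<le> i" "i < k + n" "plus i" "0 < wedge (z k) (z i)"
    by (rule exists_plus_on_side[OF z_nonzero[of k], of "k - n"]) auto
  show False
  proof (cases "i \<le> k")
    case True
    then show False using order[of i k] i wedge_commute[of "z i" "z k"] by simp
  next
    case False
    then show False using nx_le[of k i] i \<open>\<not> nx k < k + n\<close> by simp
  qed
qed

text \<open>The line through two consecutive original vertices leaves all others on the side of the
  origin. For vertices roughly opposite to the edge the signs of the wedges suffice; for the
  remaining ones this is the triangle inequality of outer points.\<close>

lemma edge_supports:
  assumes i: "plus i" and q: "plus q"
  shows "wedge (z q) (z (nx i) - z i) \<le> wedge (z i) (z (nx i))"
proof -
  obtain t where t: "i - n \<le> q + t * (2 * n)" "q + t * (2 * n) < i - n + 2 * n" by (rule window)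
  define r where "r = q + t * (2 * n)"
  have r: "i - n \<le> r" "r < i + n" "plus r" "z r = z q"
    using t q by (auto simp: r_def z_multiple plus_multiple)
  define l where "l = nx i"
  have l: "i < l" "l < i + n" "plus l" using nx[of i] nx_less[OF i] by (auto simp: l_def)
  have mem: "z j \<in> B" for j using outer by (simp add: outer_point_def)
  note tri = outer_point_triangle[OF B(1) mem outer mem]
  have "wedge (z r) (z l) - wedge (z r) (z i) \<le> wedge (z i) (z l)"
  proof -
    consider "r \<le> l - n" | "l - n < r" "r \<le> i" | "i < r" "r < l" | "l \<le> r" by linarith
    then show ?thesis
    proof cases
      case 1
      have "z r = - z (r + n)" using antiperiodicD[OF z, of r] by simp
      then show ?thesis
        using order[of "r + n" l] order[of i "r + n"] order[of i l] 1 r l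
          wedge_commute[of "z (r + n)" "z i"] by simp
    next
      case 2
      then show ?thesis using tri[of r i l] order[of r i] order[of i l] order[of r l] r l by simp
    next
      case 3
      then show ?thesis using nx_le[of i r] r by (simp add: l_def)
    next
      case 4
      then show ?thesis
        using tri[of i l r] order[of i l] order[of l r] order[of i r] r l
          wedge_commute[of "z r" "z l"] wedge_commute[of "z r" "z i"] by simp
    qed
  qed
  then show ?thesis using r(4) by (simp add: wedge_linear l_def)
qed

lemma fan_cover:
  "Q \<subseteq> (\<Union>i\<in>{i \<in> {a..<a + 2 * n}. plus i}. convex hull {0, z i, z (nx i)})"
proof
  fix v assume v: "v \<in> Q"
  have "\<exists>i. plus i \<and> v \<in> convex hull {0, z i, z (nx i)}"
  proof (cases "v = 0")
    case True
    then show ?thesis using nx(2)[of 0] by (auto intro: hull_inc)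
  next
    case False
    obtain i0 where i0: "plus i0" "0 < wedge (- v) (z i0)"
      using exists_plus_on_side[of "- v"] False by auto
    \<comment> \<open>Between \<open>i0\<close> and \<open>j1\<close> the wedge of \<open>v\<close>
      with the original vertices changes sign; the last nonpositive index and its successor span the
      cone containing \<open>v\<close>.\<close>
    obtain j1 where j1: "i0 \<le> j1" "plus j1" "0 < wedge v (z j1)"
      using exists_plus_on_side[OF False, of i0] by auto
    define S where "S = {i \<in> {i0..<j1}. plus i \<and> wedge v (z i) \<le> 0}"
    have "j1 \<noteq> i0" using i0 j1 by auto
    then have "i0 \<in> S" using i0 j1 by (simp add: S_def)
    moreover have "finite S" unfolding S_def by (rule finite_subset[of _ "{i0..<j1}"]) auto
    moreover define i where "i = Max S"
    ultimately have i: "i \<in> S" "\<And>j. j \<in> S \<Longrightarrow> j \<le> i" using Max_in[of S] by (blast, simp)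
    define l where "l = nx i"
    have l: "i < l" "plus l" "l \<le> j1" "l < i + n"
      using nx[of i] nx_le[of i j1] nx_less[of i] i(1) j1 by (auto simp: l_def S_def)
    have vi: "plus i" "wedge v (z i) \<le> 0" using i(1) by (auto simp: S_def)
    have vl: "0 < wedge v (z l)"
    proof (rule ccontr)
      assume neg: "\<not> ?thesis"
      then have "l \<noteq> j1" using j1 by auto
      then have "l \<in> S" using neg l i(1) by (auto simp: S_def)
      then show False using i(2)[of l] l by simp
    qed
    \<comment> \<open>Were \<open>z l\<close> parallel to \<open>z i\<close>, it would be a negative
      multiple, and no later original vertex could lie strictly to the left of
      \<open>z i\<close>.\<close>
    have D: "0 < wedge (z i) (z l)"
    proof (rule ccontr)
      assume "\<not> ?thesis"
      then have "wedge (z i) (z l) = 0" using order[of i l] l by simp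
      then obtain c where c: "z l = c *\<^sub>R z i" using wedge_eq_0_imp_scaleR z_nonzero by blast
      then have "0 < c * wedge v (z i)" using vl by simp
      then have "c < 0" using vi(2) by (auto simp: zero_less_mult_iff)
      obtain r where r: "i - n \<le> r" "r < i + n" "plus r" "0 < wedge (z i) (z r)"
        by (rule exists_plus_on_side[OF z_nonzero[of i], of "i - n"]) auto
      show False
      proof (cases "r \<le> i")
        case True
        then show False using order[of r i] r wedge_commute[of "z r" "z i"] by simp
      next
        case False
        then have "0 \<le> wedge (z l) (z r)" using nx_le[of i r] r l by (intro order) (auto simp: l_def)
        then show False using c r(4) \<open>c < 0\<close> by (simp add: zero_le_mult_iff)
      qed
    qed
    have "z ` {i. plus i} \<subseteq> {x. wedge x (z l - z i) \<le> wedge (z i) (z l)}"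
      using edge_supports[OF vi(1)] by (auto simp: l_def)
    then have "v \<in> {x. wedge x (z l - z i) \<le> wedge (z i) (z l)}"
      using Q(2) v convex_hull_wedge_le by blast
    then have sum: "wedge v (z l) + wedge (z i) v \<le> wedge (z i) (z l)"
      using wedge_commute[of "z i" v] by (simp add: wedge_linear)
    define \<alpha> \<beta> where "\<alpha> = wedge v (z l) / wedge (z i) (z l)" and "\<beta> = wedge (z i) v / wedge (z i) (z l)"
    have \<alpha>\<beta>: "0 \<le> \<alpha>" "0 \<le> \<beta>" "\<alpha> + \<beta> \<le> 1"
      using vl vi(2) D sum wedge_commute[of "z i" v] by (auto simp: \<alpha>_def \<beta>_def field_simps)
    have "v = (1 / wedge (z i) (z l)) *\<^sub>R (wedge (z i) (z l) *\<^sub>R v)" using D by simp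
    also have "\<dots> = \<alpha> *\<^sub>R z i + \<beta> *\<^sub>R z l"
      unfolding wedge_expand[of "z i" "z l" v] by (simp add: scaleR_add_right \<alpha>_def \<beta>_def)
    finally have "v \<in> convex hull {0, z i, z l}"
      unfolding convex_hull_3 using \<alpha>\<beta> by (intro CollectI exI[of _ "1 - \<alpha> - \<beta>"] exI[of _ \<alpha>] exI[of _ \<beta>]) auto
    then show ?thesis using vi(1) by (auto simp: l_def)
  qed
  then obtain i where i: "plus i" "v \<in> convex hull {0, z i, z (nx i)}" by blast
  obtain t where "a \<le> i + t * (2 * n)" "i + t * (2 * n) < a + 2 * n" by (rule window)
  then show "v \<in> (\<Union>i\<in>{i \<in> {a..<a + 2 * n}. plus i}. convex hull {0, z i, z (nx i)})"
    using i by (intro UN_I[of "i + t * (2 * n)"]) (auto simp: z_multiple plus_multiple nx_multiple)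
qed

text \<open>An upper estimate needs only that the triangles cover \<open>Q\<close>, so overlaps do
  not matter.\<close>

lemma area_fan:
  "2 * area Q \<le> (\<Sum>i\<in>{i \<in> {a..<a + 2 * n}. plus i}. wedge (z i) (z (nx i)))" (is "_ \<le> sum _ ?P")
proof -
  have fin: "finite ?P" by (rule finite_subset[of _ "{a..<a + 2 * n}"]) auto
  have comp: "compact (convex hull {0, z i, z (nx i)})" for i
    by (intro finite_imp_compact_convex_hull) simp
  have "area Q \<le> area (\<Union>i\<in>?P. convex hull {0, z i, z (nx i)})"
    using fan_cover[of a] Q(1) fin comp
    by (intro measure_mono_fmeasurable) (auto simp: lmeasurable_compact fmeasurableD intro!: lmeasurable_compact compact_UN)
  also have "\<dots> \<le> (\<Sum>i\<in>?P. area (convex hull {0, z i, z (nx i)}))"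
    using fin comp by (intro measure_UNION_le) (auto intro: fmeasurableD lmeasurable_compact)
  also have "\<dots> = (\<Sum>i\<in>?P. wedge (z i) (z (nx i)) / 2)"
  proof (intro sum.cong refl)
    fix i assume "i \<in> ?P"
    then have "0 \<le> wedge (z i) (z (nx i))" using nx[of i] nx_less[of i] by (intro order) auto
    then show "area (convex hull {0, z i, z (nx i)}) = wedge (z i) (z (nx i)) / 2"
      by (simp add: area_triangle)
  qed
  finally show ?thesis by (simp flip: sum_divide_distrib)
qed

text \<open>The increment of the wedge with \<open>z (t - 1)\<close> over the step from
  \<open>t\<close> to \<open>t + 1\<close>. By the Monge property it dominates the increment of the
  wedge with an earlier point, at most half a turn back.\<close>

definition gain :: "int \<Rightarrow> real" where
  "gain t = wedge (z (t - 1)) (z (t + 1) - z t)"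

lemma wedge_le_gain:
  assumes "i + 2 \<le> j" "j \<le> i + n"
  shows "wedge (z i) (z j) \<le> wedge (z i) (z (i + 2)) + (\<Sum>t\<in>{i + 2..<j}. gain t)"
  using assms
proof (induction j rule: int_ge_induct)
  case base
  then show ?case by simp
next
  case (step j)
  have "0 \<le> wedge (z (j - 1) - z i) (z (j + 1) - z j)"
    using step.hyps step.prems by (intro outer_point_monge[OF B] outer order) auto
  then have "wedge (z i) (z (j + 1)) - wedge (z i) (z j) \<le> gain j"
    by (simp add: gain_def wedge_linear)
  moreover have "{i + 2..<j + 1} = insert j {i + 2..<j}" using step.hyps by auto
  ultimately show ?case using step.IH step.prems by simp
qed

text \<open>Summing from \<open>i\<close> and subtracting two gains gives one formula for all steps;
  for \<open>nx i = i + 1\<close> it is an equality. The index intervals then tile a period.\<close>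

lemma wedge_nx_le:
  assumes "plus i"
  shows "wedge (z i) (z (nx i)) \<le> wedge (z i) (z (i + 2)) + (\<Sum>t\<in>{i..<nx i}. gain t) - gain i - gain (i + 1)"
proof (cases "nx i = i + 1")
  case True
  have "{i..<i + 1} = {i}" by auto
  then show ?thesis unfolding True by (simp add: gain_def wedge_linear add.assoc)
next
  case False
  then have 2: "i + 2 \<le> nx i" using nx(1)[of i] by simp
  have "{i..<nx i} = insert i (insert (i + 1) {i + 2..<nx i})" using 2 by auto
  then show ?thesis using wedge_le_gain[OF 2] nx_less[OF assms] by simp
qed

text \<open>Exactly one index of each antipodal pair belongs to an original vertex.\<close>

lemma sum_plus:
  fixes h :: "int \<Rightarrow> real"
  assumes h: "\<And>i. h (i + n) = h i"
  shows "(\<Sum>i\<in>{i \<in> {a..<a + 2 * n}. plus i}. h i) = (\<Sum>i\<in>{0..<n}. h i)"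
proof -
  have "{i \<in> {a..<a + 2 * n}. plus i}
      = {i \<in> {a..<a + n}. plus i} \<union> (\<lambda>i. i + n) ` {i \<in> {a..<a + n}. \<not> plus i}" (is "_ = ?R \<union> ?S")
  proof (intro equalityI subsetI)
    fix i assume i: "i \<in> {i \<in> {a..<a + 2 * n}. plus i}"
    show "i \<in> ?R \<union> ?S"
    proof (cases "i < a + n")
      case False
      then have "i - n \<in> {i \<in> {a..<a + n}. \<not> plus i}" using i plus[of "i - n"] by auto
      then show ?thesis by (intro UnI2 image_eqI[of _ _ "i - n"]) auto
    qed (use i in auto)
  next
    fix i assume "i \<in> ?R \<union> ?S"
    then show "i \<in> {i \<in> {a..<a + 2 * n}. plus i}"
    proof
      assume "i \<in> ?S"
      then obtain j where j: "i = j + n" "j \<in> {a..<a + n}" "\<not> plus j" by blast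
      then show ?thesis using plus[of j] n by auto
    qed (use n in auto)
  qed
  moreover have "?R \<inter> ?S = {}" by auto
  moreover have fin: "finite ?R" "finite {i \<in> {a..<a + n}. \<not> plus i}"
    by (rule finite_subset[of _ "{a..<a + n}"]; auto)+
  ultimately have "(\<Sum>i\<in>{i \<in> {a..<a + 2 * n}. plus i}. h i) = sum h ?R + sum h ?S"
    by (simp add: sum.union_disjoint)
  also have "sum h ?S = (\<Sum>i\<in>{i \<in> {a..<a + n}. \<not> plus i}. h i)"
    by (subst sum.reindex) (auto simp: h inj_on_def)
  also have "sum h ?R + \<dots> = sum h {a..<a + n}"
    by (subst sum.union_disjoint[OF fin, symmetric]) (auto intro!: sum.cong)
  also have "\<dots> = sum h {0..<n}" using n h by (intro sum_periodic_shift) auto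
  finally show ?thesis .
qed

lemma sum_edges:
  fixes g :: "int \<Rightarrow> real"
  assumes a: "plus a"
  shows "(\<Sum>i\<in>{i \<in> {a..<a + 2 * n}. plus i}. \<Sum>t\<in>{i..<nx i}. g t) = sum g {a..<a + 2 * n}"
    (is "sum _ ?P = _")
proof -
  have fin: "finite ?P" by (rule finite_subset[of _ "{a..<a + 2 * n}"]) auto
  have "(\<Union>i\<in>?P. {i..<nx i}) = {a..<a + 2 * n}"
  proof (intro equalityI subsetI)
    fix t assume "t \<in> (\<Union>i\<in>?P. {i..<nx i})"
    then obtain i where i: "i \<in> ?P" "i \<le> t" "t < nx i" by auto
    then have "nx i \<le> a + 2 * n" using a plus_period[of a] by (intro nx_le) auto
    then show "t \<in> {a..<a + 2 * n}" using i by auto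
  next
    fix t assume t: "t \<in> {a..<a + 2 * n}"
    define S where "S = {i \<in> {a..t}. plus i}"
    have "a \<in> S" using a t by (simp add: S_def)
    moreover have "finite S" unfolding S_def by (rule finite_subset[of _ "{a..t}"]) auto
    moreover define i where "i = Max S"
    ultimately have i: "i \<in> S" "\<And>j. j \<in> S \<Longrightarrow> j \<le> i" using Max_in[of S] by (blast, simp)
    have "t < nx i"
    proof (rule ccontr)
      assume "\<not> t < nx i"
      then have "nx i \<in> S" using nx[of i] i(1) by (auto simp: S_def)
      then show False using i(2)[of "nx i"] nx(1)[of i] by simp
    qed
    then show "t \<in> (\<Union>i\<in>?P. {i..<nx i})" using i(1) t by (intro UN_I[of i]) (auto simp: S_def)
  qed
  moreover have "(\<Sum>t\<in>(\<Union>i\<in>?P. {i..<nx i}). g t) = (\<Sum>i\<in>?P. \<Sum>t\<in>{i..<nx i}. g t)"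
  proof (rule sum.UNION_disjoint[OF fin])
    have disj: "{i..<nx i} \<inter> {j..<nx j} = {}" if "i \<in> ?P" "j \<in> ?P" "i < j" for i j
      using nx_le[of i j] that by auto
    show "\<forall>i\<in>?P. \<forall>j\<in>?P. i \<noteq> j \<longrightarrow> {i..<nx i} \<inter> {j..<nx j} = {}"
    proof (intro ballI impI)
      fix i j assume ij: "i \<in> ?P" "j \<in> ?P" "i \<noteq> j"
      then consider "i < j" | "j < i" by linarith
      then show "{i..<nx i} \<inter> {j..<nx j} = {}"
        using disj[OF ij(1,2)] disj[OF ij(2,1)] by cases blast+
    qed
  qed simp
  ultimately show ?thesis by simp
qed

text \<open>The gains cancel: the tiling intervals contribute each of them twice in a full period,
  and the two subtracted sums remove it once each.\<close>

theorem area_le_double_step: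
  "2 * area Q \<le> (\<Sum>i\<in>{0..<n}. wedge (z i) (z (i + 2)))"
proof -
  obtain a where a: "plus a" using nx(2) by blast
  let ?P = "{i \<in> {a..<a + 2 * n}. plus i}"
  have zn: "z (i + n + k) = - z (i + k)" for i k
    using antiperiodicD[OF z, of "i + k"] by (simp add: algebra_simps)
  have gper: "gain (t + n) = gain t" for t
    using zn[of t "-1"] zn[of t 1] zn[of t 0] by (simp add: gain_def wedge_linear)
  have gper': "gain (t + n + 1) = gain (t + 1)" for t
    using gper[of "t + 1"] by (simp add: algebra_simps)
  define G where "G = sum gain {0..<n}"
  have G1: "(\<Sum>i\<in>{0..<n}. gain (i + 1)) = G"
  proof -
    have "(\<Sum>i\<in>{0..<n}. gain (i + 1)) = sum gain {1..<1 + n}"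
      by (rule sum.reindex_bij_witness[where j = "\<lambda>s. s + 1" and i = "\<lambda>s. s - 1"]) auto
    then show ?thesis using sum_periodic_shift[of n gain 1] gper n by (simp add: G_def)
  qed
  have G2: "sum gain {a..<a + 2 * n} = 2 * G"
  proof -
    have "{a..<a + 2 * n} = {a..<a + n} \<union> {a + n..<a + n + n}" using n by auto
    then have "sum gain {a..<a + 2 * n} = sum gain {a..<a + n} + sum gain {a + n..<a + n + n}"
      by (simp add: sum.union_disjoint)
    then show ?thesis
      using sum_periodic_shift[of n gain a] sum_periodic_shift[of n gain "a + n"] gper n
      by (simp add: G_def)
  qed
  have "2 * area Q \<le> (\<Sum>i\<in>?P. wedge (z i) (z (nx i)))" by (rule area_fan)
  also have "\<dots> \<le> (\<Sum>i\<in>?P. wedge (z i) (z (i + 2)) + (\<Sum>t\<in>{i..<nx i}. gain t) - gain i - gain (i + 1))"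
    by (intro sum_mono wedge_nx_le) auto
  also have "\<dots> = (\<Sum>i\<in>?P. wedge (z i) (z (i + 2))) + (\<Sum>i\<in>?P. \<Sum>t\<in>{i..<nx i}. gain t)
      - (\<Sum>i\<in>?P. gain i) - (\<Sum>i\<in>?P. gain (i + 1))"
    by (simp add: sum.distrib sum_subtractf)
  also have "(\<Sum>i\<in>?P. wedge (z i) (z (i + 2))) = (\<Sum>i\<in>{0..<n}. wedge (z i) (z (i + 2)))"
    using zn[of _ 0] zn[of _ 2] by (intro sum_plus) simp
  also have "(\<Sum>i\<in>?P. \<Sum>t\<in>{i..<nx i}. gain t) = 2 * G" using sum_edges[OF a] G2 by simp
  also have "(\<Sum>i\<in>?P. gain i) = G" unfolding G_def using gper by (rule sum_plus)
  also have "(\<Sum>i\<in>?P. gain (i + 1)) = G" unfolding G1[symmetric] using gper' by (rule sum_plus)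
  finally show ?thesis by simp
qed

end

section \<open>Construction of the merged angular order\<close>

lemma outer_point_minus:
  assumes "\<And>x. x \<in> B \<Longrightarrow> - x \<in> B" "outer_point B q"
  shows "outer_point B (- q)"
  unfolding outer_point_def
proof (intro conjI allI impI notI)
  show "- q \<in> B" using assms by (simp add: outer_point_def)
  fix c :: real assume "1 < c" "c *\<^sub>R (- q) \<in> B"
  then show False using assms(1)[of "c *\<^sub>R (- q)"] assms(2) by (simp add: outer_point_def)
qed

lemma outer_point_exists:
  assumes B: "compact B" and v: "v \<in> B" "v \<noteq> 0"
  shows "\<exists>c\<ge>1. outer_point B (c *\<^sub>R v)"
proof -
  define T where "T = {c. c *\<^sub>R v \<in> B}"
  obtain b where b: "\<And>x. x \<in> B \<Longrightarrow> norm x \<le> b"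
    using compact_imp_bounded[OF B] by (auto simp: bounded_iff)
  have "T \<subseteq> {- (b / norm v)..b / norm v}"
  proof
    fix c assume "c \<in> T"
    then have "\<bar>c\<bar> * norm v \<le> b" using b[of "c *\<^sub>R v"] by (simp add: T_def)
    then have "\<bar>c\<bar> \<le> b / norm v" using v by (simp add: field_simps)
    then show "c \<in> {- (b / norm v)..b / norm v}" by auto
  qed
  moreover have "closed T"
  proof -
    have "T = (\<lambda>c. c *\<^sub>R v) -` B" by (auto simp: T_def)
    then show ?thesis
      using compact_imp_closed[OF B] by (simp add: closed_vimage continuous_intros)
  qed
  ultimately have "compact T"
    by (meson bounded_closed_interval bounded_subset compact_eq_bounded_closed)
  moreover have "1 \<in> T" using v by (simp add: T_def)
  ultimately obtain c where c: "c \<in> T" "\<And>d. d \<in> T \<Longrightarrow> d \<le> c"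
    using compact_attains_sup[of T] by blast
  have c1: "1 \<le> c" using c(2) \<open>1 \<in> T\<close> by blast
  have "outer_point B (c *\<^sub>R v)"
    unfolding outer_point_def
  proof (intro conjI allI impI notI)
    show "c *\<^sub>R v \<in> B" using c(1) by (simp add: T_def)
    fix d :: real assume d: "1 < d" "d *\<^sub>R c *\<^sub>R v \<in> B"
    then have "d * c \<le> c" using c(2)[of "d * c"] by (simp add: T_def)
    then show False using d c1 by simp
  qed
  with c1 show ?thesis by blast
qed

text \<open>Repeating an element pads the vertex list, so the half-period of the cycle is exactly
  \<open>k\<close>.\<close>

lemma exists_list_of_length:
  assumes "finite V" "V \<noteq> {}" "card V \<le> k"
  obtains vs where "set vs = V" "length vs = k"
proof -
  obtain xs where xs: "set xs = V" "distinct xs" using finite_distinct_list[OF assms(1)] by blast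
  have "length xs \<le> k" using distinct_card[OF xs(2)] xs(1) assms(3) by simp
  moreover have "hd xs \<in> V" using xs(1) assms(2) by (metis hd_in_set set_empty)
  ultimately show ?thesis
    by (intro that[of "xs @ replicate (k - length xs) (hd xs)"])
       (auto simp: xs(1) set_replicate_conv_if)
qed

lemma exists_transversal_direction:
  assumes "finite V" "0 \<notin> V"
  obtains u :: "real^2" where "\<And>v. v \<in> V \<Longrightarrow> wedge u v \<noteq> 0"
proof -
  have "finite ((\<lambda>v. v$2 / v$1) ` V)" using assms(1) by simp
  then obtain t where t: "t \<notin> (\<lambda>v. v$2 / v$1) ` V" using ex_new_if_finite infinite_UNIV_char_0 by blast
  show ?thesis
  proof (rule that[of "vector [1, t]"])
    fix v assume v: "v \<in> V"
    show "wedge (vector [1, t]) v \<noteq> 0"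
    proof
      assume w: "wedge (vector [1, t]) v = 0"
      have "v \<noteq> 0" using v assms(2) by auto
      with w have "v$1 \<noteq> 0" by (auto simp: wedge_def vec2_eq_iff)
      then have "t = v$2 / v$1" using w by (simp add: wedge_def field_simps)
      then show False using t v by blast
    qed
  qed
qed

text \<open>The quotient is minus the cotangent of the angle from \<open>u\<close>, increasing on
  the open half turn; sorting by it sorts by angle.\<close>

lemma wedge_nonneg_of_slope_le:
  assumes u: "u \<noteq> 0" and pos: "0 < wedge u x" "0 < wedge u y"
    and le: "- inner u x / wedge u x \<le> - inner u y / wedge u y"
  shows "0 \<le> wedge x y"
proof -
  have "inner u y * wedge u x \<le> inner u x * wedge u y"
    using le pos by (simp add: field_simps)
  moreover have "inner u u * wedge x y = inner u x * wedge u y - inner u y * wedge u x"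
    by (simp add: wedge_def inner_vec_def sum_2 algebra_simps)
  ultimately have "0 \<le> inner u u * wedge x y" by simp
  moreover have "0 < inner u u" using u by simp
  ultimately show ?thesis using zero_le_mult_iff[of "inner u u" "wedge x y"] by linarith
qed

lemma merged_cycle_exists:
  assumes B: "B \<in> symmetric_bodies" and Q: "compact Q" "Q \<subseteq> B" "0 \<in> interior Q"
    and V: "finite V" "card V \<le> k" "Q = convex hull V" "0 \<notin> V" and k: "0 < k"
  obtains z plus where "merged_cycle (int k) z plus B Q"
proof -
  note sym = symmetric_bodiesD[OF B]
  have VB: "V \<subseteq> B" using Q(2) V(3) hull_subset[of V convex] by auto
  have "\<exists>c\<ge>1. outer_point B (c *\<^sub>R v)" if "v \<in> V" for v
    using that VB V(4) by (intro outer_point_exists[OF sym(1)]) auto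
  then obtain c where c: "\<And>v. v \<in> V \<Longrightarrow> 1 \<le> c v" "\<And>v. v \<in> V \<Longrightarrow> outer_point B (c v *\<^sub>R v)" by metis
  define W where "W = (\<lambda>v. c v *\<^sub>R v) ` V"
  have W: "finite W" "card W \<le> k" "\<And>w. w \<in> W \<Longrightarrow> outer_point B w"
    using V(1,2) c(2) card_image_le[OF V(1), of "\<lambda>v. c v *\<^sub>R v"] by (auto simp: W_def)
  have Q0: "0 \<in> Q" using Q(3) interior_subset by blast
  have "V \<noteq> {}" using Q0 V(3) by auto
  then have Wne: "W \<noteq> {}" by (simp add: W_def)
  have W0: "0 \<notin> W" using W(3) outer_point_nonzero by blast
  \<comment> \<open>A functional strictly positive on \<open>W\<close> is strictly positive on
    \<open>V\<close> as well, hence on \<open>Q\<close>, which contains the origin.\<close>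
  have "0 \<in> convex hull W"
  proof (rule ccontr)
    assume "0 \<notin> convex hull W"
    then obtain a b where ab: "0 < b" "\<And>x. x \<in> convex hull W \<Longrightarrow> b < inner a x"
      using separating_hyperplane_closed_0[OF convex_convex_hull compact_imp_closed[OF finite_imp_compact_convex_hull[OF W(1)]]]
      by blast
    have "V \<subseteq> {x. 0 < inner a x}"
    proof
      fix v assume v: "v \<in> V"
      then have "c v *\<^sub>R v \<in> convex hull W" by (auto simp: W_def intro: hull_inc)
      then have "0 < c v * inner a v" using ab by fastforce
      then show "v \<in> {x. 0 < inner a x}" using c(1)[OF v] by (simp add: zero_less_mult_iff)
    qed
    then have "Q \<subseteq> {x. 0 < inner a x}" unfolding V(3) by (intro hull_minimal convex_halfspace_gt)
    then show False using Q0 by auto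
  qed
  \<comment> \<open>Each vertex lies on the segment from the origin to its outward image, so moving
    vertices outward does not shrink the hull.\<close>
  have QW: "Q \<subseteq> convex hull W"
    unfolding V(3)
  proof (intro hull_minimal convex_convex_hull subsetI)
    fix v assume v: "v \<in> V"
    have "c v *\<^sub>R v \<in> convex hull W" using v by (auto simp: W_def intro: hull_inc)
    then have "(1 / c v) *\<^sub>R (c v *\<^sub>R v) + (1 - 1 / c v) *\<^sub>R 0 \<in> convex hull W"
      using \<open>0 \<in> convex hull W\<close> c(1)[OF v] by (intro convexD[OF convex_convex_hull]) auto
    then show "v \<in> convex hull W" using c(1)[OF v] by simp
  qed
  obtain vs where vs: "set vs = W" "length vs = k" by (rule exists_list_of_length[OF W(1) Wne W(2)])
  obtain u where u: "\<And>v. v \<in> W \<Longrightarrow> wedge u v \<noteq> 0" using exists_transversal_direction[OF W(1) W0] by blast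
  have u0: "u \<noteq> 0" using u Wne by auto
  \<comment> \<open>Turns every point into the half-plane to the left of \<open>u\<close> and
    remembers whether it was reflected.\<close>
  define sg where "sg v = (if 0 < wedge u v then (v, True) else (- v, False))" for v
  define \<kappa> where "\<kappa> s = - inner u (fst s) / wedge u (fst s)" for s :: "(real^2) \<times> bool"
  define zs where "zs = sort_key \<kappa> (map sg vs)"
  have len: "length zs = k" by (simp add: zs_def vs)
  have setzs: "set zs = sg ` W" by (simp add: zs_def vs)
  have zsp: "0 < wedge u (fst s)" "outer_point B (fst s)" if "s \<in> set zs" for s
    using that u W(3) outer_point_minus[OF sym(4)] unfolding setzs sg_def by force+
  define f where "f i = fst (zs ! nat i)" for i :: int
  have f: "0 < wedge u (f i)" "outer_point B (f i)" if "0 \<le> i" "i < int k" for i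
    using zsp[of "zs ! nat i"] that len by (auto simp: f_def)
  have ford: "0 \<le> wedge (f i) (f j)" if "0 \<le> i" "i < j" "j < int k" for i j
  proof -
    have "map \<kappa> zs ! nat i \<le> map \<kappa> zs ! nat j"
      using that len by (intro sorted_nth_mono) (auto simp: zs_def)
    then have "\<kappa> (zs ! nat i) \<le> \<kappa> (zs ! nat j)" using that len by simp
    then show ?thesis
      using wedge_nonneg_of_slope_le[OF u0, of "f i" "f j"] f(1) that by (simp add: f_def \<kappa>_def)
  qed
  define z where "z = antiperiodic_extension (int k) f"
  \<comment> \<open>Each half turn negates the points, so it exchanges original and reflected ones;
    hence the parity test.\<close>
  define plus where "plus i \<longleftrightarrow> snd (zs ! nat (i mod int k)) = even (i div int k)" for i :: int
  have ap: "antiperiodic (int k) z" unfolding z_def using k by (intro antiperiodic_extension) simp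
  have "merged_cycle (int k) z plus B Q"
  proof
    show "0 < int k" using k by simp
    show "antiperiodic (int k) z" by (rule ap)
    show "plus (i + int k) \<longleftrightarrow> \<not> plus i" for i using k by (auto simp: plus_def)
    show "0 \<le> wedge (z i) (z j)" if ij: "i \<le> j" "j \<le> i + int k" for i j
    proof -
      consider "i = j" | "j = i + int k" | "i < j" "j < i + int k" using ij by linarith
      then show ?thesis
      proof cases
        case 2
        then show ?thesis using antiperiodicD[OF ap, of i] by simp
      next
        case 3
        then show ?thesis unfolding z_def
          using k ford by (intro wedge_antiperiodic_extension[where P = "\<lambda>x. 0 \<le> x"]) auto
      qed simp
    qed
    show "outer_point B (z i)" for i
      using f(2)[of "i mod int k"] outer_point_minus[OF sym(4)] k
      by (auto simp: z_def antiperiodic_extension_def)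
    show "convex B" "\<And>x. x \<in> B \<Longrightarrow> - x \<in> B" using sym by auto
    show "compact Q" "0 \<in> interior Q" using Q by auto
    have "W \<subseteq> z ` {i. plus i}"
    proof
      fix w assume "w \<in> W"
      then have "sg w \<in> set zs" by (simp add: setzs)
      then obtain j where j: "j < k" "zs ! j = sg w" using len by (auto simp: in_set_conv_nth)
      have zj: "z (int j) = fst (sg w)"
        using j by (simp add: z_def antiperiodic_extension_base f_def)
      show "w \<in> z ` {i. plus i}"
      proof (cases "0 < wedge u w")
        case True
        then have "plus (int j)" "z (int j) = w" using j zj by (auto simp: plus_def sg_def)
        then show ?thesis by blast
      next
        case False
        then have "plus (int j + int k)" "z (int j + int k) = w"
          using j zj antiperiodicD[OF ap, of "int j"] k by (auto simp: plus_def sg_def)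
        then show ?thesis by blast
      qed
    qed
    then show "Q \<subseteq> convex hull (z ` {i. plus i})" using QW hull_mono by blast
  qed
  then show ?thesis by (rule that)
qed

section \<open>The area bound for inscribed polygons\<close>

text \<open>A shift by \<open>m\<close> in the subsequence is a shift by the antiperiod
  \<open>2 * m\<close> of \<open>z\<close>. Scaling by \<open>1 / sqrt M\<close> divides all wedges
  by \<open>M\<close>, so the configuration becomes admissible.\<close>

lemma half_area_subsequence_le:
  fixes z :: "int \<Rightarrow> real^2"
  assumes m: "m \<ge> 1" and z: "antiperiodic (2 * m) z" and M: "0 < M"
    and order: "\<And>i j. i \<le> j \<Longrightarrow> j \<le> i + 2 * m \<Longrightarrow> 0 \<le> wedge (z i) (z j)"
    and le: "\<And>i j. wedge (z i) (z j) \<le> M"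
  shows "(\<Sum>j\<in>{0..<m}. wedge (z (2 * j + r)) (z (2 * j + r + 2))) \<le> odd_gon_bound m * M"
proof -
  define p where "p j = (1 / sqrt M) *\<^sub>R z (2 * j + r)" for j
  have wp: "wedge (p i) (p j) = wedge (z (2 * i + r)) (z (2 * j + r)) / M" for i j
    using M by (simp add: p_def flip: real_sqrt_mult)
  have "admissible m p"
    unfolding admissible_def
  proof (intro conjI allI impI)
    show "antiperiodic m p"
      unfolding antiperiodic_def
    proof
      fix j
      have shift: "2 * (j + m) + r = (2 * j + r) + 2 * m" by simp
      show "p (j + m) = - p j" unfolding p_def shift antiperiodicD[OF z] by simp
    qed
    fix i j assume "i < j \<and> j < i + m"
    then show "0 \<le> wedge (p i) (p j)" "wedge (p i) (p j) \<le> 1"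
      unfolding wp using order[of "2 * i + r" "2 * j + r"] le M by (auto simp: field_simps)
  qed
  then have "half_area m p \<le> odd_gon_bound m" using m by (intro half_area_le) auto
  moreover have "half_area m p = (\<Sum>j\<in>{0..<m}. wedge (z (2 * j + r)) (z (2 * j + r + 2))) / M"
    unfolding half_area_def wp sum_divide_distrib by (intro sum.cong refl) (simp add: algebra_simps)
  ultimately show ?thesis using M by (simp add: field_simps)
qed

lemma sum_even_odd:
  fixes h :: "int \<Rightarrow> real"
  assumes "0 \<le> m"
  shows "(\<Sum>i\<in>{0..<2 * m}. h i) = (\<Sum>j\<in>{0..<m}. h (2 * j)) + (\<Sum>j\<in>{0..<m}. h (2 * j + 1))"
  using assms
proof (induction m rule: int_ge_induct)
  case base
  then show ?case by simp
next
  case (step m)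
  have "{0..<2 * (m + 1)} = insert (2 * m + 1) (insert (2 * m) {0..<2 * m})"
    "{0..<m + 1} = insert m {0..<m}" using step.hyps by auto
  then show ?case using step.IH by simp
qed

theorem polygon_area_le:
  assumes B: "B \<in> symmetric_bodies" and Q: "convex_polygon Q" "Q \<subseteq> B" "card (vertices Q) \<le> 2 * m"
    and m: "m \<ge> 1"
    and M: "0 < M" "\<And>u v. u \<in> B \<Longrightarrow> v \<in> B \<Longrightarrow> \<bar>wedge u v\<bar> \<le> M" and area_B: "area B \<le> 4 * M"
  shows "area Q \<le> odd_gon_bound (int m) * M"
proof (cases "0 \<in> interior Q")
  case False
  have "2 * area Q \<le> area B"
    using area_le_half_body[OF B _ _ Q(2) False] Q(1)
    by (simp add: convex_polygon_def polytope_imp_convex polytope_imp_compact)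
  then have "area Q \<le> 2 * M" using area_B by simp
  also have "\<dots> \<le> odd_gon_bound (int m) * M"
    using odd_gon_bound_ge_2[of "int m"] m M by (intro mult_right_mono) auto
  finally show ?thesis .
next
  case True
  have poly: "polytope Q" using Q(1) by (simp add: convex_polygon_def)
  have comp: "compact Q" and conv: "convex Q" using poly by (auto intro: polytope_imp_convex polytope_imp_compact)
  have fin: "finite (vertices Q)"
    unfolding vertices_def using poly by (intro finite_polyhedron_extreme_points polytope_imp_polyhedron)
  have hull: "Q = convex hull (vertices Q)"
    unfolding vertices_def using comp conv by (rule Krein_Milman_Minkowski)
  have v0: "0 \<notin> vertices Q"
    using True extreme_point_not_in_interior by (auto simp: vertices_def)
  \<comment> \<open>With \<open>2 * m\<close> vertices the antiperiod is even, so antipodes share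
    the parity of their index and both parity classes are symmetric 2m-gons. This is where the even
    vertex bound enters.\<close>
  obtain z plus where "merged_cycle (int (2 * m)) z plus B Q"
    using merged_cycle_exists[OF B comp Q(2) True fin Q(3) hull v0] m by auto
  then interpret merged_cycle "2 * int m" z plus B Q by simp
  have zB: "z i \<in> B" for i using outer[of i] by (simp add: outer_point_def)
  have le: "wedge (z i) (z j) \<le> M" for i j using M(2)[OF zB[of i] zB[of j]] by simp
  have m': "1 \<le> int m" using m by simp
  have "2 * area Q \<le> (\<Sum>i\<in>{0..<2 * int m}. wedge (z i) (z (i + 2)))" by (rule area_le_double_step)
  also have "\<dots> = (\<Sum>j\<in>{0..<int m}. wedge (z (2 * j + 0)) (z (2 * j + 0 + 2)))
      + (\<Sum>j\<in>{0..<int m}. wedge (z (2 * j + 1)) (z (2 * j + 1 + 2)))"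
    by (subst sum_even_odd) auto
  also have "\<dots> \<le> odd_gon_bound (int m) * M + odd_gon_bound (int m) * M"
    by (intro add_mono half_area_subsequence_le m' z M order le) auto
  finally show ?thesis by linarith
qed

lemma max_cross_area_exists:
  assumes B: "B \<in> symmetric_bodies"
  obtains x y where "x \<in> B" "y \<in> B" "0 < wedge x y"
    "\<And>u v. u \<in> B \<Longrightarrow> v \<in> B \<Longrightarrow> \<bar>wedge u v\<bar> \<le> wedge x y"
    "area B \<le> 4 * wedge x y" "\<And>S. mass B S = area S / wedge x y"
proof -
  obtain x y where xy: "x \<in> B" "y \<in> B" "0 < wedge x y"
    "\<And>u v. u \<in> B \<Longrightarrow> v \<in> B \<Longrightarrow> \<bar>wedge u v\<bar> \<le> wedge x y"
    "area (max_cross_polytope B) = 2 * wedge x y" by (rule max_wedge_exists[OF B]) blast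
  have "area B \<le> 4 * wedge x y"
    using xy symmetric_bodiesD(1)[OF B] by (intro area_body_le) auto
  moreover have "mass B S = area S / wedge x y" for S by (simp add: mass_def xy(5))
  ultimately show ?thesis using that[OF xy(1-4)] by blast
qed

theorem mu_mass_even_le:
  assumes B: "B \<in> symmetric_bodies" and m: "m \<ge> 1"
  shows "mu_mass (2 * m) B \<le> ereal (odd_gon_bound (int m))"
  unfolding mu_mass_def
proof (intro SUP_least)
  fix Q assume "Q \<in> {Q. convex_polygon Q \<and> Q \<subseteq> B \<and> card (vertices Q) \<le> 2 * m}"
  then have Q: "convex_polygon Q" "Q \<subseteq> B" "card (vertices Q) \<le> 2 * m" by auto
  obtain x y where xy: "0 < wedge x y" "\<And>u v. u \<in> B \<Longrightarrow> v \<in> B \<Longrightarrow> \<bar>wedge u v\<bar> \<le> wedge x y"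
    "area B \<le> 4 * wedge x y" "\<And>S. mass B S = area S / wedge x y"
    by (rule max_cross_area_exists[OF B]) blast
  show "ereal (mass B Q) \<le> ereal (odd_gon_bound (int m))"
    using polygon_area_le[OF B Q m xy(1-3)] by (simp add: xy(4) pos_divide_le_eq[OF xy(1)])
qed

section \<open>Parallelograms\<close>

lemma interior_nonempty_of_area_pos:
  "convex S \<Longrightarrow> 0 < area S \<Longrightarrow> interior S \<noteq> {}"
  using negligible_convex_interior[of S] negligible_imp_measure0[of S] by auto

lemma convex_polygon_hull:
  assumes "finite S" "0 < area (convex hull S)"
  shows "convex_polygon (convex hull S)" "card (vertices (convex hull S)) \<le> card S"
proof -
  show "convex_polygon (convex hull S)"
    unfolding convex_polygon_def polytope_def
    using assms interior_nonempty_of_area_pos[OF convex_convex_hull] by blast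
  have "vertices (convex hull S) \<subseteq> S"
    unfolding vertices_def using extreme_point_of_convex_hull by blast
  then show "card (vertices (convex hull S)) \<le> card S" using assms(1) by (rule card_mono[rotated])
qed

lemma mass_le_mu_mass:
  "convex_polygon Q \<Longrightarrow> Q \<subseteq> B \<Longrightarrow> card (vertices Q) \<le> n \<Longrightarrow> ereal (mass B Q) \<le> mu_mass n B"
  unfolding mu_mass_def by (rule SUP_upper) simp

lemma mu_mass_3_ge_1:
  assumes B: "B \<in> symmetric_bodies"
  shows "1 \<le> mu_mass 3 B"
proof -
  obtain x y where xy: "x \<in> B" "y \<in> B" "0 < wedge x y" "\<And>S. mass B S = area S / wedge x y"
    by (rule max_cross_area_exists[OF B]) blast
  let ?S = "{x, - x, y}"
  have "wedge (- x - x) (y - x) = - 2 * wedge x y" by (simp add: wedge_def algebra_simps)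
  then have area: "area (convex hull ?S) = wedge x y"
    using xy(3) unfolding area_triangle by simp
  have "card ?S \<le> 3" by (simp add: card_insert_if)
  moreover have "convex hull ?S \<subseteq> B"
    using xy symmetric_bodiesD[OF B] by (intro hull_minimal) auto
  ultimately have "ereal (mass B (convex hull ?S)) \<le> mu_mass 3 B"
    using convex_polygon_hull[of ?S] area xy(3) by (intro mass_le_mu_mass) auto
  then show ?thesis using xy(3,4) area by (simp add: one_ereal_def)
qed

lemma mu_mass_ge_2:
  assumes B: "B \<in> symmetric_bodies" and n: "n \<ge> 4"
  shows "2 \<le> mu_mass n B"
proof -
  obtain x y where xy: "x \<in> B" "y \<in> B" "0 < wedge x y" "\<And>S. mass B S = area S / wedge x y"
    by (rule max_cross_area_exists[OF B]) blast
  let ?S = "{x, - x, y, - y}"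
  have area: "area (convex hull ?S) = 2 * wedge x y"
    using xy(3) by (simp add: area_cross_polytope)
  have "card ?S \<le> n" using n by (simp add: card_insert_if)
  moreover have "convex hull ?S \<subseteq> B"
    using xy symmetric_bodiesD[OF B] by (intro hull_minimal) auto
  ultimately have "ereal (mass B (convex hull ?S)) \<le> mu_mass n B"
    using convex_polygon_hull[of ?S] area xy(3) by (intro mass_le_mu_mass) auto
  then show ?thesis using xy(3,4) area by simp
qed

text \<open>A nonempty compact set has at most one centre. Composing the two reflections translates
  by \<open>d + d\<close>, which would carry a point of \<open>K\<close> extreme in direction
  \<open>d\<close> beyond itself.\<close>

lemma symmetric_translation_zero:
  fixes d :: "'a::real_inner"
  assumes K: "compact K" "K \<noteq> {}" and KB: "uminus ` K = K" "uminus ` ((+) d ` K) = (+) d ` K"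
  shows "d = 0"
proof -
  have "\<exists>x\<in>K. \<forall>y\<in>K. inner d y \<le> inner d x"
    by (intro continuous_attains_sup K continuous_intros)
  then obtain x where x: "x \<in> K" "\<And>y. y \<in> K \<Longrightarrow> inner d y \<le> inner d x" by blast
  have "- (d + x) \<in> (+) d ` K" using x(1) KB(2) by blast
  then obtain k where k: "k \<in> K" "- (d + x) = d + k" by blast
  have "- k \<in> K" using k(1) KB(1) by blast
  moreover have "k = - (d + x) - d" using k(2) by (metis add_diff_cancel_left')
  then have "- k = d + d + x" by simp
  ultimately have "inner d (d + d + x) \<le> inner d x" using x(2) by simp
  then have "inner d d \<le> 0" by (simp add: inner_add_right)
  then show ?thesis by (metis inner_eq_zero_iff inner_ge_zero order_antisym)
qed

lemma uminus_convex_hull: "uminus ` (convex hull S) = convex hull (uminus ` S)"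
  for S :: "'a::real_vector set"
  by (rule convex_hull_linear_image) (auto intro: linearI)

lemma parallelogram_symmetric:
  assumes B: "B \<in> symmetric_bodies" and par: "parallelogram B"
  obtains x y where "B = convex hull {x, - x, y, - y}"
proof -
  obtain p u v where B_eq: "B = convex hull {p, p + u, p + u + v, p + v}"
    using par by (auto simp: parallelogram_def)
  \<comment> \<open>The centre and the two half diagonals.\<close>
  define d x y where "d = p + (1/2) *\<^sub>R (u + v)" and "x = (1/2) *\<^sub>R (u + v)" and "y = (1/2) *\<^sub>R (u - v)"
  define K where "K = convex hull {x, - x, y, - y}"
  have corners: "p = d + - x" "p + u = d + y" "p + u + v = d + x" "p + v = d + - y"
    by (simp_all add: d_def x_def y_def vec2_eq_iff field_simps)
  have "{p, p + u, p + u + v, p + v} = (+) d ` {x, - x, y, - y}"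
    by (simp only: image_insert image_empty corners[symmetric]) auto
  then have BK: "B = (+) d ` K" unfolding B_eq K_def by (simp only: convex_hull_translation)
  have "uminus ` {x, - x, y, - y} = {x, - x, y, - y}" by auto
  then have K: "uminus ` K = K" by (simp add: K_def uminus_convex_hull)
  have "d = 0"
  proof (rule symmetric_translation_zero)
    show "compact K" unfolding K_def by (intro finite_imp_compact_convex_hull) simp
    show "K \<noteq> {}" by (simp add: K_def)
    show "uminus ` K = K" by (rule K)
    show "uminus ` ((+) d ` K) = (+) d ` K" using B unfolding BK by (simp add: symmetric_bodies_def)
  qed
  then have "B = convex hull {x, - x, y, - y}" using BK by (simp add: K_def)
  then show ?thesis by (rule that)
qed

text \<open>The determinant is linear in the first coordinates, with the differences of the second
  coordinates as coefficients. The absolute values of these differences sum to twice the range of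
  three numbers in [-1, 1].\<close>

lemma square_triangle_bound:
  fixes a1 a2 b1 b2 c1 c2 :: real
  assumes "\<bar>a1\<bar> \<le> 1" "\<bar>a2\<bar> \<le> 1" "\<bar>b1\<bar> \<le> 1" "\<bar>b2\<bar> \<le> 1" "\<bar>c1\<bar> \<le> 1" "\<bar>c2\<bar> \<le> 1"
  shows "\<bar>(b1 - a1) * (c2 - a2) - (b2 - a2) * (c1 - a1)\<bar> \<le> 4"
proof -
  have prod: "\<bar>s * t\<bar> \<le> \<bar>t\<bar>" if "\<bar>s\<bar> \<le> 1" for s t :: real
    using that mult_right_mono[of "\<bar>s\<bar>" 1 "\<bar>t\<bar>"] by (simp add: abs_mult)
  have "(b1 - a1) * (c2 - a2) - (b2 - a2) * (c1 - a1)
      = a1 * (b2 - c2) + b1 * (c2 - a2) + c1 * (a2 - b2)" by (simp add: algebra_simps)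
  moreover have "\<bar>b2 - c2\<bar> + \<bar>c2 - a2\<bar> + \<bar>a2 - b2\<bar> \<le> 4" using assms by linarith
  ultimately show ?thesis
    using prod[OF assms(1), of "b2 - c2"] prod[OF assms(3), of "c2 - a2"] prod[OF assms(5), of "a2 - b2"]
    by linarith
qed

lemma triangle_in_cross_polytope:
  assumes abc: "a \<in> convex hull {x, - x, y, - y}" "b \<in> convex hull {x, - x, y, - y}" "c \<in> convex hull {x, - x, y, - y}"
  shows "area (convex hull {a, b, c}) \<le> \<bar>wedge x y\<bar>"
proof -
  define e f where "e = (1/2) *\<^sub>R (x + y)" and "f = (1/2) *\<^sub>R (x - y)"
  have ef: "\<bar>wedge e f\<bar> = \<bar>wedge x y\<bar> / 2"
    using wedge_commute[of y x] by (simp add: e_def f_def wedge_linear)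
  from abc obtain a' b' c' where
    pts: "a = span_map e f a'" "b = span_map e f b'" "c = span_map e f c'"
    and sq: "a' \<in> cbox (-1) 1" "b' \<in> cbox (-1) 1" "c' \<in> cbox (-1) 1"
    unfolding cross_polytope_eq_span_map e_def f_def by blast
  have "wedge (b - a) (c - a)
      = wedge e f * ((b'$1 - a'$1) * (c'$2 - a'$2) - (b'$2 - a'$2) * (c'$1 - a'$1))"
    unfolding pts by (simp add: span_map_def wedge_def algebra_simps)
  moreover have "\<bar>(b'$1 - a'$1) * (c'$2 - a'$2) - (b'$2 - a'$2) * (c'$1 - a'$1)\<bar> \<le> 4"
    using sq by (intro square_triangle_bound) (auto simp: mem_box_cart forall_2 abs_le_iff)
  ultimately have "\<bar>wedge (b - a) (c - a)\<bar> \<le> \<bar>wedge e f\<bar> * 4"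
    by (simp add: abs_mult mult_left_mono)
  then show ?thesis by (simp add: area_triangle ef)
qed

lemma mu_mass_parallelogram_le:
  assumes B: "B \<in> symmetric_bodies" and par: "parallelogram B"
  shows "mu_mass n B \<le> 2" "mu_mass 3 B \<le> 1"
proof -
  obtain x y where Bxy: "B = convex hull {x, - x, y, - y}" by (rule parallelogram_symmetric[OF B par])
  obtain u v where uv: "0 < wedge u v" "\<And>s t. s \<in> B \<Longrightarrow> t \<in> B \<Longrightarrow> \<bar>wedge s t\<bar> \<le> wedge u v"
    "\<And>S. mass B S = area S / wedge u v"
    by (rule max_cross_area_exists[OF B]) blast
  have xyB: "x \<in> B" "y \<in> B" unfolding Bxy by (auto intro: hull_inc)
  have le: "\<bar>wedge x y\<bar> \<le> wedge u v" by (rule uv(2)[OF xyB])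
  have compQ: "compact Q" "convex Q" if "convex_polygon Q" for Q
    using that by (auto simp: convex_polygon_def polytope_imp_compact polytope_imp_convex)
  show "mu_mass n B \<le> 2"
    unfolding mu_mass_def
  proof (intro SUP_least)
    fix Q assume "Q \<in> {Q. convex_polygon Q \<and> Q \<subseteq> B \<and> card (vertices Q) \<le> n}"
    then have "area Q \<le> area B"
      using compQ(1) symmetric_bodiesD(1)[OF B]
      by (intro measure_mono_fmeasurable) (auto simp: lmeasurable_compact fmeasurableD)
    also have "area B \<le> 2 * wedge u v" using le unfolding Bxy area_cross_polytope by simp
    finally have "mass B Q \<le> 2" by (simp add: uv(3) pos_divide_le_eq[OF uv(1)])
    then show "ereal (mass B Q) \<le> 2" by (metis ereal_less_eq(3) numeral_eq_ereal)
  qed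
  show "mu_mass 3 B \<le> 1"
    unfolding mu_mass_def
  proof (intro SUP_least)
    fix Q assume "Q \<in> {Q. convex_polygon Q \<and> Q \<subseteq> B \<and> card (vertices Q) \<le> 3}"
    then have Q: "convex_polygon Q" "Q \<subseteq> B" "card (vertices Q) \<le> 3" by auto
    have hull: "Q = convex hull (vertices Q)"
      unfolding vertices_def using compQ[OF Q(1)] by (rule Krein_Milman_Minkowski)
    have fin: "finite (vertices Q)"
      unfolding vertices_def using Q(1)
      by (intro finite_polyhedron_extreme_points polytope_imp_polyhedron) (simp add: convex_polygon_def)
    have "Q \<noteq> {}" using Q(1) by (auto simp: convex_polygon_def)
    then have "vertices Q \<noteq> {}" using hull by auto
    then obtain vs where vs: "set vs = vertices Q" "length vs = 3"
      using exists_list_of_length[OF fin _ Q(3)] by blast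
    then obtain a b c where "vs = [a, b, c]"
      by (auto simp: length_Suc_conv numeral_3_eq_3)
    then have abc: "vertices Q = {a, b, c}" using vs(1) by auto
    then have "a \<in> B" "b \<in> B" "c \<in> B" using Q(2) hull by (auto intro: hull_inc subsetD)
    then have "area Q \<le> \<bar>wedge x y\<bar>"
      using triangle_in_cross_polytope[of a x y b c] hull abc unfolding Bxy by simp
    then have "mass B Q \<le> 1" using le by (simp add: uv(3) pos_divide_le_eq[OF uv(1)])
    then show "ereal (mass B Q) \<le> 1" by (simp add: one_ereal_def)
  qed
qed

lemma symmetric_hull_body:
  assumes "finite S" "uminus ` S = S" "0 < area (convex hull S)"
  shows "convex hull S \<in> symmetric_bodies"
  unfolding symmetric_bodies_def
  using assms interior_nonempty_of_area_pos[OF convex_convex_hull assms(3)]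
  by (simp add: finite_imp_compact_convex_hull uminus_convex_hull)

lemma parallelogram_body_exists:
  obtains B where "B \<in> symmetric_bodies" "parallelogram B"
proof -
  define x y :: "real^2" where "x = vector [1, 0]" and "y = vector [0, 1]"
  have w: "wedge x y = 1" by (simp add: wedge_def x_def y_def)
  have "convex hull {x, - x, y, - y} \<in> symmetric_bodies"
    by (rule symmetric_hull_body) (auto simp: area_cross_polytope w)
  moreover have "parallelogram (convex hull {x, - x, y, - y})"
    unfolding parallelogram_def
  proof (intro exI conjI)
    have "wedge (x + y) (x - y) \<noteq> 0" using w wedge_commute[of y x] by (simp add: wedge_linear)
    then have "x + y \<noteq> x - y \<and> independent {x + y, x - y}" unfolding independent_iff_wedge .
    then show "x + y \<noteq> x - y" "independent {x + y, x - y}" by auto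
    have "{- x, - x + (x + y), - x + (x + y) + (x - y), - x + (x - y)} = {x, - x, y, - y}" by auto
    then show "convex hull {x, - x, y, - y}
        = convex hull {- x, - x + (x + y), - x + (x + y) + (x - y), - x + (x - y)}" by simp
  qed
  ultimately show ?thesis by (rule that)
qed

lemma inf_mass_eq:
  assumes ge: "\<And>B. B \<in> symmetric_bodies \<Longrightarrow> c \<le> mu_mass n B"
    and le: "\<And>B. B \<in> symmetric_bodies \<Longrightarrow> parallelogram B \<Longrightarrow> mu_mass n B \<le> c"
  shows "inf_mass n = c \<and> (\<forall>B \<in> symmetric_bodies. parallelogram B \<longrightarrow> mu_mass n B = inf_mass n)"
proof -
  obtain B where B: "B \<in> symmetric_bodies" "parallelogram B" by (rule parallelogram_body_exists)
  have "inf_mass n = c"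
  proof (rule antisym)
    show "inf_mass n \<le> c" unfolding inf_mass_def
      using INF_lower[OF B(1)] le[OF B] by (rule order_trans)
    show "c \<le> inf_mass n" unfolding inf_mass_def by (rule INF_greatest[OF ge])
  qed
  then show ?thesis using ge le by (auto intro: antisym)
qed

section \<open>Regular polygons\<close>

definition circle_point :: "nat \<Rightarrow> real \<Rightarrow> nat \<Rightarrow> real^2" where
  "circle_point N t j = vector [cos (t + 2 * pi * real j / real N), sin (t + 2 * pi * real j / real N)]"

definition regular_hull :: "nat \<Rightarrow> real \<Rightarrow> (real^2) set" where
  "regular_hull N t = convex hull (circle_point N t ` {..<N})"

lemma wedge_circle_point:
  "wedge (circle_point N t i) (circle_point N t j) = sin (2 * pi * (real j - real i) / real N)"
proof -
  have "2 * pi * (real j - real i) / real N = (t + 2 * pi * real j / real N) - (t + 2 * pi * real i / real N)"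
    by (simp add: diff_divide_distrib right_diff_distrib)
  then show ?thesis by (simp only: sin_diff) (simp add: circle_point_def wedge_def)
qed

lemma circle_point_period: "N > 0 \<Longrightarrow> circle_point N t (j + N) = circle_point N t j"
  using sin_periodic[of "t + 2 * pi * real j / real N"] cos_periodic[of "t + 2 * pi * real j / real N"]
  by (simp add: circle_point_def add_divide_distrib distrib_left add.assoc)

lemma circle_point_antipode:
  assumes "N > 0"
  shows "circle_point (2 * N) t (j + N) = - circle_point (2 * N) t j"
proof -
  have eq: "t + 2 * pi * real (j + N) / real (2 * N) = (t + 2 * pi * real j / real (2 * N)) + pi"
    using assms by (simp add: field_simps)
  show ?thesis unfolding circle_point_def eq by (simp add: vec2_eq_iff)
qed

lemma circle_point_in_hull:
  assumes "N > 0"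
  shows "circle_point N t j \<in> regular_hull N t"
proof -
  have "circle_point N t (r + q * N) = circle_point N t r" for r q
  proof (induction q)
    case (Suc q)
    then show ?case using circle_point_period[OF assms, of t "r + q * N"] by (simp add: ac_simps)
  qed simp
  from this[of "j mod N" "j div N"] have "circle_point N t j = circle_point N t (j mod N)" by simp
  then show ?thesis using assms by (auto simp: regular_hull_def intro!: hull_inc)
qed

lemma circle_points_symmetric:
  assumes "N > 0"
  shows "uminus ` circle_point (2 * N) t ` {..<2 * N} = circle_point (2 * N) t ` {..<2 * N}"
    (is "uminus ` ?S = ?S")
proof -
  have sub: "uminus ` ?S \<subseteq> ?S"
  proof clarify
    fix j assume j: "j < 2 * N"
    show "- circle_point (2 * N) t j \<in> ?S"
    proof (cases "j < N")
      case True
      then show ?thesis using circle_point_antipode[OF assms, of t j]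
        by (intro image_eqI[of _ _ "j + N"]) auto
    next
      case False
      then show ?thesis using circle_point_antipode[OF assms, of t "j - N"] j
        by (intro image_eqI[of _ _ "j - N"]) auto
    qed
  qed
  have "?S = uminus ` uminus ` ?S" by (simp add: image_image)
  also have "\<dots> \<subseteq> uminus ` ?S" using sub by (intro image_mono)
  finally show ?thesis using sub by blast
qed

lemma negligible_wedge:
  assumes "a \<noteq> 0"
  shows "negligible {v. wedge v a = 0}"
proof -
  have "{v. wedge v a = 0} = {v. inner (vector [a$2, - a$1]) v = 0}"
    by (auto simp: wedge_def inner_vec_def sum_2 mult.commute)
  moreover have "vector [a$2, - a$1] \<noteq> (0::real^2)" using assms by (auto simp: vec2_eq_iff)
  ultimately show ?thesis by (simp add: negligible_hyperplane)
qed

definition sector :: "nat \<Rightarrow> real \<Rightarrow> nat \<Rightarrow> (real^2) set" where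
  "sector N t i = convex hull {0, circle_point N t i, circle_point N t (i + 1)}"

lemma sin_step_pos: "N \<ge> 3 \<Longrightarrow> 0 < sin (2 * pi / real N)"
  by (intro sin_gt_zero) (auto simp: field_simps)

lemma wedge_circle_point_step:
  "wedge (circle_point N t i) (circle_point N t (i + 1)) = sin (2 * pi / real N)"
  by (simp add: wedge_circle_point)

lemma area_sector: "N \<ge> 3 \<Longrightarrow> area (sector N t i) = sin (2 * pi / real N) / 2"
  using sin_step_pos[of N] by (simp add: sector_def area_triangle wedge_circle_point)

lemma sector_cone:
  assumes N: "N \<ge> 3" and v: "v \<in> sector N t i"
  shows "0 \<le> wedge (circle_point N t i) v" "0 \<le> wedge v (circle_point N t (i + 1))"
proof -
  let ?p = "circle_point N t i" and ?q = "circle_point N t (i + 1)"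
  have pos: "0 \<le> wedge ?p ?q" unfolding wedge_circle_point_step using sin_step_pos[OF N] by simp
  have "sector N t i \<subseteq> {v. wedge v ?p \<le> 0}" "sector N t i \<subseteq> {v. wedge v (- ?q) \<le> 0}"
    unfolding sector_def using pos wedge_commute[of ?q ?p] by (intro convex_hull_wedge_le; simp)+
  then have "wedge v ?p \<le> 0" "wedge v (- ?q) \<le> 0" using v by auto
  then show "0 \<le> wedge ?p v" "0 \<le> wedge v ?q" using wedge_commute[of ?p v] by auto
qed

text \<open>A common point off the two lines is a positive combination of \<open>?p\<close> and
  \<open>?q\<close>. Lying in the cone of sector \<open>j\<close> gives it two sine inequalities in
  \<open>d = j - i\<close>, and one of them fails according to whether \<open>2 * d\<close> is
  below, equal to or above \<open>N\<close>.\<close>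

lemma sectors_almost_disjoint:
  assumes N: "N \<ge> 4" and ij: "i < j" "j < N"
  shows "negligible (sector N t i \<inter> sector N t j)"
proof -
  let ?p = "circle_point N t i" and ?q = "circle_point N t (i + 1)"
  let ?s = "\<lambda>d. sin (2 * pi * d / real N)"
  have N3: "N \<ge> 3" using N by simp
  have s: "0 < wedge ?p ?q" unfolding wedge_circle_point_step using sin_step_pos[OF N3] .
  then have ne: "?p \<noteq> 0" "?q \<noteq> 0" by auto
  have "sector N t i \<inter> sector N t j \<subseteq> {v. wedge v ?p = 0} \<union> {v. wedge v ?q = 0}"
  proof
    fix v assume v: "v \<in> sector N t i \<inter> sector N t j"
    show "v \<in> {v. wedge v ?p = 0} \<union> {v. wedge v ?q = 0}"
    proof (rule ccontr)
      assume no: "v \<notin> {v. wedge v ?p = 0} \<union> {v. wedge v ?q = 0}"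
      define \<alpha> \<beta> where "\<alpha> = wedge v ?q" and "\<beta> = wedge ?p v"
      have ab: "0 < \<alpha>" "0 < \<beta>"
        using sector_cone[OF N3, of v t i] v no wedge_commute[of v ?p] by (auto simp: \<alpha>_def \<beta>_def less_le)
      define d where "d = real j - real i"
      have d: "1 \<le> d" "d + 1 \<le> real N" using ij by (auto simp: d_def)
      have comb: "wedge ?p ?q *\<^sub>R v = \<alpha> *\<^sub>R ?p + \<beta> *\<^sub>R ?q"
        unfolding \<alpha>_def \<beta>_def by (rule wedge_expand)
      have "0 \<le> wedge ?p ?q * wedge (circle_point N t j) v"
        using sector_cone[OF N3, of v t j] v s by simp
      also have "wedge ?p ?q * wedge (circle_point N t j) v = wedge (circle_point N t j) (wedge ?p ?q *\<^sub>R v)"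
        by simp
      also have "\<dots> = \<alpha> * ?s (- d) + \<beta> * ?s (- (d - 1))"
        unfolding comb by (simp add: wedge_linear wedge_circle_point d_def algebra_simps)
      finally have 1: "\<alpha> * ?s d + \<beta> * ?s (d - 1) \<le> 0"
        by (simp only: mult_minus_right sin_minus minus_divide_left[symmetric])
      have "0 \<le> wedge ?p ?q * wedge v (circle_point N t (j + 1))"
        using sector_cone[OF N3, of v t j] v s by simp
      also have "wedge ?p ?q * wedge v (circle_point N t (j + 1)) = wedge (wedge ?p ?q *\<^sub>R v) (circle_point N t (j + 1))"
        by simp
      also have "\<dots> = \<alpha> * ?s (d + 1) + \<beta> * ?s d"
        unfolding comb by (simp add: wedge_linear wedge_circle_point d_def algebra_simps)
      finally have 2: "0 \<le> \<alpha> * ?s (d + 1) + \<beta> * ?s d" .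
      have pos: "0 < ?s x" if "0 < x" "2 * x < real N" for x
        using that N by (intro sin_gt_zero) (auto simp: field_simps)
      have nn: "0 \<le> ?s x" if "0 \<le> x" "2 * x \<le> real N" for x
        using that N by (intro sin_ge_zero) (auto simp: field_simps)
      have neg: "?s x < 0" if "real N < 2 * x" "x < real N" for x
        using that N by (intro sin_lt_zero) (auto simp: field_simps)
      consider "2 * d < real N" | "2 * d = real N" | "real N < 2 * d" by linarith
      then show False
      proof cases
        case 1
        then have "0 < \<alpha> * ?s d" "0 \<le> \<beta> * ?s (d - 1)" using ab d pos[of d] nn[of "d - 1"] by auto
        then show False using \<open>\<alpha> * ?s d + \<beta> * ?s (d - 1) \<le> 0\<close> by linarith
      next
        \<comment> \<open>Here \<open>N >= 4\<close> ensures \<open>d > 1\<close>, so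
          \<open>?s (d - 1)\<close> is positive.\<close>
        case 2
        then have "0 \<le> \<alpha> * ?s d" "0 < \<beta> * ?s (d - 1)" using ab d N nn[of d] pos[of "d - 1"] by auto
        then show False using 1 by linarith
      next
        case 3
        have "?s (d + 1) \<le> 0"
        proof (cases "d + 1 = real N")
          case False
          then show ?thesis using neg[of "d + 1"] d 3 by simp
        qed (use N in simp)
        then have "\<alpha> * ?s (d + 1) \<le> 0" "\<beta> * ?s d < 0"
          using ab d 3 neg[of d] by (auto simp: mult_less_0_iff mult_le_0_iff)
        then show False using 2 by linarith
      qed
    qed
  qed
  then show ?thesis
    using negligible_Un[OF negligible_wedge[OF ne(1)] negligible_wedge[OF ne(2)]] negligible_subset by blast
qed

lemma area_regular_hull_ge:
  assumes N: "N \<ge> 2"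
  shows "real N * sin (pi / real N) \<le> area (regular_hull (2 * N) t)"
proof -
  have N3: "2 * N \<ge> 3" and N4: "2 * N \<ge> 4" and N0: "0 < 2 * N" using N by auto
  have comp: "compact (sector M t i)" for M i
    unfolding sector_def by (intro finite_imp_compact_convex_hull) simp
  have compR: "compact (regular_hull M t)" for M
    unfolding regular_hull_def by (intro finite_imp_compact_convex_hull) simp
  note inh = circle_point_in_hull[OF N0, of t]
  have "0 \<in> regular_hull (2 * N) t"
  proof -
    have "(1/2) *\<^sub>R circle_point (2 * N) t 0 + (1/2) *\<^sub>R circle_point (2 * N) t (0 + N) \<in> regular_hull (2 * N) t"
      using inh unfolding regular_hull_def by (intro convexD[OF convex_convex_hull]) auto
    then show ?thesis using circle_point_antipode[of N t 0] N by simp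
  qed
  then have sub: "sector (2 * N) t i \<subseteq> regular_hull (2 * N) t" for i
    unfolding sector_def using inh
    by (intro hull_minimal) (auto simp: regular_hull_def)
  have "real N * sin (pi / real N) = (\<Sum>i\<in>{..<2 * N}. area (sector (2 * N) t i))"
    by (simp add: area_sector[OF N3])
  also have "\<dots> = area (\<Union>i\<in>{..<2 * N}. sector (2 * N) t i)"
  proof (rule measure_negligible_finite_Union_image[symmetric])
    show "pairwise (\<lambda>i j. negligible (sector (2 * N) t i \<inter> sector (2 * N) t j)) {..<2 * N}"
    proof (rule pairwiseI)
      fix i j assume ij: "i \<in> {..<2 * N}" "j \<in> {..<2 * N}" "i \<noteq> j"
      then consider "i < j" | "j < i" by linarith
      then show "negligible (sector (2 * N) t i \<inter> sector (2 * N) t j)"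
        using sectors_almost_disjoint[OF N4, of i j t] sectors_almost_disjoint[OF N4, of j i t] ij
        by cases (auto simp: Int_commute)
    qed
  qed (auto simp: comp lmeasurable_compact)
  also have "\<dots> \<le> area (regular_hull (2 * N) t)"
    using sub comp compR
    by (intro measure_mono_fmeasurable) (auto simp: lmeasurable_compact fmeasurableD compact_UN)
  finally show ?thesis .
qed

text \<open>For odd \<open>m\<close> no multiple of pi / m is an odd multiple of pi / 2; the nearest
  ones miss it by pi / (2 m). Reflection at pi / 2 and the half turn reduce to angles below pi /
  2.\<close>

lemma abs_sin_odd_le:
  assumes m: "odd m" and a: "a < 2 * m"
  shows "\<bar>sin (pi * real a / real m)\<bar> \<le> cos (pi / (2 * real m))"
proof -
  have m0: "0 < m" using m by (auto intro: Nat.gr0I)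
  have base: "\<bar>sin (pi * real b / real m)\<bar> \<le> cos (pi / (2 * real m))" if b: "2 * b + 1 \<le> m" for b
  proof -
    have "pi * (2 * real b + 1) \<le> pi * real m"
      using b by (intro mult_left_mono) (auto simp flip: of_nat_mult of_nat_Suc of_nat_add simp del: of_nat_mult of_nat_Suc of_nat_add)
    then have le: "pi * real b / real m \<le> pi / 2 - pi / (2 * real m)"
      using m0 by (simp add: field_simps)
    have nn: "0 \<le> pi * real b / real m" by simp
    have pos: "0 < pi / (2 * real m)" using m0 by simp
    have "sin (pi * real b / real m) \<le> sin (pi / 2 - pi / (2 * real m))"
      by (intro sin_monotone_2pi_le; use le nn pos pi_gt_zero in linarith)
    moreover have "0 \<le> sin (pi * real b / real m)" by (intro sin_ge_zero; use le nn pos pi_gt_zero in linarith)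
    ultimately show ?thesis by (simp add: sin_diff)
  qed
  have half: "\<bar>sin (pi * real b / real m)\<bar> \<le> cos (pi / (2 * real m))" if b: "b < m" for b
  proof (cases "2 * b + 1 \<le> m")
    case True
    then show ?thesis by (rule base)
  next
    case False
    then have "2 * (m - b) + 1 \<le> m" using b m by presburger
    moreover have "pi * real b / real m = pi - pi * real (m - b) / real m"
      using b m0 by (simp add: of_nat_diff field_simps)
    ultimately show ?thesis using base[of "m - b"] by (simp add: sin_diff)
  qed
  show ?thesis
  proof (cases "a < m")
    case True
    then show ?thesis by (rule half)
  next
    case False
    then have "pi * real a / real m = pi * real (a - m) / real m + pi"
      using m0 by (simp add: of_nat_diff field_simps)
    then have "sin (pi * real a / real m) = - sin (pi * real (a - m) / real m)"
      by (simp only: sin_add) simp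
    then show ?thesis using half[of "a - m"] False a by simp
  qed
qed

text \<open>The wedge is linear in each argument, so the bound passes from vertices to the hull one
  argument at a time.\<close>

lemma wedge_regular_hull_le:
  assumes m: "odd m" and uv: "u \<in> regular_hull (2 * m) t" "v \<in> regular_hull (2 * m) t"
  shows "\<bar>wedge u v\<bar> \<le> cos (pi / (2 * real m))"
proof -
  let ?w = "circle_point (2 * m) t" and ?c = "cos (pi / (2 * real m))"
  have vert: "wedge (?w i) (?w j) \<le> ?c" if "i < 2 * m" "j < 2 * m" for i j
  proof -
    have "wedge (?w i) (?w j) = sin (pi * (real j - real i) / real m)"
      unfolding wedge_circle_point by simp
    also have "\<dots> \<le> \<bar>sin (pi * real (if i \<le> j then j - i else i - j) / real m)\<bar>"
    proof (cases "i \<le> j")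
      case False
      then have "pi * (real j - real i) / real m = - (pi * real (i - j) / real m)"
        by (simp add: of_nat_diff algebra_simps minus_divide_left[symmetric] diff_divide_distrib)
      then show ?thesis using False by (simp only: sin_minus) simp
    qed (simp add: of_nat_diff)
    also have "\<dots> \<le> ?c" using that by (intro abs_sin_odd_le m) auto
    finally show ?thesis .
  qed
  have half: "wedge x (?w j) \<le> ?c" if "x \<in> regular_hull (2 * m) t" "j < 2 * m" for x j
    using convex_hull_wedge_le[of "?w ` {..<2 * m}" "?w j" ?c] vert that by (auto simp: regular_hull_def)
  have le: "wedge x y \<le> ?c" if "x \<in> regular_hull (2 * m) t" "y \<in> regular_hull (2 * m) t" for x y
  proof -
    have "?w ` {..<2 * m} \<subseteq> {y. wedge y (- x) \<le> ?c}"
      using half[OF that(1)] wedge_commute[of x] by auto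
    from convex_hull_wedge_le[OF this] have "wedge y (- x) \<le> ?c" using that(2) by (auto simp: regular_hull_def)
    then show ?thesis using wedge_commute[of x y] by simp
  qed
  show ?thesis using le[OF uv] le[OF uv(2,1)] wedge_commute[of u v] by simp
qed

lemma wedge_span_map: "wedge (span_map p q u) (span_map p q v) = wedge p q * wedge u v"
  by (simp add: span_map_def wedge_def algebra_simps)

lemma affinely_regular_symmetric:
  assumes B: "B \<in> symmetric_bodies" and reg: "affinely_regular (2 * m) B" and m: "m > 0"
  obtains p q t where "B = span_map p q ` regular_hull (2 * m) t"
proof -
  obtain A :: "real^2^2" and b c r t where B_eq: "B = (\<lambda>x. A *v x + b) ` (convex hull
      ((\<lambda>j. c + r *\<^sub>R circle_point (2 * m) t j) ` {..<2 * m}))"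
    using reg by (auto simp: affinely_regular_def regular_polygon_def circle_point_def)
  define p q where "p = r *\<^sub>R (A *v axis 1 1)" and "q = r *\<^sub>R (A *v axis 2 1)"
  have L: "r *\<^sub>R (A *v x) = span_map p q x" for x
    by (simp add: p_def q_def span_map_def vec2_eq_iff matrix_vector_mult_def sum_2 axis_def algebra_simps)
  define d where "d = A *v c + b"
  define K where "K = span_map p q ` regular_hull (2 * m) t"
  have "convex hull ((\<lambda>j. c + r *\<^sub>R circle_point (2 * m) t j) ` {..<2 * m})
      = (+) c ` (*\<^sub>R) r ` regular_hull (2 * m) t"
    unfolding regular_hull_def convex_hull_scaling[symmetric] convex_hull_translation[symmetric] image_image ..
  then have "B = (\<lambda>x. A *v (c + r *\<^sub>R x) + b) ` regular_hull (2 * m) t"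
    unfolding B_eq by (simp add: image_image)
  also have "\<dots> = (+) d ` K"
    unfolding K_def image_image
    by (intro image_cong refl) (simp add: d_def matrix_vector_right_distrib matrix_vector_mult_scaleR L[symmetric])
  finally have BK: "B = (+) d ` K" .
  have "d = 0"
  proof (rule symmetric_translation_zero)
    show "compact K"
      unfolding K_def regular_hull_def
      by (intro compact_continuous_image linear_continuous_on finite_imp_compact_convex_hull)
        (simp_all add: linear_span_map flip: linear_conv_bounded_linear)
    show "K \<noteq> {}" using circle_point_in_hull[of "2 * m" t 0] m by (auto simp: K_def)
    have "uminus ` K = span_map p q ` uminus ` regular_hull (2 * m) t"
      unfolding K_def image_image by (intro image_cong refl) (simp add: linear_neg[OF linear_span_map])
    then show "uminus ` K = K"
      unfolding regular_hull_def uminus_convex_hull circle_points_symmetric[OF m] K_def .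
    show "uminus ` ((+) d ` K) = (+) d ` K" using B unfolding BK by (simp add: symmetric_bodies_def)
  qed
  then have "B = span_map p q ` regular_hull (2 * m) t" using BK by (simp add: K_def)
  then show ?thesis by (rule that)
qed

text \<open>\<open>B\<close> itself serves as the inscribed polygon. The linear map scales area and
  wedges alike, and m sin (pi / m) divided by cos (pi / (2 m)) is 2 m sin (pi / (2 m)) by the
  double-angle formula.\<close>

lemma mu_mass_affinely_regular_ge:
  assumes B: "B \<in> symmetric_bodies" and reg: "affinely_regular (2 * m) B" and m: "odd m" "m \<ge> 3" and n: "2 * m \<le> n"
  shows "ereal (2 * real m * sin (pi / (2 * real m))) \<le> mu_mass n B"
proof -
  have m0: "0 < m" using m by simp
  obtain p q t where Bpq: "B = span_map p q ` regular_hull (2 * m) t"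
    by (rule affinely_regular_symmetric[OF B reg m0])
  define S where "S = span_map p q ` circle_point (2 * m) t ` {..<2 * m}"
  have BS: "B = convex hull S"
    unfolding Bpq S_def regular_hull_def by (rule convex_hull_linear_image[OF linear_span_map])
  have S: "finite S" "card S \<le> 2 * m"
    unfolding S_def by (auto intro!: order_trans[OF card_image_le] )
  obtain x y where xy: "x \<in> B" "y \<in> B" "0 < wedge x y" "\<And>T. mass B T = area T / wedge x y"
    by (rule max_cross_area_exists[OF B]) blast
  define \<delta> where "\<delta> = \<bar>wedge p q\<bar>"
  have lm: "regular_hull (2 * m) t \<in> lmeasurable"
    unfolding regular_hull_def by (intro lmeasurable_compact finite_imp_compact_convex_hull) simp
  have areaB: "area B = \<delta> * area (regular_hull (2 * m) t)"
    unfolding Bpq \<delta>_def by (rule area_span_map[OF lm])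
  define C where "C = cos (pi / (2 * real m))"
  obtain x' y' where xy': "x' \<in> regular_hull (2 * m) t" "y' \<in> regular_hull (2 * m) t"
    "x = span_map p q x'" "y = span_map p q y'" using xy(1,2) unfolding Bpq by blast
  have "wedge x y \<le> \<delta> * \<bar>wedge x' y'\<bar>"
    unfolding xy'(3,4) wedge_span_map \<delta>_def by (simp flip: abs_mult)
  also have "\<dots> \<le> \<delta> * C"
    unfolding C_def \<delta>_def using wedge_regular_hull_le[OF m(1) xy'(1,2)] by (intro mult_left_mono) auto
  finally have le: "wedge x y \<le> \<delta> * C" .
  have \<delta>0: "0 < \<delta>"
  proof -
    have "\<delta> \<noteq> 0" using le xy(3) by auto
    then show ?thesis by (simp add: \<delta>_def)
  qed
  define \<theta> where "\<theta> = pi / (2 * real m)"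
  have th: "0 < \<theta>" "\<theta> < pi / 2" using m by (auto simp: \<theta>_def field_simps)
  have sc: "0 < sin \<theta>" "0 < C" using th by (auto simp: C_def \<theta>_def[symmetric] intro: sin_gt_zero cos_gt_zero)
  have "2 * real m * sin \<theta> * C = real m * (2 * sin \<theta> * cos \<theta>)"
    by (simp add: C_def \<theta>_def)
  also have "2 * sin \<theta> * cos \<theta> = sin (2 * \<theta>)" by (rule sin_double[symmetric])
  also have "2 * \<theta> = pi / real m" by (simp add: \<theta>_def)
  also have "real m * sin (pi / real m) \<le> area (regular_hull (2 * m) t)"
    using m by (intro area_regular_hull_ge) simp
  finally have area_ge: "2 * real m * sin \<theta> * C \<le> area (regular_hull (2 * m) t)" .
  have "2 * real m * sin \<theta> * wedge x y \<le> 2 * real m * sin \<theta> * (\<delta> * C)"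
    using le sc by (intro mult_left_mono) auto
  also have "\<dots> = \<delta> * (2 * real m * sin \<theta> * C)" by simp
  also have "\<dots> \<le> area B" unfolding areaB using area_ge \<delta>0 by (intro mult_left_mono) auto
  finally have mass_ge: "2 * real m * sin \<theta> \<le> mass B B" by (simp add: xy(4) pos_le_divide_eq[OF xy(3)])
  have "0 < 2 * real m * sin \<theta> * C" using sc m0 by simp
  then have "0 < area B" unfolding areaB using order_less_le_trans[OF _ area_ge] \<delta>0 by simp
  then have "convex_polygon B" "card (vertices B) \<le> n"
    using convex_polygon_hull[OF S(1)] S(2) n unfolding BS by auto
  then have "ereal (mass B B) \<le> mu_mass n B" by (intro mass_le_mu_mass) auto
  then show ?thesis using mass_ge unfolding \<theta>_def[symmetric] by (meson ereal_less_eq(3) order_trans)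
qed

lemma regular_body_exists:
  assumes m: "m \<ge> 3"
  obtains B where "B \<in> symmetric_bodies" "affinely_regular (2 * m) B"
proof -
  have "0 < real m * sin (pi / real m)" using m by (intro mult_pos_pos sin_gt_zero) (auto simp: field_simps)
  also have "\<dots> \<le> area (regular_hull (2 * m) 0)" using m by (intro area_regular_hull_ge) simp
  finally have "regular_hull (2 * m) 0 \<in> symmetric_bodies"
    unfolding regular_hull_def using m by (intro symmetric_hull_body circle_points_symmetric) auto
  moreover have "affinely_regular (2 * m) (regular_hull (2 * m) 0)"
    unfolding affinely_regular_def
  proof (intro exI conjI)
    show "invertible (mat 1 :: real^2^2)" by (auto simp: invertible_def intro: exI[of _ "mat 1"])
    show "regular_polygon (2 * m) (regular_hull (2 * m) 0)"
      unfolding regular_polygon_def regular_hull_def circle_point_def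
      using m by (intro conjI exI[of _ 0] exI[of _ 1]) auto
    show "regular_hull (2 * m) 0 = (\<lambda>x. (mat 1 :: real^2^2) *v x + 0) ` regular_hull (2 * m) 0" by simp
  qed
  ultimately show ?thesis by (rule that)
qed

lemma sup_mass_eq:
  fixes c :: ereal
  assumes le: "\<And>B. B \<in> symmetric_bodies \<Longrightarrow> mu_mass n B \<le> c"
    and ge: "\<And>B. B \<in> symmetric_bodies \<Longrightarrow> P B \<Longrightarrow> c \<le> mu_mass n B"
    and ex: "\<exists>B \<in> symmetric_bodies. P B"
  shows "sup_mass n = c \<and> (\<forall>B \<in> symmetric_bodies. P B \<longrightarrow> mu_mass n B = sup_mass n)"
proof -
  obtain B where B: "B \<in> symmetric_bodies" "P B" using ex by blast
  have "sup_mass n = c"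
  proof (rule antisym)
    show "sup_mass n \<le> c" unfolding sup_mass_def by (rule SUP_least[OF le])
    show "c \<le> sup_mass n" unfolding sup_mass_def
      using ge[OF B] SUP_upper[OF B(1)] by (rule order_trans)
  qed
  then show ?thesis using ge le by (auto intro: antisym)
qed

lemma largest_2_mod_4:
  assumes "odd \<mu>" "2 * \<mu> \<le> n" "n < 2 * \<mu> + 4"
  shows "Max {k. 0 < k \<and> k \<le> n \<and> k mod 4 = (2::nat)} = 2 * \<mu>" (is "Max ?S = _")
proof (rule Max_eqI)
  obtain j where j: "\<mu> = 2 * j + 1" using assms(1) by (rule oddE)
  show "finite ?S" by (rule finite_subset[of _ "{..n}"]) auto
  have "2 * \<mu> = 2 + j * 4" using j by simp
  then have "(2 * \<mu>) mod 4 = 2" by (simp only: mod_mult_self1) simp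
  then show "2 * \<mu> \<in> ?S" using assms j by simp
  fix k assume "k \<in> ?S"
  then have k: "k \<le> n" "k mod 4 = 2" by auto
  define i where "i = k div 4"
  have i: "k = 4 * i + 2" using k(2) mult_div_mod_eq[of 4 k] by (simp add: i_def)
  then have "i < j + 1" using k(1) assms(3) j by linarith
  then show "k \<le> 2 * \<mu>" using i j by linarith
qed

theorem theorem5p1:
  fixes n :: nat
  assumes "n \<ge> 3"
  shows "(inf_mass 3 = 1 \<and>
           (\<forall>B \<in> symmetric_bodies. parallelogram B \<longrightarrow> mu_mass 3 B = inf_mass 3)) \<and>
         (n \<ge> 4 \<longrightarrow> inf_mass n = 2 \<and>
           (\<forall>B \<in> symmetric_bodies. parallelogram B \<longrightarrow> mu_mass n B = inf_mass n)) \<and>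
         (sup_mass 4 = 2 \<and> (\<forall>B \<in> symmetric_bodies. mu_mass 4 B = sup_mass 4)) \<and>
         (n \<ge> 6 \<and> even n \<longrightarrow>
           (let n' = Max {k. 0 < k \<and> k \<le> n \<and> k mod 4 = 2} in
             sup_mass n = ereal (real n' * sin (2 * pi / real n') /
                                 (2 * sin ((real n' - 2) * pi / (2 * real n')))) \<and>
             (\<forall>B \<in> symmetric_bodies. affinely_regular n' B \<longrightarrow> mu_mass n B = sup_mass n)))"
proof (intro conjI impI)
  show "inf_mass 3 = 1" "\<forall>B \<in> symmetric_bodies. parallelogram B \<longrightarrow> mu_mass 3 B = inf_mass 3"
    using inf_mass_eq[OF mu_mass_3_ge_1 mu_mass_parallelogram_le(2)] by blast+
  show "inf_mass n = 2" "\<forall>B \<in> symmetric_bodies. parallelogram B \<longrightarrow> mu_mass n B = inf_mass n" if "n \<ge> 4"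
    using inf_mass_eq[OF mu_mass_ge_2[OF _ that] mu_mass_parallelogram_le(1)] by blast+
  \<comment> \<open>For four vertices the upper bound is 2 sin (pi / 2) = 2, which every body
    attains; hence the trivial predicate.\<close>
  have "sup_mass 4 = 2 \<and> (\<forall>B \<in> symmetric_bodies. True \<longrightarrow> mu_mass 4 B = sup_mass 4)"
  proof (rule sup_mass_eq)
    show "mu_mass 4 B \<le> 2" if "B \<in> symmetric_bodies" for B
      using mu_mass_even_le[OF that, of 2] by (simp add: odd_gon_bound_def)
    show "2 \<le> mu_mass 4 B" if "B \<in> symmetric_bodies" for B
      by (rule mu_mass_ge_2[OF that]) simp
    show "\<exists>B \<in> symmetric_bodies. True" using parallelogram_body_exists by blast
  qed
  then show "sup_mass 4 = 2" "\<forall>B \<in> symmetric_bodies. mu_mass 4 B = sup_mass 4" by simp_all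
next
  assume n: "n \<ge> 6 \<and> even n"
  \<comment> \<open>Half of n': the largest odd number not exceeding n / 2.\<close>
  define \<mu> where "\<mu> = (if odd (n div 2) then n div 2 else n div 2 - 1)"
  obtain a where a: "n = 2 * a" using n by (blast elim: evenE)
  then have "\<mu> = (if odd a then a else a - 1)" and a3: "a \<ge> 3" using n by (simp_all add: \<mu>_def)
  then have \<mu>: "odd \<mu>" "\<mu> \<ge> 3" "2 * \<mu> \<le> n" "n < 2 * \<mu> + 4"
    using a by (cases "odd a"; cases "a = 3"; simp)+
  have n': "Max {k. 0 < k \<and> k \<le> n \<and> k mod 4 = 2} = 2 * \<mu>"
    by (rule largest_2_mod_4[OF \<mu>(1,3,4)])
  define \<theta> where "\<theta> = pi / (2 * real \<mu>)"
  have th: "0 < \<theta>" "\<theta> < pi / 2" using \<mu> by (auto simp: \<theta>_def field_simps)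
  \<comment> \<open>The denominator of the closed form is twice cos \<theta>, which cancels against
    sin (2 \<theta>) in the numerator.\<close>
  have "(real (2 * \<mu>) - 2) * pi / (2 * real (2 * \<mu>)) = pi / 2 - \<theta>" "2 * pi / real (2 * \<mu>) = 2 * \<theta>"
    using \<mu> by (auto simp: \<theta>_def field_simps)
  then have closed_form: "real (2 * \<mu>) * sin (2 * pi / real (2 * \<mu>)) / (2 * sin ((real (2 * \<mu>) - 2) * pi / (2 * real (2 * \<mu>))))
      = 2 * real \<mu> * sin (pi / (2 * real \<mu>))"
    using cos_gt_zero[OF th] unfolding \<theta>_def[symmetric] by (simp only: sin_double) (simp add: sin_diff)
  have "odd_gon_bound (int (n div 2)) = 2 * real \<mu> * sin (pi / (2 * real \<mu>))"
    using n by (auto simp: odd_gon_bound_def \<mu>_def Let_def of_nat_diff)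
  then have le: "mu_mass n B \<le> ereal (2 * real \<mu> * sin (pi / (2 * real \<mu>)))" if "B \<in> symmetric_bodies" for B
    using mu_mass_even_le[OF that, of a] a a3 by simp
  have "\<exists>B \<in> symmetric_bodies. affinely_regular (2 * \<mu>) B" using regular_body_exists[OF \<mu>(2)] by blast
  then show "let n' = Max {k. 0 < k \<and> k \<le> n \<and> k mod 4 = 2} in
      sup_mass n = ereal (real n' * sin (2 * pi / real n') / (2 * sin ((real n' - 2) * pi / (2 * real n')))) \<and>
      (\<forall>B \<in> symmetric_bodies. affinely_regular n' B \<longrightarrow> mu_mass n B = sup_mass n)"
    unfolding n' Let_def closed_form
    using sup_mass_eq[OF le mu_mass_affinely_regular_ge[OF _ _ \<mu>(1-3)]] by blast
qed

end
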